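(* Let $B$ be the triangular model (in $H=\mathbf L^2(\Delta;\mathbb C^p)$, $\Delta=[-l,l]$) described in the context, with $B^*=-UBU^*$ for some unitary $U$ on $H$; let $A=bB^3$ with $b\in\mathbb R$, let $X=(A,B;H,\widetilde\Phi,E=\mathbb C^{3m};\sigma_A,\sigma_B,\gamma,\widetilde\gamma)$ be the colligation of the context, and let $T(x,t)=e^{i(tA+xB)}$. Let $\Psi(x,t)=\widetilde\Phi\,T(x,t)\,\widetilde\rho\,\widetilde\Phi^*\sigma_B$ with $\widetilde\rho=U^*\rho=I$. Then $\Psi(x,t)$ has the representation $$\Psi(x,t)\widetilde g=\frac1{2\pi}\int_{|\mu|=r}e^{i\mu}W(t,x,\mu)\,d\mu\;\widehat g,$$ where $$W(t,x,\mu)=I+i\widetilde\Phi\,(tA+xB-\mu I)^{-1}\,\widetilde\Phi^*(t\sigma_A+x\sigma_B)$$ is the complete characteristic function of the colligation $X$, $r>a\sqrt{|t|^2+|x|^2}$ for a suitable constant $a$, $\widehat g=(x\sigma_B+t\sigma_A)^{-1}\sigma_B\widetilde g$, $\widetilde g\in G_B=(B-B^* )H$. Moreover, let $M=\int_0^\infty e^{-i\eta B^*}\rho\frac{B-B^*}{i}e^{i\eta B}d\eta$, $\Gamma(x,t)=T(x,t)+U^*(T(x,t)^* )^{-1}M$, $S=\Gamma^{-1}\Gamma_x$, $g\in G_B$, $h(x,t)=S(x,t)g-iBg$, and $v_f(\xi)=\widetilde\Phi e^{i\xi B}f$ for $f\in H$. Then the generalized Gelfand–Levitan–Marchenko equation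 for the mode $v_h(\xi)=\widetilde\Phi e^{i\xi B}h(x,t)$ has the form (in the case $\widetilde\rho=I$) $$v_h(\xi)=-\frac1{2\pi}\int_0^\infty\Big(\int_{|\mu|=r}e^{i\mu}W(-2t,-2x+\xi+\eta,\mu)d\mu\Big)\big((-2t)\sigma_A+(-2x+\xi+\eta)\sigma_B\big)^{-1}\sigma_Bv_h(\eta)\,d\eta$$ $$\qquad+\frac1{2\pi}\int_{|\mu|=r}e^{i\mu}W(-2t,-2x+\xi,\mu)d\mu\,\big((-2t)\sigma_A+(-2x+\xi)\sigma_B\big)^{-1}\sigma_Bv_g(0).$$
   Context: Conventions. Elements of $\mathbb C^k$ are row vectors and a matrix $K$ defines the operator $h\mapsto hK$. $\mathbb C^{3m}=(\mathbb C^m)^3$. $S(x,t)$ is considered where $\Gamma(x,t)$ is invertible. Triangular model. $1\le p\le m$, $\Delta=[-l,l]$, $H=\mathbf L^2(\Delta;\mathbb C^p)$. $L$ is an invertible Hermitian $m\times m$ matrix with $L=J_1-J_2+S_0+S_0^*$, where $J_1=\begin{pmatrix}I_{r_0}&0\\0&0\end{pmatrix}$, $J_2=\begin{pmatrix}0&0\\0&I_{m-r_0}\end{pmatrix}$, $S_0=\begin{pmatrix}0&0\\ \widehat S&0\end{pmatrix}$ and $r_0$, $m-r_0$ are the numbers of positive and negative eigenvalues of $L$. $\Pi(w)$ is a measurable $p\times m$ matrix function on $\Delta$ whose rows are linearly independent at each point of a set of positive measure, and $\widetilde\Pi(w)=\Pi^*(w)\Pi(w)$ satisfies $\operatorname{tr}\widetilde\Pi(w)=1$,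 $\widetilde\Pi(w)J_1=J_1\widetilde\Pi(w)$ and a Hölder condition $\|\widetilde\Pi(w_1)-\widetilde\Pi(w_2)\|\le C|w_1-w_2|^{\alpha_1}$, $0<\alpha_1\le1$. The operator $B$ (a coupling of a dissipative and an antidissipative operator with absolutely continuous real spectra) is $$Bf(w)=wf(w)-i\int_{-l}^{w}f(\xi)\Pi(\xi)S_0^*\Pi^*(w)d\xi+i\int_w^{l}f(\xi)\Pi(\xi)S_0\Pi^*(w)d\xi+i\int_{-l}^{w}f(\xi)\Pi(\xi)L\Pi^*(w)d\xi .$$ Let $\Phi:H\to\mathbb C^m$, $\Phi f=\int_{\Delta}f(w)\Pi(w)dw$; then $(B-B^* )/i=\Phi^*L\Phi$. Operator $M$. It is defined with $\rho=U$ (so that $\widetilde\rho=U^*\rho=I$), where $\rho$ is assumed to commute with multiplication by the independent variable. It is known that then the integral for $M$ converges strongly and $B^*M-MB=\rho(B^*-B)$. Colligation. $\widetilde\Phi f=(\Phi f,\Phi B^*f,\Phi B^{*2}f)\in\mathbb C^{3m}$, $$\sigma_A=\begin{pmatrix}0&0&bL\\ 0&bL&0\\ bL&0&0\end{pmatrix},\quad \sigma_B=\begin{pmatrix}L&0&0\\0&0&0\\0&0&0\end{pmatrix},\quad \gamma=\begin{pmatrix}0&0&0\\0&0&bL\\0&bL&0\end{pmatrix},$$ $\widetilde\gamma=\gamma+i(\sigma_A\widetilde\Phi\widetilde\Phi^*\sigma_B-\sigma_B\widetilde\Phi\widetilde\Phi^*\sigma_A)$. These satisfy $(A-A^* )/i=\widetilde\Phi^*\sigma_A\widetilde\Phi$,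 $(B-B^* )/i=\widetilde\Phi^*\sigma_B\widetilde\Phi$. *)

theory Defs
  imports "HOL-Complex_Analysis.Complex_Analysis"
begin

unbundle no fps_syntax

text \<open>Conventions. Elements of \<open>complex^'k\<close> are row vectors and a matrix \<open>K\<close> acts by
  \<open>h \<mapsto> h v* K\<close>; operators are composed in the usual order.\<close>

abbreviation rowop :: "complex^'n^'m \<Rightarrow> complex^'m \<Rightarrow> complex^'n"
  where "rowop K h \<equiv> h v* K"

definition hconj :: "complex^'n^'m \<Rightarrow> complex^'m^'n"
  where "hconj K = (\<chi> i j. cnj (K $ j $ i))"

definition vdot :: "complex^'n \<Rightarrow> complex^'n \<Rightarrow> complex"
  where "vdot u v = (\<Sum>i\<in>UNIV. u $ i * cnj (v $ i))"

definition op_matrix :: "(complex^'m \<Rightarrow> complex^'n) \<Rightarrow> complex^'n^'m"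
  where "op_matrix F = (\<chi> i j. F (axis i 1) $ j)"

section \<open>The Hilbert space\<close>

text \<open>A HOL type cannot depend on the real number \<open>l\<close>. We therefore construct the type of
  classes of square integrable functions on the whole line, and realise the space
  of square integrable functions on \<open>{-l..l}\<close> as the subspace \<open>L2on {-l..l}\<close> of the classes
  vanishing almost everywhere outside \<open>{-l..l}\<close>. Operators on the subspace are functions on the
  type of which only the values on the subspace matter; inverses and adjoints are taken
  relative to it.\<close>

definition sq_integrable :: "(real \<Rightarrow> complex^'p) \<Rightarrow> bool"
  where "sq_integrable f \<longleftrightarrow>
    f \<in> borel_measurable lebesgue \<and> integrable lebesgue (\<lambda>w. (norm (f w))\<^sup>2)"

lemma sq_integrable_zero [simp]: "sq_integrable (\<lambda>_. 0)"
  by (simp add: sq_integrable_def)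

lemma sq_integrable_add:
  assumes "sq_integrable f" "sq_integrable g"
  shows "sq_integrable (\<lambda>w. f w + g w)"
  unfolding sq_integrable_def
proof
  have [measurable]: "f \<in> borel_measurable lebesgue" "g \<in> borel_measurable lebesgue"
    using assms by (auto simp: sq_integrable_def)
  show "(\<lambda>w. f w + g w) \<in> borel_measurable lebesgue" by measurable
  have "integrable lebesgue (\<lambda>w. 2 * (norm (f w))\<^sup>2 + 2 * (norm (g w))\<^sup>2)"
    using assms by (auto simp: sq_integrable_def)
  then show "integrable lebesgue (\<lambda>w. (norm (f w + g w))\<^sup>2)"
  proof (rule Bochner_Integration.integrable_bound)
    show "AE w in lebesgue. norm ((norm (f w + g w))\<^sup>2) \<le> norm (2 * (norm (f w))\<^sup>2 + 2 * (norm (g w))\<^sup>2)"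
    proof (rule AE_I2)
      fix w
      have "(norm (f w + g w))\<^sup>2 \<le> (norm (f w) + norm (g w))\<^sup>2"
        by (simp add: norm_triangle_ineq power_mono)
      also have "\<dots> \<le> 2 * (norm (f w))\<^sup>2 + 2 * (norm (g w))\<^sup>2"
        using sum_squares_bound[of "norm (f w)" "norm (g w)"] by (simp add: power2_sum)
      finally show "norm ((norm (f w + g w))\<^sup>2) \<le> norm (2 * (norm (f w))\<^sup>2 + 2 * (norm (g w))\<^sup>2)"
        by simp
    qed
  qed measurable
qed

lemma norm_cmult_vec: "norm (c *s (v :: complex^'p)) = cmod c * norm v"
  by (simp add: norm_vec_def norm_mult L2_set_right_distrib)

lemma borel_measurable_cmult_vec:
  assumes "f \<in> borel_measurable M"
  shows "(\<lambda>w. c *s (f w :: complex^'p)) \<in> borel_measurable M"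
proof (rule borel_measurable_continuous_on[OF _ assms])
  show "continuous_on UNIV (\<lambda>v :: complex^'p. c *s v)"
    unfolding vector_scalar_mult_def by (intro continuous_intros)
qed

lemma sq_integrable_cmult:
  assumes "sq_integrable f" shows "sq_integrable (\<lambda>w. c *s f w)"
  using assms
  by (auto simp: sq_integrable_def norm_cmult_vec power_mult_distrib intro!: borel_measurable_cmult_vec)

lemma sq_integrable_scaleR:
  assumes "sq_integrable f" shows "sq_integrable (\<lambda>w. r *\<^sub>R f w)"
  using assms by (auto simp: sq_integrable_def power_mult_distrib)

quotient_type (overloaded) 'p L2 = "real \<Rightarrow> complex^'p" /
  partial: "\<lambda>f g. sq_integrable f \<and> sq_integrable g \<and> (AE w in lebesgue. f w = g w)"
proof (rule part_equivpI)
  show "\<exists>x::real \<Rightarrow> complex^'p. sq_integrable x \<and> sq_integrable x \<and> (AE w in lebesgue. x w = x w)"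
    by (rule exI[of _ "\<lambda>_. 0"]) simp
qed (auto intro!: sympI transpI elim: eventually_elim2 eventually_mono)

lemma norm_vdot_le: "cmod (vdot u v) \<le> (norm u)\<^sup>2 + (norm v)\<^sup>2"
proof -
  have "cmod (vdot u v) \<le> (\<Sum>i\<in>UNIV. cmod (u $ i) * cmod (v $ i))"
    unfolding vdot_def by (rule order_trans[OF norm_sum]) (simp add: norm_mult)
  also have "\<dots> \<le> (\<Sum>i\<in>UNIV. (cmod (u $ i))\<^sup>2 + (cmod (v $ i))\<^sup>2)"
  proof (rule sum_mono)
    fix i
    have "2 * (cmod (u $ i) * cmod (v $ i)) \<le> (cmod (u $ i))\<^sup>2 + (cmod (v $ i))\<^sup>2"
      using sum_squares_bound[of "cmod (u $ i)" "cmod (v $ i)"] by simp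
    moreover have "0 \<le> cmod (u $ i) * cmod (v $ i)" by simp
    ultimately show "cmod (u $ i) * cmod (v $ i) \<le> (cmod (u $ i))\<^sup>2 + (cmod (v $ i))\<^sup>2" by linarith
  qed
  also have "\<dots> = (norm u)\<^sup>2 + (norm v)\<^sup>2"
    by (simp add: norm_vec_def L2_set_def sum.distrib sum_nonneg)
  finally show ?thesis .
qed

lemma vdot_self: "vdot u u = of_real ((norm u)\<^sup>2)"
  by (simp add: vdot_def norm_vec_def L2_set_def sum_nonneg complex_norm_square del: of_real_power)

lemma integrable_vdot:
  assumes "sq_integrable f" "sq_integrable g"
  shows "integrable lebesgue (\<lambda>w. vdot (f w) (g w))"
proof (rule Bochner_Integration.integrable_bound)
  show "integrable lebesgue (\<lambda>w. (norm (f w))\<^sup>2 + (norm (g w))\<^sup>2)"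
    using assms by (auto simp: sq_integrable_def)
  have [measurable]: "f \<in> borel_measurable lebesgue" "g \<in> borel_measurable lebesgue"
    using assms by (auto simp: sq_integrable_def)
  have [measurable]: "(\<lambda>w. f w $ i) \<in> borel_measurable lebesgue"
       "(\<lambda>w. g w $ i) \<in> borel_measurable lebesgue" for i
    by (auto intro!: borel_measurable_continuous_on[of "\<lambda>v. v $ i"] continuous_intros)
  have [measurable]: "(\<lambda>w. cnj (g w $ i)) \<in> borel_measurable lebesgue" for i
    by (auto intro!: borel_measurable_continuous_on[of cnj] continuous_intros)
  show "(\<lambda>w. vdot (f w) (g w)) \<in> borel_measurable lebesgue"
    unfolding vdot_def by measurable
  show "AE w in lebesgue. norm (vdot (f w) (g w)) \<le> norm ((norm (f w))\<^sup>2 + (norm (g w))\<^sup>2)"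
    by (intro AE_I2) (simp add: norm_vdot_le)
qed

lemma Re_integral_vdot_self:
  "Re (LINT w|lebesgue. vdot (f w) (f w)) = (LINT w|lebesgue. (norm (f w))\<^sup>2)"
  unfolding vdot_self integral_complex_of_real by (rule Re_complex_of_real)

lift_definition cinner :: "'p::finite L2 \<Rightarrow> 'p L2 \<Rightarrow> complex"
  is "\<lambda>f g. LINT w|lebesgue. vdot (f w) (g w)"
proof -
  fix f f' g g' :: "real \<Rightarrow> complex^'p"
  assume a: "sq_integrable f \<and> sq_integrable f' \<and> (AE w in lebesgue. f w = f' w)"
    and b: "sq_integrable g \<and> sq_integrable g' \<and> (AE w in lebesgue. g w = g' w)"
  show "(LINT w|lebesgue. vdot (f w) (g w)) = (LINT w|lebesgue. vdot (f' w) (g' w))"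
  proof (rule integral_cong_AE)
    show "AE w in lebesgue. vdot (f w) (g w) = vdot (f' w) (g' w)"
      using a b by (auto elim!: eventually_elim2)
  qed (use a b in \<open>auto intro: borel_measurable_integrable integrable_vdot\<close>)
qed

lift_definition scaleC :: "complex \<Rightarrow> 'p::finite L2 \<Rightarrow> 'p L2"  (infixr \<open>*\<^sub>C\<close> 75)
  is "\<lambda>c f w. c *s f w"
  by (auto intro: sq_integrable_cmult)

instantiation L2 :: (finite) real_inner
begin

lift_definition zero_L2 :: "'a L2" is "\<lambda>_. 0" by simp

lift_definition plus_L2 :: "'a L2 \<Rightarrow> 'a L2 \<Rightarrow> 'a L2" is "\<lambda>f g w. f w + g w"
  by (auto intro: sq_integrable_add elim!: eventually_elim2)

lift_definition scaleR_L2 :: "real \<Rightarrow> 'a L2 \<Rightarrow> 'a L2" is "\<lambda>r f w. r *\<^sub>R f w"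
  by (auto intro: sq_integrable_scaleR)

definition uminus_L2 :: "'a L2 \<Rightarrow> 'a L2" where "uminus_L2 f = (-1) *\<^sub>R f"
definition minus_L2 :: "'a L2 \<Rightarrow> 'a L2 \<Rightarrow> 'a L2" where "minus_L2 f g = f + (-1) *\<^sub>R g"
definition inner_L2 :: "'a L2 \<Rightarrow> 'a L2 \<Rightarrow> real" where "inner_L2 f g = Re (cinner f g)"
definition norm_L2 :: "'a L2 \<Rightarrow> real" where "norm_L2 f = sqrt (f \<bullet> f)"
definition dist_L2 :: "'a L2 \<Rightarrow> 'a L2 \<Rightarrow> real" where "dist_L2 f g = norm (f - g)"
definition sgn_L2 :: "'a L2 \<Rightarrow> 'a L2" where "sgn_L2 f = inverse (norm f) *\<^sub>R f"
definition uniformity_L2 :: "('a L2 \<times> 'a L2) filter"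
  where "uniformity_L2 = (INF e\<in>{0<..}. principal {(f, g). dist f g < e})"
definition open_L2 :: "'a L2 set \<Rightarrow> bool"
  where "open_L2 S \<longleftrightarrow> (\<forall>f\<in>S. \<forall>\<^sub>F (f', g) in uniformity. f' = f \<longrightarrow> g \<in> S)"

instance
proof
  fix f g h :: "'a L2" and r s :: real
  show "f + g + h = f + (g + h)"
    by transfer (auto simp: add.assoc intro!: sq_integrable_add)
  show "f + g = g + f"
    by transfer (auto simp: add.commute intro!: sq_integrable_add)
  show "0 + f = f"
    by transfer auto
  show "- f + f = 0"
    unfolding uminus_L2_def by transfer (auto intro!: sq_integrable_add sq_integrable_scaleR)
  show "f - g = f + - g"
    by (simp add: minus_L2_def uminus_L2_def)
  show "r *\<^sub>R (f + g) = r *\<^sub>R f + r *\<^sub>R g"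
    by transfer (auto simp: scaleR_add_right intro!: sq_integrable_add sq_integrable_scaleR)
  show "(r + s) *\<^sub>R f = r *\<^sub>R f + s *\<^sub>R f"
    by transfer (auto simp: scaleR_add_left intro!: sq_integrable_add sq_integrable_scaleR)
  show "r *\<^sub>R s *\<^sub>R f = (r * s) *\<^sub>R f"
    by transfer (auto intro!: sq_integrable_scaleR)
  show "1 *\<^sub>R f = f"
    by transfer auto
  show "dist f g = norm (f - g)"
    by (rule dist_L2_def)
  show "sgn f = inverse (norm f) *\<^sub>R f"
    by (rule sgn_L2_def)
  show "(uniformity :: ('a L2 \<times> 'a L2) filter) = (INF e\<in>{0<..}. principal {(x, y). dist x y < e})"
    by (rule uniformity_L2_def)
  show "open S = (\<forall>x\<in>S. \<forall>\<^sub>F (x', y) in uniformity. x' = x \<longrightarrow> y \<in> S)" for S :: "'a L2 set"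
    by (rule open_L2_def)
  show "norm f = sqrt (f \<bullet> f)"
    by (rule norm_L2_def)
  show "f \<bullet> g = g \<bullet> f"
    unfolding inner_L2_def
  proof transfer
    fix f g :: "real \<Rightarrow> complex^'a"
    have "vdot (f w) (g w) = cnj (vdot (g w) (f w))" for w
      by (simp add: vdot_def mult.commute)
    then have "(LINT w|lebesgue. vdot (f w) (g w)) = cnj (LINT w|lebesgue. vdot (g w) (f w))"
      by simp
    then show "Re (LINT w|lebesgue. vdot (f w) (g w)) = Re (LINT w|lebesgue. vdot (g w) (f w))"
      by simp
  qed
  show "(f + g) \<bullet> h = f \<bullet> h + g \<bullet> h"
    unfolding inner_L2_def
  proof transfer
    fix f g h :: "real \<Rightarrow> complex^'a"
    assume "sq_integrable f \<and> sq_integrable f \<and> (AE w in lebesgue. f w = f w)"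
      "sq_integrable g \<and> sq_integrable g \<and> (AE w in lebesgue. g w = g w)"
      "sq_integrable h \<and> sq_integrable h \<and> (AE w in lebesgue. h w = h w)"
    moreover have "vdot (f w + g w) (h w) = vdot (f w) (h w) + vdot (g w) (h w)" for w
      by (simp add: vdot_def distrib_right sum.distrib)
    ultimately show "Re (LINT w|lebesgue. vdot (f w + g w) (h w)) =
        Re (LINT w|lebesgue. vdot (f w) (h w)) + Re (LINT w|lebesgue. vdot (g w) (h w))"
      by (simp add: integrable_vdot)
  qed
  show "(r *\<^sub>R f) \<bullet> g = r * (f \<bullet> g)"
    unfolding inner_L2_def
  proof transfer
    fix r and f g :: "real \<Rightarrow> complex^'a"
    have "vdot (r *\<^sub>R f w) (g w) = r *\<^sub>R vdot (f w) (g w)" for w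
      by (simp add: vdot_def scaleR_sum_right)
    then show "Re (LINT w|lebesgue. vdot (r *\<^sub>R f w) (g w)) = r * Re (LINT w|lebesgue. vdot (f w) (g w))"
      by simp
  qed
  show "0 \<le> f \<bullet> f"
    unfolding inner_L2_def
    by transfer (simp only: Re_integral_vdot_self, rule integral_nonneg_AE, simp)
  show "(f \<bullet> f = 0) = (f = 0)"
    unfolding inner_L2_def
  proof transfer
    fix f :: "real \<Rightarrow> complex^'a"
    assume f: "sq_integrable f \<and> sq_integrable f \<and> (AE w in lebesgue. f w = f w)"
    then have int: "integrable lebesgue (\<lambda>w. (norm (f w))\<^sup>2)"
      by (simp add: sq_integrable_def)
    have "(LINT w|lebesgue. (norm (f w))\<^sup>2) = 0 \<longleftrightarrow> (AE w in lebesgue. (norm (f w))\<^sup>2 = 0)"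
      by (rule integral_nonneg_eq_0_iff_AE[OF int]) simp
    then show "(Re (LINT w|lebesgue. vdot (f w) (f w)) = 0) =
        (sq_integrable f \<and> sq_integrable (\<lambda>_. 0::complex^'a) \<and> (AE w in lebesgue. f w = 0))"
      unfolding Re_integral_vdot_self using f by simp
  qed
qed

end

lift_definition vanishes_off :: "real set \<Rightarrow> 'p::finite L2 \<Rightarrow> bool"
  is "\<lambda>D f. AE w in lebesgue. w \<notin> D \<longrightarrow> f w = 0"
proof -
  fix D and f g :: "real \<Rightarrow> complex^'p"
  assume "sq_integrable f \<and> sq_integrable g \<and> (AE w in lebesgue. f w = g w)"
  then have fg: "AE w in lebesgue. f w = g w" by blast
  show "(AE w in lebesgue. w \<notin> D \<longrightarrow> f w = 0) = (AE w in lebesgue. w \<notin> D \<longrightarrow> g w = 0)"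
  proof
    assume "AE w in lebesgue. w \<notin> D \<longrightarrow> f w = 0"
    with fg show "AE w in lebesgue. w \<notin> D \<longrightarrow> g w = 0" by eventually_elim auto
  next
    assume "AE w in lebesgue. w \<notin> D \<longrightarrow> g w = 0"
    with fg show "AE w in lebesgue. w \<notin> D \<longrightarrow> f w = 0" by eventually_elim auto
  qed
qed

definition L2on :: "real set \<Rightarrow> 'p::finite L2 set"
  where "L2on D = {f. vanishes_off D f}"

section \<open>Operators on a subspace \<open>H\<close>\<close>

definition adj :: "'p::finite L2 set \<Rightarrow> ('p L2 \<Rightarrow> 'p L2) \<Rightarrow> 'p L2 \<Rightarrow> 'p L2"
  where "adj H K g = (THE k. k \<in> H \<and> (\<forall>f\<in>H. cinner (K f) g = cinner f k))"

definition chan_adj :: "'p::finite L2 set \<Rightarrow> ('p L2 \<Rightarrow> complex^'e) \<Rightarrow> complex^'e \<Rightarrow> 'p L2"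
  where "chan_adj H F y = (THE k. k \<in> H \<and> (\<forall>f\<in>H. vdot (F f) y = cinner f k))"

text \<open>Bijectivity is the same as having a bounded inverse for the bounded operators considered
  here.\<close>

definition invertible_on :: "'p::finite L2 set \<Rightarrow> ('p L2 \<Rightarrow> 'p L2) \<Rightarrow> bool"
  where "invertible_on H K \<longleftrightarrow> bij_betw K H H"

definition unitary_on :: "'p::finite L2 set \<Rightarrow> ('p L2 \<Rightarrow> 'p L2) \<Rightarrow> bool"
  where "unitary_on H U \<longleftrightarrow> bij_betw U H H \<and>
    (\<forall>f\<in>H. \<forall>g\<in>H. U (f + g) = U f + U g) \<and> (\<forall>c. \<forall>f\<in>H. U (c *\<^sub>C f) = c *\<^sub>C U f) \<and>
    (\<forall>f\<in>H. \<forall>g\<in>H. cinner (U f) (U g) = cinner f g)"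

definition op_exp :: "('p::finite L2 \<Rightarrow> 'p L2) \<Rightarrow> 'p L2 \<Rightarrow> 'p L2"
  where "op_exp K f = (\<Sum>n. (1 / fact n) *\<^sub>R (K ^^ n) f)"

section \<open>The triangular model\<close>

definition diag_on :: "'m set \<Rightarrow> complex^'m^'m"
  where "diag_on R = (\<chi> i j. if i = j \<and> i \<in> R then 1 else 0)"

definition charpoly :: "complex^'m^'m \<Rightarrow> complex poly"
  where "charpoly K = det (\<chi> i j. (if i = j then [:0, 1:] else 0) - [:K $ i $ j:])"

definition pos_eigs :: "complex^'m^'m \<Rightarrow> nat"
  where "pos_eigs K = (\<Sum>z | poly (charpoly K) z = 0 \<and> z \<in> \<real> \<and> Re z > 0. order z (charpoly K))"

definition neg_eigs :: "complex^'m^'m \<Rightarrow> nat"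
  where "neg_eigs K = (\<Sum>z | poly (charpoly K) z = 0 \<and> z \<in> \<real> \<and> Re z < 0. order z (charpoly K))"

text \<open>The index type \<open>'m\<close> is unordered; \<open>R\<close> is the set of the indices forming the first
  diagonal block, so that \<open>card R\<close> is the number \<open>r\<^sub>0\<close>.\<close>

definition triangular_data ::
  "real \<Rightarrow> 'm set \<Rightarrow> complex^'m^'m \<Rightarrow> complex^'m^'m \<Rightarrow> (real \<Rightarrow> complex^'m^'p) \<Rightarrow> bool"
  where "triangular_data l R L S0 \<pi> \<longleftrightarrow>
    0 < l \<and> CARD('p) \<le> CARD('m) \<and>
    invertible L \<and> hconj L = L \<and>
    L = diag_on R - diag_on (- R) + S0 + hconj S0 \<and>
    (\<forall>i j. \<not> (i \<notin> R \<and> j \<in> R) \<longrightarrow> S0 $ i $ j = 0) \<and>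
    card R = pos_eigs L \<and> card (- R) = neg_eigs L \<and>
    \<pi> \<in> borel_measurable (lebesgue_on {-l..l}) \<and>
    (\<exists>D\<in>sets lebesgue. D \<subseteq> {-l..l} \<and> emeasure lebesgue D > 0 \<and>
      (\<forall>w\<in>D. \<forall>c. (\<Sum>i\<in>UNIV. c $ i *s row i (\<pi> w)) = 0 \<longrightarrow> c = (0 :: complex^'p))) \<and>
    (\<forall>w\<in>{-l..l}. trace (hconj (\<pi> w) ** \<pi> w) = 1) \<and>
    (\<forall>w\<in>{-l..l}. hconj (\<pi> w) ** \<pi> w ** diag_on R = diag_on R ** (hconj (\<pi> w) ** \<pi> w)) \<and>
    (\<exists>C \<alpha>. 0 < \<alpha> \<and> \<alpha> \<le> 1 \<and> (\<forall>w1\<in>{-l..l}. \<forall>w2\<in>{-l..l}.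
      norm (hconj (\<pi> w1) ** \<pi> w1 - hconj (\<pi> w2) ** \<pi> w2) \<le> C * \<bar>w1 - w2\<bar> powr \<alpha>))"

text \<open>\<open>rep_L2\<close> picks a representative and \<open>abs_L2\<close> forms the class; the classes below do not
  depend on the representative.\<close>

definition mult_var :: "real \<Rightarrow> 'p::finite L2 \<Rightarrow> 'p L2"
  where "mult_var l f = abs_L2 (\<lambda>w. if w \<in> {-l..l} then w *\<^sub>R rep_L2 f w else 0)"

definition model_op ::
  "real \<Rightarrow> complex^'m^'m \<Rightarrow> complex^'m^'m \<Rightarrow> (real \<Rightarrow> complex^'m^'p) \<Rightarrow> 'p L2 \<Rightarrow> 'p L2"
  where "model_op l L S0 \<pi> f = abs_L2 (\<lambda>w. if w \<in> {-l..l} then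
      w *\<^sub>R rep_L2 f w
      - \<i> *s (LINT \<xi>:{-l..w}|lebesgue. rep_L2 f \<xi> v* (\<pi> \<xi> ** hconj S0 ** hconj (\<pi> w)))
      + \<i> *s (LINT \<xi>:{w..l}|lebesgue. rep_L2 f \<xi> v* (\<pi> \<xi> ** S0 ** hconj (\<pi> w)))
      + \<i> *s (LINT \<xi>:{-l..w}|lebesgue. rep_L2 f \<xi> v* (\<pi> \<xi> ** L ** hconj (\<pi> w)))
    else 0)"

definition model_chan :: "real \<Rightarrow> (real \<Rightarrow> complex^'m^'p) \<Rightarrow> 'p::finite L2 \<Rightarrow> complex^'m"
  where "model_chan l \<pi> f = (LINT w:{-l..l}|lebesgue. rep_L2 f w v* \<pi> w)"

section \<open>The colligation\<close>

record ('p, 'e) colligation =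
  opA :: "'p L2 \<Rightarrow> 'p L2"
  opB :: "'p L2 \<Rightarrow> 'p L2"
  hspace :: "'p L2 set"
  chan :: "'p L2 \<Rightarrow> complex^'e"
  sigA :: "complex^'e^'e"
  sigB :: "complex^'e^'e"
  gam :: "complex^'e^'e"
  gamt :: "complex^'e^'e"

definition stack3 :: "complex^'m^3 \<Rightarrow> complex^(3 \<times> 'm)"
  where "stack3 v = (\<chi> p. v $ fst p $ snd p)"

definition block3 :: "complex^'m^'m^3^3 \<Rightarrow> complex^(3 \<times> 'm)^(3 \<times> 'm)"
  where "block3 K = (\<chi> p q. K $ fst p $ fst q $ snd p $ snd q)"

definition model_colligation ::
  "real \<Rightarrow> real \<Rightarrow> complex^'m^'m \<Rightarrow> complex^'m^'m \<Rightarrow> (real \<Rightarrow> complex^'m^'p) \<Rightarrow> ('p, 3 \<times> 'm) colligation"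
  where "model_colligation l b L S0 \<pi> =
   (let H = L2on {-l..l};
        B = model_op l L S0 \<pi>;
        A = (\<lambda>f. b *\<^sub>R B (B (B f)));
        \<Phi> = model_chan l \<pi>;
        \<Phi>' = (\<lambda>f. stack3 (vector [\<Phi> f, \<Phi> (adj H B f), \<Phi> (adj H B (adj H B f))]));
        bL = b *\<^sub>R L;
        \<sigma>A = block3 (vector [vector [0, 0, bL], vector [0, bL, 0], vector [bL, 0, 0]]);
        \<sigma>B = block3 (vector [vector [L, 0, 0], vector [0, 0, 0], vector [0, 0, 0]]);
        \<gamma> = block3 (vector [vector [0, 0, 0], vector [0, 0, bL], vector [0, bL, 0]]);
        G = (\<lambda>y. \<Phi>' (chan_adj H \<Phi>' y));
        \<gamma>' = \<gamma> + op_matrix (\<lambda>y. \<i> *s (rowop \<sigma>A (G (rowop \<sigma>B y)) - rowop \<sigma>B (G (rowop \<sigma>A y))))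
    in \<lparr>opA = A, opB = B, hspace = H, chan = \<Phi>', sigA = \<sigma>A, sigB = \<sigma>B, gam = \<gamma>, gamt = \<gamma>'\<rparr>)"

definition pencil :: "('p::finite, 'e::finite) colligation \<Rightarrow> real \<Rightarrow> real \<Rightarrow> complex \<Rightarrow> 'p L2 \<Rightarrow> 'p L2"
  where "pencil X t x \<mu> f = t *\<^sub>R opA X f + x *\<^sub>R opB X f - \<mu> *\<^sub>C f"

definition sig :: "('p::finite, 'e::finite) colligation \<Rightarrow> real \<Rightarrow> real \<Rightarrow> complex^'e^'e"
  where "sig X t x = t *\<^sub>R sigA X + x *\<^sub>R sigB X"

definition char_fun :: "('p::finite, 'e::finite) colligation \<Rightarrow> real \<Rightarrow> real \<Rightarrow> complex \<Rightarrow> complex^'e^'e"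
  where "char_fun X t x \<mu> = mat 1 + op_matrix (\<lambda>y. \<i> *s chan X (inv_into (hspace X) (pencil X t x \<mu>)
    (chan_adj (hspace X) (chan X) (rowop (sig X t x) y))))"

definition char_integral :: "('p::finite, 'e::finite) colligation \<Rightarrow> real \<Rightarrow> real \<Rightarrow> real \<Rightarrow> complex^'e^'e"
  where "char_integral X t x r =
    (\<chi> i j. contour_integral (circlepath 0 r) (\<lambda>\<mu>. exp (\<i> * \<mu>) * char_fun X t x \<mu> $ i $ j))"

definition opT :: "('p::finite, 'e::finite) colligation \<Rightarrow> real \<Rightarrow> real \<Rightarrow> 'p L2 \<Rightarrow> 'p L2"
  where "opT X x t = op_exp (\<lambda>f. \<i> *\<^sub>C (t *\<^sub>R opA X f + x *\<^sub>R opB X f))"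

definition Psi :: "('p::finite, 'e::finite) colligation \<Rightarrow> ('p L2 \<Rightarrow> 'p L2) \<Rightarrow> real \<Rightarrow> real \<Rightarrow> complex^'e \<Rightarrow> complex^'e"
  where "Psi X \<rho>' x t y =
    chan X (opT X x t (\<rho>' (chan_adj (hspace X) (chan X) (rowop (sigB X) y))))"

definition mode :: "('p::finite, 'e::finite) colligation \<Rightarrow> 'p L2 \<Rightarrow> real \<Rightarrow> complex^'e"
  where "mode X f \<xi> = chan X (op_exp (\<lambda>k. (\<i> * \<xi>) *\<^sub>C opB X k) f)"

definition M_integrand :: "('p::finite, 'e::finite) colligation \<Rightarrow> ('p L2 \<Rightarrow> 'p L2) \<Rightarrow> 'p L2 \<Rightarrow> real \<Rightarrow> 'p L2"
  where "M_integrand X \<rho> f \<eta> =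
    (let B = opB X; B' = adj (hspace X) B; k = op_exp (\<lambda>k. (\<i> * \<eta>) *\<^sub>C B k) f
     in op_exp (\<lambda>k. (- \<i> * \<eta>) *\<^sub>C B' k) (\<rho> ((1 / \<i>) *\<^sub>C (B k - B' k))))"

text \<open>The gauge integral over \<open>{0..}\<close> of a function with values in the space is the norm limit of
  the integrals over \<open>{0..N}\<close>, so applied to each \<open>f\<close> this is strong convergence.

  Commutation of \<open>\<rho>\<close> with \<open>mult_var l\<close> is the usual condition ensuring this convergence. For
  \<open>\<rho> = U\<close> with \<open>B\<^sup>* = - U B U\<^sup>*\<close> it can never hold, because twice the (noncompact)
  multiplication operator would then be compact. For \<open>L = 1\<close>, \<open>\<pi> = 1\<close> and the reflection
  \<open>U f(w) = f(-w)\<close>, on the other hand, the integral does converge strongly.\<close>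

definition M_strongly_convergent :: "('p::finite, 'e::finite) colligation \<Rightarrow> ('p L2 \<Rightarrow> 'p L2) \<Rightarrow> bool"
  where "M_strongly_convergent X \<rho> \<longleftrightarrow> (\<forall>f\<in>hspace X. M_integrand X \<rho> f integrable_on {0..})"

definition opM :: "('p::finite, 'e::finite) colligation \<Rightarrow> ('p L2 \<Rightarrow> 'p L2) \<Rightarrow> 'p L2 \<Rightarrow> 'p L2"
  where "opM X \<rho> f = integral {0..} (M_integrand X \<rho> f)"

definition opGamma ::
  "('p::finite, 'e::finite) colligation \<Rightarrow> ('p L2 \<Rightarrow> 'p L2) \<Rightarrow> ('p L2 \<Rightarrow> 'p L2) \<Rightarrow> real \<Rightarrow> real \<Rightarrow> 'p L2 \<Rightarrow> 'p L2"
  where "opGamma X U \<rho> x t f = opT X x t f +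
    adj (hspace X) U (inv_into (hspace X) (adj (hspace X) (opT X x t)) (opM X \<rho> f))"

definition opS ::
  "('p::finite, 'e::finite) colligation \<Rightarrow> ('p L2 \<Rightarrow> 'p L2) \<Rightarrow> ('p L2 \<Rightarrow> 'p L2) \<Rightarrow> real \<Rightarrow> real \<Rightarrow> 'p L2 \<Rightarrow> 'p L2"
  where "opS X U \<rho> x t f = inv_into (hspace X) (opGamma X U \<rho> x t)
    (vector_derivative (\<lambda>y. opGamma X U \<rho> y t f) (at x))"

definition nonhermitian_range :: "('p::finite, 'e::finite) colligation \<Rightarrow> 'p L2 set"
  where "nonhermitian_range X = (\<lambda>f. opB X f - adj (hspace X) (opB X) f) ` hspace X"

end

theory Submission
  imports Defs
begin

text \<open>Write \<open>K = t A + x B\<close>. For \<open>r > \<parallel>K\<parallel>\<close> the resolvent on the circle is the Neumann series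
  \<open>- (\<Sum>n. K^n / \<mu>^(n+1))\<close>, so integrating \<open>e^{i \<mu>} (K - \<mu>)^{-1}\<close> termwise gives
  \<open>- 2 \<pi> i e^{i K}\<close>; between the channel operator \<open>F\<close> and \<open>F\<^sup>* (t \<sigma>\<^sub>A + x \<sigma>\<^sub>B)\<close> this is the
  representation of \<open>\<Psi>\<close>.

  From \<open>B\<^sup>* = - U B U\<^sup>*\<close> one gets \<open>T\<^sup>* = U T U\<^sup>*\<close>, hence \<open>\<Gamma> = T + T^{-1} N\<close> with \<open>N\<close> the integral of
  \<open>\<phi>(\<eta>) = e^{i \<eta> B} C e^{i \<eta> B}\<close>, where \<open>C = (B - B\<^sup>*) / i = F\<^sup>* \<sigma>\<^sub>B F\<close>. Strongly, \<open>\<phi>\<close> and its derivative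
  \<open>i (B \<phi> + \<phi> B)\<close> are both integrable, so \<open>\<phi>\<close> vanishes at infinity and \<open>i (B N + N B) = - C\<close>.
  Therefore \<open>\<Gamma> S = \<Gamma>\<^sub>x\<close> becomes \<open>T h + T^{-1} N h = T^{-1} C g\<close>, and applying \<open>F e^{i \<xi> B} T^{-1}\<close> yields
  the Gelfand-Levitan-Marchenko equation for the mode of \<open>h\<close>.

  The other alternative, that \<open>U\<close> commutes with the multiplication operator \<open>Q\<close>, is contradictory:
  \<open>U\<close> then almost preserves supports, so for \<open>g\<close> concentrated near a point where \<open>Q > 0\<close> the identity
  \<open>Re \<langle>B g, g\<rangle> + Re \<langle>B U g, U g\<rangle> = 0\<close> fails, since the integral part of \<open>B\<close> is negligible on short
  intervals.\<close>

section \<open>The space of square integrable functions\<close>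

text \<open>The relation between \<open>T\<close> and its adjoint rests on parity:
  \<open>t A + x B\<close> contains only odd powers of \<open>B\<close> with real coefficients, so
  it inherits the minus sign of the symmetry, and conjugating the factor i in the exponent removes
  that sign. The derivative of \<open>\<phi>\<close> needs no estimate of its own: its summand
  \<open>\<phi> B\<close> is the same integrand for the vector \<open>i B f\<close>, which again
  lies in \<open>H\<close>, so convergence at every vector of \<open>H\<close> covers it. The main
  technical obstacle is that \<open>H\<close> is a subset of a type, while \<open>U\<close> and the
  adjoints are specified on \<open>H\<close> only. Exponentials are therefore formed from
  \<open>B\<close>, which is bounded on the whole type, and \<open>U\<close> is cut off by the
  projection \<open>P\<close> to total bounded operators. The type has to be complete for
  \<open>exp\<close> to exist in the operator algebra, and free of isolated points for its unit to
  have norm 1. That algebra is real; complex linearity is recorded separately as commutation with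
  scalar operators.\<close>

lemma sq_integrable_rep_L2 [simp]: "sq_integrable (rep_L2 f)"
  using Quotient3_rep_reflp[OF Quotient3_L2] by blast

lemma abs_rep_L2 [simp]: "abs_L2 (rep_L2 f) = f"
  using Quotient3_abs_rep[OF Quotient3_L2] .

lemma abs_L2_eqI:
  assumes "sq_integrable f" "sq_integrable g" "AE w in lebesgue. f w = g w"
  shows "abs_L2 f = abs_L2 g"
  using Quotient3_rel[OF Quotient3_L2, of f g] assms by blast

lemma rep_abs_L2:
  assumes "sq_integrable f" shows "AE w in lebesgue. rep_L2 (abs_L2 f) w = f w"
  using rep_abs_rsp_left[OF Quotient3_L2, of f f] assms by blast

lemma rep_L2_eqI:
  assumes "AE w in lebesgue. rep_L2 f w = rep_L2 g w" shows "f = g"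
  using abs_L2_eqI[OF _ _ assms] by simp

lemma abs_L2_plus:
  assumes "sq_integrable f" "sq_integrable g"
  shows "abs_L2 f + abs_L2 g = abs_L2 (\<lambda>w. f w + g w)"
  using assms by (intro plus_L2.abs_eq) auto

lemma abs_L2_scaleC:
  assumes "sq_integrable f" shows "c *\<^sub>C abs_L2 f = abs_L2 (\<lambda>w. c *s f w)"
  using assms by (intro scaleC.abs_eq) auto

lemma cinner_abs_L2:
  assumes "sq_integrable f" "sq_integrable g"
  shows "cinner (abs_L2 f) (abs_L2 g) = (LINT w|lebesgue. vdot (f w) (g w))"
  using assms by (intro cinner.abs_eq) auto

lemma rep_L2_plus: "AE w in lebesgue. rep_L2 (f + g) w = rep_L2 f w + rep_L2 g w"
  using rep_abs_L2[OF sq_integrable_add[of "rep_L2 f" "rep_L2 g"]] abs_L2_plus[of "rep_L2 f" "rep_L2 g"]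
  by simp

lemma rep_L2_scaleC: "AE w in lebesgue. rep_L2 (c *\<^sub>C f) w = c *s rep_L2 f w"
  using rep_abs_L2[OF sq_integrable_cmult[of "rep_L2 f" c]] abs_L2_scaleC[of "rep_L2 f" c] by simp

lemma norm_abs_L2:
  assumes "sq_integrable f" shows "(norm (abs_L2 f))\<^sup>2 = (LINT w|lebesgue. (norm (f w))\<^sup>2)"
proof -
  have "(norm (abs_L2 f))\<^sup>2 = inner (abs_L2 f) (abs_L2 f)" by (rule power2_norm_eq_inner)
  also have "\<dots> = (LINT w|lebesgue. (norm (f w))\<^sup>2)"
    by (simp add: inner_L2_def cinner_abs_L2 assms Re_integral_vdot_self)
  finally show ?thesis .
qed

lemma norm_rep_L2: "(norm f)\<^sup>2 = (LINT w|lebesgue. (norm (rep_L2 f w))\<^sup>2)"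
  using norm_abs_L2[of "rep_L2 f"] by simp

lemma vdot_commute: "vdot u v = cnj (vdot v u)"
  by (simp add: vdot_def mult.commute)

lemma vdot_add_left: "vdot (u + v) w = vdot u w + vdot v w"
  by (simp add: vdot_def distrib_right sum.distrib)

lemma vdot_cmult_left: "vdot (c *s u) w = c * vdot u w"
  by (simp add: vdot_def sum_distrib_left mult.assoc)

lemma cinner_commute: "cinner f g = cnj (cinner g f)"
proof transfer
  fix f g :: "real \<Rightarrow> complex^'a"
  have "(LINT w|lebesgue. vdot (f w) (g w)) = (LINT w|lebesgue. cnj (vdot (g w) (f w)))"
    by (rule Bochner_Integration.integral_cong[OF refl]) (rule vdot_commute)
  then show "(LINT w|lebesgue. vdot (f w) (g w)) = cnj (LINT w|lebesgue. vdot (g w) (f w))"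
    by simp
qed

lemma cinner_add_left: "cinner (f + g) h = cinner f h + cinner g h"
  by transfer (simp add: vdot_add_left integrable_vdot)

lemma cinner_scaleC_left: "cinner (c *\<^sub>C f) h = c * cinner f h"
  by transfer (simp add: vdot_cmult_left)

lemma cinner_add_right: "cinner h (f + g) = cinner h f + cinner h g"
  by (metis cinner_add_left cinner_commute complex_cnj_add)

lemma cinner_scaleC_right: "cinner h (c *\<^sub>C f) = cnj c * cinner h f"
  by (metis cinner_scaleC_left cinner_commute complex_cnj_mult)

lemma scaleR_scaleC: "r *\<^sub>R f = of_real r *\<^sub>C f"
proof -
  have "r *\<^sub>R v = complex_of_real r *s v" for v :: "complex^'a"
    by (simp add: vec_eq_iff scaleR_conv_of_real[where 'a = complex])
  then show ?thesis
    by transfer (auto simp: sq_integrable_cmult)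
qed

lemma scaleC_add_right: "c *\<^sub>C (f + g) = c *\<^sub>C f + c *\<^sub>C g"
  by transfer (auto simp: vector_add_ldistrib intro!: sq_integrable_cmult sq_integrable_add)

lemma scaleC_scaleC [simp]: "c *\<^sub>C d *\<^sub>C f = (c * d) *\<^sub>C f"
  by transfer (auto simp: vector_smult_assoc intro!: sq_integrable_cmult)

lemma scaleC_one [simp]: "1 *\<^sub>C f = f"
  by transfer auto

lemma scaleC_minus1: "- f = (-1) *\<^sub>C f"
  using scaleR_scaleC[of "-1" f] by simp

lemma scaleC_scaleR: "c *\<^sub>C (r *\<^sub>R f) = r *\<^sub>R (c *\<^sub>C f)"
  by (simp add: scaleR_scaleC mult.commute)

lemma norm_scaleC: "norm (c *\<^sub>C f) = cmod c * norm f"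
proof -
  have "cinner (c *\<^sub>C f) (c *\<^sub>C f) = of_real ((cmod c)\<^sup>2) * cinner f f"
    unfolding complex_norm_square by (simp add: cinner_scaleC_left cinner_scaleC_right)
  then have "inner (c *\<^sub>C f) (c *\<^sub>C f) = (cmod c)\<^sup>2 * inner f f"
    unfolding inner_L2_def by (simp del: of_real_power)
  then show ?thesis
    by (simp add: norm_eq_sqrt_inner real_sqrt_mult)
qed

lemma bounded_linear_scaleC: "bounded_linear (scaleC c)"
  by (rule bounded_linear_intro[of _ "cmod c"])
    (simp_all add: scaleC_add_right scaleC_scaleR norm_scaleC mult.commute)

lemma scaleC_minus_left: "(- c) *\<^sub>C f = - (c *\<^sub>C f)"
  by (simp add: scaleC_minus1[of "c *\<^sub>C f"])

lemma scaleC_minus_right: "c *\<^sub>C (- f) = - (c *\<^sub>C f)"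
  by (rule linear_neg[OF bounded_linear.linear[OF bounded_linear_scaleC]])

lemma scaleC_diff_right: "c *\<^sub>C (f - g) = c *\<^sub>C f - c *\<^sub>C g"
  by (rule linear_diff[OF bounded_linear.linear[OF bounded_linear_scaleC]])

text \<open>Rotating \<open>f\<close> by the unimodular \<open>u\<close> makes the pairing real and
  nonnegative, so the real inequality for \<open>inner\<close> applies.\<close>

lemma Cauchy_Schwarz_cinner: "cmod (cinner f g) \<le> norm f * norm g"
proof (cases "cinner f g = 0")
  case False
  define u where "u = cnj (cinner f g) / cmod (cinner f g)"
  have u: "cmod u = 1" using False by (simp add: u_def norm_divide)
  have "of_real (cmod (cinner f g)) = u * cinner f g"
    using False complex_norm_square[of "cinner f g"] by (simp add: u_def field_simps power2_eq_square)
  then have "cmod (cinner f g) = inner (u *\<^sub>C f) g"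
    unfolding inner_L2_def cinner_scaleC_left by (metis Re_complex_of_real)
  also have "\<dots> \<le> norm (u *\<^sub>C f) * norm g"
    by (rule norm_cauchy_schwarz)
  finally show ?thesis by (simp add: norm_scaleC u)
qed auto

lemma bounded_bilinear_cinner: "bounded_bilinear cinner"
  by standard (auto simp: cinner_add_left cinner_add_right scaleR_scaleC cinner_scaleC_left
      cinner_scaleC_right scaleR_conv_of_real intro!: exI[of _ 1] Cauchy_Schwarz_cinner)

lemmas bounded_linear_cinner_left = bounded_bilinear.bounded_linear_left[OF bounded_bilinear_cinner]
lemmas bounded_linear_cinner_right = bounded_bilinear.bounded_linear_right[OF bounded_bilinear_cinner]

lemma cinner_eqI:
  assumes "\<And>f. f \<in> H \<Longrightarrow> cinner f k = cinner f k'" "k \<in> H" "k' \<in> H" "k - k' \<in> H" 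
  shows "k = k'"
proof -
  have "inner (k - k') (k - k') = 0"
    using assms(1)[OF assms(4)] bounded_bilinear.diff_right[OF bounded_bilinear_cinner, of "k - k'" k k']
    by (simp add: inner_L2_def)
  then show ?thesis by simp
qed

lemma rep_L2_minus: "AE w in lebesgue. rep_L2 (f - g) w = rep_L2 f w - rep_L2 g w"
proof -
  have eq: "f - g = f + (-1) *\<^sub>C g"
    by (simp add: scaleC_minus1[symmetric])
  show ?thesis
    unfolding eq using rep_L2_plus[of f "(-1) *\<^sub>C g"] rep_L2_scaleC[of "-1" g]
    by eventually_elim (simp add: vec_eq_iff)
qed

section \<open>Completeness of the space\<close>

lemma sq_integrable_measurable: "sq_integrable f \<Longrightarrow> f \<in> borel_measurable lebesgue"
  by (simp add: sq_integrable_def)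

text \<open>Translates distances of classes into nonnegative integrals of representatives, the form
  in which Fatou's lemma and the exchange of sum and integral apply.\<close>

lemma nn_integral_rep_L2_minus:
  "(\<integral>\<^sup>+ w. ennreal ((norm (rep_L2 f w - rep_L2 g w))\<^sup>2) \<partial>lebesgue) = ennreal ((norm (f - g))\<^sup>2)"
proof -
  have "(\<integral>\<^sup>+ w. ennreal ((norm (rep_L2 f w - rep_L2 g w))\<^sup>2) \<partial>lebesgue)
      = (\<integral>\<^sup>+ w. ennreal ((norm (rep_L2 (f - g) w))\<^sup>2) \<partial>lebesgue)"
    by (rule nn_integral_cong_AE) (use rep_L2_minus[of f g] in \<open>auto elim!: eventually_mono\<close>)
  also have "\<dots> = ennreal (LINT w|lebesgue. (norm (rep_L2 (f - g) w))\<^sup>2)"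
    using sq_integrable_rep_L2[of "f - g"] by (intro nn_integral_eq_integral) (auto simp: sq_integrable_def)
  finally show ?thesis by (simp add: norm_rep_L2)
qed

text \<open>The subtracted term \<open>(1/4)^m\<close> makes the induction close: one step costs
  \<open>(1/4)^m\<close> and releases \<open>3/2 * (1/4)^m\<close>.\<close>

lemma norm_minus_le_geometric:
  fixes Y :: "nat \<Rightarrow> 'a::real_normed_vector"
  assumes "\<And>n. norm (Y (Suc n) - Y n) \<le> (1/4)^n" "n \<le> m"
  shows "norm (Y m - Y n) \<le> 2 * ((1/4)^n - (1/4)^m)"
  using assms(2)
proof (induction m rule: dec_induct)
  case (step m)
  have "norm (Y (Suc m) - Y n) \<le> norm (Y (Suc m) - Y m) + norm (Y m - Y n)"
    using norm_triangle_ineq[of "Y (Suc m) - Y m" "Y m - Y n"] by simp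
  also have "\<dots> \<le> (1/4)^m + 2 * ((1/4)^n - (1/4)^m)"
    by (intro add_mono assms(1) step.IH)
  also have "\<dots> \<le> 2 * ((1/4)^n - (1/4)^Suc m)"
    by simp
  finally show ?case .
qed simp

text \<open>With \<open>d n = norm (y (Suc n) - y n)\<close>, the pointwise sum of \<open>2^n * (d n)\<^sup>2\<close> has a finite integral,
  and \<open>d n \<le> (1/2)^n + 2^n * (d n)\<^sup>2\<close>.\<close>

lemma L2_convergent_if_geometric:
  fixes Y :: "nat \<Rightarrow> 'p::finite L2"
  assumes Y: "\<And>n. norm (Y (Suc n) - Y n) \<le> (1/4)^n"
  shows "convergent Y"
proof -
  define y where "y n = rep_L2 (Y n)" for n
  define d where "d n w = norm (y (Suc n) w - y n w)" for n w
  have [measurable]: "y n \<in> borel_measurable lebesgue" for n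
    by (simp add: y_def sq_integrable_measurable)
  have "(\<integral>\<^sup>+ w. (\<Sum>n. ennreal (2^n * (d n w)\<^sup>2)) \<partial>lebesgue) = (\<Sum>n. \<integral>\<^sup>+ w. ennreal (2^n * (d n w)\<^sup>2) \<partial>lebesgue)"
    unfolding d_def by (intro nn_integral_suminf) measurable
  also have "\<dots> \<le> (\<Sum>n. ennreal ((1/8)^n))"
  proof (rule suminf_le)
    fix n
    have "(\<integral>\<^sup>+ w. ennreal (2^n * (d n w)\<^sup>2) \<partial>lebesgue) = ennreal (2^n) * ennreal ((norm (Y (Suc n) - Y n))\<^sup>2)"
      unfolding nn_integral_rep_L2_minus[symmetric] d_def y_def[symmetric]
      by (subst nn_integral_cmult[symmetric]) (auto simp: ennreal_mult)
    also have "\<dots> \<le> ennreal (2^n * ((1/4)^n)\<^sup>2)"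
      unfolding ennreal_mult'[symmetric]
      by (subst ennreal_mult'[symmetric]) (auto intro!: ennreal_leI mult_left_mono power_mono Y)
    also have "2^n * ((1/4)^n)\<^sup>2 = (1/8 :: real)^n"
      by (simp add: power_mult_distrib[symmetric] power2_eq_square del: power_one_over)
    finally show "(\<integral>\<^sup>+ w. ennreal (2^n * (d n w)\<^sup>2) \<partial>lebesgue) \<le> ennreal ((1/8)^n)" .
  qed auto
  also have "\<dots> = ennreal (\<Sum>n. (1/8)^n)"
    by (rule suminf_ennreal2) (auto intro: summable_geometric)
  also have "\<dots> < \<infinity>" by simp
  finally have "AE w in lebesgue. (\<Sum>n. ennreal (2^n * (d n w)\<^sup>2)) \<noteq> \<infinity>"
    unfolding d_def by (intro nn_integral_PInf_AE) auto
  then have conv: "AE w in lebesgue. convergent (\<lambda>n. y n w)"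
  proof eventually_elim
    case (elim w)
    have "summable (\<lambda>n. 2^n * (d n w)\<^sup>2)"
      using elim by (intro summable_suminf_not_top) auto
    then have "summable (\<lambda>n. (1/2)^n + 2^n * (d n w)\<^sup>2)"
      by (intro summable_add summable_geometric) auto
    then have "summable (\<lambda>n. d n w)"
    proof (rule summable_comparison_test'[where N = 0])
      fix n
      have "0 \<le> (1 - 2^n * d n w)\<^sup>2" by simp
      then have "2 * (2^n * d n w) \<le> 1 + (2^n * d n w)\<^sup>2"
        by (simp add: power2_eq_square algebra_simps)
      then have "2^n * d n w \<le> 1 + (2^n * d n w)\<^sup>2" 
        by (smt (verit) zero_le_power2)
      then have "(1/2)^n * (2^n * d n w) \<le> (1/2)^n * (1 + (2^n * d n w)\<^sup>2)"
        by (intro mult_left_mono) auto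
      then show "norm (d n w) \<le> (1/2)^n + 2^n * (d n w)\<^sup>2"
        by (simp add: d_def power2_eq_square field_simps)
    qed
    then have "summable (\<lambda>n. y (Suc n) w - y n w)"
      unfolding d_def by (rule summable_norm_cancel)
    then show "convergent (\<lambda>n. y n w)"
      unfolding summable_iff_convergent sum_lessThan_telescope[of "\<lambda>n. y n w"]
      using convergent_add_const_right_iff[of "\<lambda>n. y n w" "- y 0 w"] by simp
  qed
  define f where "f w = lim (\<lambda>n. y n w)" for w
  have [measurable]: "f \<in> borel_measurable lebesgue"
    unfolding f_def by measurable
  \<comment> \<open>Fatou's lemma: the distance from \<open>y n\<close> to the pointwise limit is at
    most the upper limit of the distances to the later members.\<close>
  have tail: "(\<integral>\<^sup>+ w. ennreal ((norm (f w - y n w))\<^sup>2) \<partial>lebesgue) \<le> ennreal ((2 * (1/4)^n)\<^sup>2)" for n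
  proof -
    have "(\<integral>\<^sup>+ w. ennreal ((norm (f w - y n w))\<^sup>2) \<partial>lebesgue)
        = (\<integral>\<^sup>+ w. liminf (\<lambda>m. ennreal ((norm (y m w - y n w))\<^sup>2)) \<partial>lebesgue)"
    proof (rule nn_integral_cong_AE, use conv in eventually_elim)
      case (elim w)
      then have "(\<lambda>m. y m w) \<longlonglongrightarrow> f w"
        unfolding f_def by (simp add: convergent_LIMSEQ_iff)
      then have "(\<lambda>m. ennreal ((norm (y m w - y n w))\<^sup>2)) \<longlonglongrightarrow> ennreal ((norm (f w - y n w))\<^sup>2)"
        by (intro tendsto_intros)
      then show ?case
        by (intro lim_imp_Liminf[symmetric]) auto
    qed
    also have "\<dots> \<le> liminf (\<lambda>m. \<integral>\<^sup>+ w. ennreal ((norm (y m w - y n w))\<^sup>2) \<partial>lebesgue)"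
      by (intro nn_integral_liminf) measurable
    also have "\<dots> \<le> limsup (\<lambda>m. \<integral>\<^sup>+ w. ennreal ((norm (y m w - y n w))\<^sup>2) \<partial>lebesgue)"
      by (intro Liminf_le_Limsup) simp
    also have "\<dots> \<le> ennreal ((2 * (1/4)^n)\<^sup>2)"
    proof (intro Limsup_bounded eventually_sequentiallyI)
      fix m assume "n \<le> m"
      then have "norm (Y m - Y n) \<le> 2 * ((1/4)^n - (1/4)^m)"
        using norm_minus_le_geometric[OF Y] by blast
      also have "\<dots> \<le> 2 * (1/4)^n" by simp
      finally have "norm (Y m - Y n) \<le> 2 * (1/4)^n" .
      then show "(\<integral>\<^sup>+ w. ennreal ((norm (y m w - y n w))\<^sup>2) \<partial>lebesgue) \<le> ennreal ((2 * (1/4)^n)\<^sup>2)"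
        unfolding y_def nn_integral_rep_L2_minus by (intro ennreal_leI power_mono) auto
    qed
    finally show ?thesis .
  qed
  have diff: "sq_integrable (\<lambda>w. f w - y n w)" for n
    unfolding sq_integrable_def
  proof
    show "integrable lebesgue (\<lambda>w. (norm (f w - y n w))\<^sup>2)"
      by (rule integrableI_bounded) (use tail[of n] in \<open>auto simp: less_top[symmetric] top_unique\<close>)
  qed measurable
  \<comment> \<open>The limit is reached as the sum of the square integrable difference
    \<open>f - y 0\<close> and \<open>y 0\<close>.\<close>
  have f: "sq_integrable f"
    using sq_integrable_add[OF diff[of 0], of "y 0"] by (simp add: y_def)
  have "norm (Y n - abs_L2 f) \<le> 2 * (1/4)^n" for n
  proof -
    have "ennreal ((norm (abs_L2 f - Y n))\<^sup>2) = (\<integral>\<^sup>+ w. ennreal ((norm (f w - y n w))\<^sup>2) \<partial>lebesgue)"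
      unfolding nn_integral_rep_L2_minus[symmetric] y_def
      by (rule nn_integral_cong_AE) (use rep_abs_L2[OF f] in \<open>auto elim!: eventually_mono\<close>)
    with tail[of n] have "(norm (abs_L2 f - Y n))\<^sup>2 \<le> (2 * (1/4)^n)\<^sup>2"
      by (metis ennreal_le_iff zero_le_power2)
    then have "norm (abs_L2 f - Y n) \<le> 2 * (1/4)^n"
      by (rule power2_le_imp_le) simp
    then show ?thesis by (simp add: norm_minus_commute)
  qed
  moreover have "(\<lambda>n. 2 * (1/4)^n :: real) \<longlonglongrightarrow> 0"
    by (rule tendsto_mult_right_zero, rule LIMSEQ_realpow_zero) auto
  ultimately have "(\<lambda>n. Y n - abs_L2 f) \<longlonglongrightarrow> 0"
    using Lim_null_comparison[of "\<lambda>n. Y n - abs_L2 f" "\<lambda>n. 2 * (1/4)^n" sequentially]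
    by (blast intro: always_eventually)
  then show ?thesis
    unfolding convergent_def using LIM_zero_cancel by blast
qed

instance L2 :: (finite) banach
proof
  fix X :: "nat \<Rightarrow> 'a L2"
  assume X: "Cauchy X"
  have "\<exists>N. \<forall>m\<ge>N. \<forall>n\<ge>N. dist (X m) (X n) < (1/4)^k" for k
    using metric_CauchyD[OF X, of "(1/4)^k"] by auto
  then obtain N where N: "\<And>k m n. m \<ge> N k \<Longrightarrow> n \<ge> N k \<Longrightarrow> dist (X m) (X n) < (1/4)^k"
    by metis
  \<comment> \<open>The summand \<open>k\<close> makes \<open>r\<close> strictly increasing; the sum
    of all earlier thresholds puts both \<open>r k\<close> and \<open>r (Suc k)\<close> beyond
    \<open>N k\<close>.\<close>
  define r where "r k = k + (\<Sum>i\<le>k. N i)" for k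
  have r: "strict_mono r"
    by (rule strict_monoI_Suc) (simp add: r_def)
  have "N k \<le> r k" "N k \<le> r (Suc k)" for k
    using member_le_sum[of k "{..k}" N] by (auto simp: r_def)
  then have "norm ((X \<circ> r) (Suc k) - (X \<circ> r) k) \<le> (1/4)^k" for k
    using N[of k "r (Suc k)" "r k"] by (simp add: dist_norm less_imp_le)
  then have "convergent (X \<circ> r)"
    by (rule L2_convergent_if_geometric)
  then show "convergent X"
    unfolding convergent_def using Cauchy_converges_subseq[OF X r] by blast
qed

text \<open>The indicator of \<open>D\<close> times a unit coordinate vector has squared norm
  \<open>measure lebesgue D\<close>. Used for the unit interval to obtain a nonzero space, and for
  the short interval on which the commuting unitary is refuted.\<close>

lemma L2on_nontrivial:
  assumes D: "D \<in> lmeasurable" "measure lebesgue D > 0"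
  shows "\<exists>f \<in> L2on D. f \<noteq> (0 :: 'p::finite L2)"
proof -
  define e :: "real \<Rightarrow> complex^'p" where "e w = indicator D w *\<^sub>R axis undefined 1" for w
  have [measurable]: "D \<in> sets lebesgue" using D by auto
  have n: "(norm (e w))\<^sup>2 = indicator D w" for w
    by (simp add: e_def norm_axis_1 indicator_def)
  have e: "sq_integrable e"
    unfolding sq_integrable_def n using D lmeasurable_iff_integrable
    by (auto simp: e_def[abs_def] intro!: borel_measurable_scaleR borel_measurable_indicator)
  have "(norm (abs_L2 e))\<^sup>2 = measure lebesgue D"
    unfolding norm_abs_L2[OF e] n using D by simp
  then have "abs_L2 e \<noteq> 0" using D(2) by auto
  moreover have "abs_L2 e \<in> L2on D"
    unfolding L2on_def vanishes_off.rep_eq mem_Collect_eq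
    using rep_abs_L2[OF e] by eventually_elim (simp add: e_def)
  ultimately show ?thesis by blast
qed

lemma L2_nontrivial: "\<exists>f :: 'p::finite L2. f \<noteq> 0"
  using L2on_nontrivial[of "{0..1}"] by auto

text \<open>Required for the unit of \<open>'p L2 endo\<close> to be nonzero and of norm 1, hence
  for the algebra structure that carries \<open>exp\<close>.\<close>

instance L2 :: (finite) perfect_space
proof
  fix x :: "'a L2"
  obtain v :: "'a L2" where v: "v \<noteq> 0" using L2_nontrivial by blast
  show "\<not> open {x}"
  proof
    assume "open {x}"
    then obtain e where e: "e > 0" "\<And>y. dist y x < e \<Longrightarrow> y = x"
      unfolding open_dist by auto
    have "dist (x + (e / 2 / norm v) *\<^sub>R v) x < e"
      using v e(1) by (simp add: dist_norm)
    then have "x + (e / 2 / norm v) *\<^sub>R v = x" by (rule e(2))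
    then show False using v e(1) by simp
  qed
qed

section \<open>The Banach algebra of bounded operators\<close>

text \<open>The type \<open>'a \<Rightarrow>\<^sub>L 'b\<close> cannot be an instance of an algebra class, because an instance cannot
  identify its two arguments; the copy \<open>'a endo\<close> can, and so inherits \<open>exp\<close>.\<close>

typedef (overloaded) 'a endo = "UNIV :: ('a::real_normed_vector \<Rightarrow>\<^sub>L 'a) set"
  by simp

setup_lifting type_definition_endo

instantiation endo :: (real_normed_vector) real_normed_vector
begin

lift_definition zero_endo :: "'a endo" is 0 .
lift_definition plus_endo :: "'a endo \<Rightarrow> 'a endo \<Rightarrow> 'a endo" is "(+)" .
lift_definition minus_endo :: "'a endo \<Rightarrow> 'a endo \<Rightarrow> 'a endo" is "(-)" .
lift_definition uminus_endo :: "'a endo \<Rightarrow> 'a endo" is uminus .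
lift_definition scaleR_endo :: "real \<Rightarrow> 'a endo \<Rightarrow> 'a endo" is scaleR .
lift_definition norm_endo :: "'a endo \<Rightarrow> real" is norm .
definition dist_endo :: "'a endo \<Rightarrow> 'a endo \<Rightarrow> real" where "dist_endo x y = norm (x - y)"
definition sgn_endo :: "'a endo \<Rightarrow> 'a endo" where "sgn_endo x = inverse (norm x) *\<^sub>R x"
definition uniformity_endo :: "('a endo \<times> 'a endo) filter"
  where "uniformity_endo = (INF e\<in>{0<..}. principal {(x, y). dist x y < e})"
definition open_endo :: "'a endo set \<Rightarrow> bool"
  where "open_endo S \<longleftrightarrow> (\<forall>x\<in>S. \<forall>\<^sub>F (x', y) in uniformity. x' = x \<longrightarrow> y \<in> S)"

instance
  by standard
    (simp_all add: dist_endo_def sgn_endo_def uniformity_endo_def open_endo_def,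
     (transfer, simp add: algebra_simps norm_triangle_ineq)+)

end

instantiation endo :: ("{real_normed_vector,perfect_space}") real_normed_algebra_1
begin

lift_definition times_endo :: "'a endo \<Rightarrow> 'a endo \<Rightarrow> 'a endo" is "(o\<^sub>L)" .
lift_definition one_endo :: "'a endo" is id_blinfun .

instance
proof
  show "(0::'a endo) \<noteq> 1"
    by transfer (metis norm_blinfun_id norm_zero zero_neq_one)
  show "norm (1::'a endo) = 1"
    by transfer simp
  show "norm (x * y) \<le> norm x * norm y" for x y :: "'a endo"
    by transfer (rule norm_blinfun_compose)
qed (transfer; auto intro!: blinfun_eqI simp: blinfun.bilinear_simps)+

end

instance endo :: ("{banach,perfect_space}") banach
proof
  fix X :: "nat \<Rightarrow> 'a endo"
  assume "Cauchy X"
  then have "Cauchy (\<lambda>n. Rep_endo (X n))"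
    by (simp add: Cauchy_def dist_norm) (transfer, simp)
  then obtain L where "(\<lambda>n. Rep_endo (X n)) \<longlonglongrightarrow> L"
    using Cauchy_convergent convergent_def by blast
  then have "X \<longlonglongrightarrow> Abs_endo L"
    by (simp add: LIMSEQ_def dist_norm norm_endo.rep_eq minus_endo.rep_eq Abs_endo_inverse)
  then show "convergent X" by (auto simp: convergent_def)
qed

lift_definition endo_apply :: "'a::real_normed_vector endo \<Rightarrow> 'a \<Rightarrow> 'a" is blinfun_apply .

definition Endo :: "('a::real_normed_vector \<Rightarrow> 'a) \<Rightarrow> 'a endo"
  where "Endo K = Abs_endo (Blinfun K)"

lemma endo_apply_Endo: "bounded_linear K \<Longrightarrow> endo_apply (Endo K) f = K f"
  by (simp add: Endo_def endo_apply.rep_eq Abs_endo_inverse bounded_linear_Blinfun_apply)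

lemma endo_eqI: "(\<And>f. endo_apply E f = endo_apply F f) \<Longrightarrow> E = F"
  by transfer (rule blinfun_eqI)

lemma endo_apply_1 [simp]: "endo_apply 1 f = f"
  by transfer simp

lemma endo_apply_mult [simp]: "endo_apply (E * F) f = endo_apply E (endo_apply F f)"
  by transfer simp

lemma bounded_bilinear_endo_apply: "bounded_bilinear endo_apply"
proof
  show "\<exists>K. \<forall>E (f :: 'a). norm (endo_apply E f) \<le> norm E * norm f * K"
    by (rule exI[of _ 1]) (transfer, simp add: norm_blinfun)
qed (transfer; simp add: blinfun.bilinear_simps)+

lemmas endo_simps = bounded_bilinear.add_left[OF bounded_bilinear_endo_apply]
  bounded_bilinear.add_right[OF bounded_bilinear_endo_apply]
  bounded_bilinear.diff_left[OF bounded_bilinear_endo_apply]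
  bounded_bilinear.diff_right[OF bounded_bilinear_endo_apply]
  bounded_bilinear.minus_left[OF bounded_bilinear_endo_apply]
  bounded_bilinear.minus_right[OF bounded_bilinear_endo_apply]
  bounded_bilinear.scaleR_left[OF bounded_bilinear_endo_apply]
  bounded_bilinear.scaleR_right[OF bounded_bilinear_endo_apply]
  bounded_bilinear.zero_left[OF bounded_bilinear_endo_apply]
  bounded_bilinear.zero_right[OF bounded_bilinear_endo_apply]

lemma bounded_linear_endo_apply: "bounded_linear (endo_apply E)"
  by (rule bounded_bilinear.bounded_linear_right[OF bounded_bilinear_endo_apply])

lemma norm_endo_apply: "norm (endo_apply E f) \<le> norm E * norm f"
  by transfer (rule norm_blinfun)

lemma endo_apply_power: "endo_apply (E ^ n) f = (endo_apply E ^^ n) f"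
  by (induction n arbitrary: f) (simp_all add: funpow_swap1)

lemma endo_exp_sums: "(\<lambda>n. (1 / fact n) *\<^sub>R (endo_apply E ^^ n) f) sums endo_apply (exp E) f"
  using bounded_linear.sums[OF bounded_bilinear.bounded_linear_left[OF bounded_bilinear_endo_apply] exp_converges[of E], of f]
  by (simp add: endo_simps endo_apply_power inverse_eq_divide)

text \<open>Passes from the pointwise series of the statement to \<open>exp\<close> in the Banach
  algebra, where addition laws and derivatives are available.\<close>

lemma op_exp_eq:
  assumes "bounded_linear K" shows "op_exp K f = endo_apply (exp (Endo K)) f"
proof -
  have "endo_apply (Endo K) = K" by (rule ext) (rule endo_apply_Endo[OF assms])
  with endo_exp_sums[of "Endo K" f] show ?thesis by (simp add: op_exp_def sums_iff)
qed

text \<open>Multiplying the sum by \<open>x\<close> on either side shifts the series by one place,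
  which removes exactly its head 1.\<close>

lemma Neumann_series:
  fixes x :: "'a::{real_normed_algebra_1,banach}"
  assumes "norm x < 1"
  shows "summable (\<lambda>n. x ^ n)" "(1 - x) * (\<Sum>n. x ^ n) = 1" "(\<Sum>n. x ^ n) * (1 - x) = 1"
proof -
  show s: "summable (\<lambda>n. x ^ n)"
  proof (rule summable_comparison_test'[where N = 0])
    show "summable (\<lambda>n. norm x ^ n)" using assms by (simp add: summable_geometric)
  qed (rule norm_power_ineq)
  have "(\<Sum>n. x ^ Suc n) = (\<Sum>n. x ^ n) - 1"
    using suminf_split_head[OF s] by simp
  moreover have "(\<Sum>n. x ^ Suc n) = x * (\<Sum>n. x ^ n)"
    using suminf_mult[OF s, of x] by simp
  moreover have "(\<Sum>n. x ^ Suc n) = (\<Sum>n. x ^ n) * x"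
    using suminf_mult2[OF s, of x] by (simp add: power_commutes)
  ultimately show "(1 - x) * (\<Sum>n. x ^ n) = 1" "(\<Sum>n. x ^ n) * (1 - x) = 1"
    by (simp_all add: algebra_simps)
qed

lemma exp_commute:
  fixes x y :: "'a::{real_normed_algebra_1,banach}"
  assumes "x * y = y * x" shows "exp x * y = y * exp x"
proof -
  have "x ^ n * y = y * x ^ n" for n
    by (rule power_commuting_commutes[OF assms])
  then have eq: "y * (x ^ n /\<^sub>R fact n) = (x ^ n /\<^sub>R fact n) * y" for n
    by simp
  have "(\<Sum>n. (x ^ n /\<^sub>R fact n) * y) = exp x * y"
    unfolding exp_def by (rule suminf_mult2[OF summable_exp_generic, symmetric])
  moreover have "(\<Sum>n. y * (x ^ n /\<^sub>R fact n)) = y * exp x"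
    unfolding exp_def by (rule suminf_mult[OF summable_exp_generic])
  ultimately show ?thesis by (simp only: eq)
qed

text \<open>Only the orbits of \<open>f\<close> and \<open>g\<close> are compared, so the relation
  may hold on an invariant subspace alone; continuity of \<open>V\<close> carries it through the
  series. With \<open>V\<close> a projection it shows that exponentials preserve
  \<open>H\<close>.\<close>

lemma endo_exp_intertwine:
  assumes "\<And>n. V (endo_apply (E ^ n) f) = endo_apply (F ^ n) g" "bounded_linear V"
  shows "V (endo_apply (exp E) f) = endo_apply (exp F) g"
proof -
  have "(\<lambda>n. V ((1 / fact n) *\<^sub>R (endo_apply E ^^ n) f)) sums V (endo_apply (exp E) f)"
    by (rule bounded_linear.sums[OF assms(2) endo_exp_sums])
  moreover have "V ((1 / fact n) *\<^sub>R (endo_apply E ^^ n) f) = (1 / fact n) *\<^sub>R (endo_apply F ^^ n) g" for n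
    using assms(1)[of n] by (simp add: linear_simps[OF assms(2)] endo_apply_power)
  ultimately show ?thesis
    using endo_exp_sums[of F g] sums_unique2 by auto
qed

section \<open>Row vectors and integrals over a triangle\<close>

lemma borel_measurable_vec_nth:
  fixes f :: "'a \<Rightarrow> complex^'n"
  assumes "f \<in> borel_measurable M" shows "(\<lambda>w. f w $ i) \<in> borel_measurable M"
  by (rule borel_measurable_continuous_on[OF _ assms]) (intro continuous_intros)

lemma borel_measurable_vecI:
  fixes f :: "'a \<Rightarrow> complex^'n"
  assumes "\<And>i. (\<lambda>w. f w $ i) \<in> borel_measurable M"
  shows "f \<in> borel_measurable M"
proof -
  have "(\<lambda>w. \<Sum>i\<in>UNIV. f w $ i *s axis i 1) \<in> borel_measurable M"
  proof (rule borel_measurable_sum)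
    fix i
    have "continuous_on UNIV (\<lambda>c :: complex. c *s (axis i 1 :: complex^'n))"
      unfolding vector_scalar_mult_def by (intro continuous_intros)
    then show "(\<lambda>w. f w $ i *s axis i 1) \<in> borel_measurable M"
      by (rule borel_measurable_continuous_on[OF _ assms])
  qed
  then show ?thesis by (simp add: basis_expansion)
qed

lemma norm_vec_le_sum: "norm (x :: complex^'n) \<le> (\<Sum>i\<in>UNIV. cmod (x $ i))"
  by (simp add: norm_vec_def L2_set_le_sum)

lemma vector_matrix_nth: "(v v* A) $ j = (\<Sum>i\<in>UNIV. v $ i * A $ i $ j)" for v :: "complex^'n" and A :: "complex^'m^'n"
  by (simp add: vector_matrix_mult_def mult.commute)

lemma norm_vector_matrix_le:
  fixes v :: "complex^'n" and A :: "complex^'m^'n"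
  assumes "\<And>i j. cmod (A $ i $ j) \<le> c"
  shows "norm (v v* A) \<le> c * (real CARD('m) * real CARD('n)) * norm v"
proof -
  have "0 \<le> c" using assms norm_ge_zero order_trans by blast
  have "norm (v v* A) \<le> (\<Sum>j\<in>UNIV. \<Sum>i\<in>UNIV. cmod (v $ i * A $ i $ j))"
    by (rule order_trans[OF norm_vec_le_sum]) (auto simp: vector_matrix_nth intro!: sum_mono norm_sum)
  also have "\<dots> \<le> (\<Sum>j\<in>(UNIV :: 'm set). \<Sum>i\<in>(UNIV :: 'n set). norm v * c)"
    unfolding norm_mult by (intro sum_mono mult_mono assms Finite_Cartesian_Product.norm_nth_le \<open>0 \<le> c\<close>) auto
  finally show ?thesis by (simp add: mult_ac)
qed

lemma vector_matrix_add_left: "(u + v) v* A = u v* A + v v* A" for u :: "complex^'n"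
  by (simp add: vec_eq_iff vector_matrix_nth distrib_right sum.distrib)

lemma vector_matrix_cmult_left: "(c *s v) v* A = c *s (v v* A)" for v :: "complex^'n"
  by (simp add: vec_eq_iff vector_matrix_nth sum_distrib_left mult.assoc)

lemma vector_matrix_add_right: "v v* (A + B) = v v* A + v v* B" for v :: "complex^'n"
  by (simp add: vec_eq_iff vector_matrix_nth distrib_left sum.distrib)

lemma vector_matrix_diff_right: "v v* (A - B) = v v* A - v v* B" for v :: "complex^'n"
  by (simp add: vec_eq_iff vector_matrix_nth algebra_simps sum_subtractf)

lemma vector_matrix_diff_left: "(u - v) v* A = u v* A - v v* A" for u :: "complex^'n"
  by (simp add: vec_eq_iff vector_matrix_nth algebra_simps sum_subtractf)

lemma scaleR_cmult_vec: "r *\<^sub>R v = complex_of_real r *s v" for v :: "complex^'n"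
  by (simp add: vec_eq_iff scaleR_conv_of_real[where 'a = complex])

lemma bounded_linear_vector_matrix: "bounded_linear (\<lambda>v :: complex^'n. v v* A)"
proof (rule bounded_linear_intro)
  have A: "cmod (A $ i $ j) \<le> norm A" for i j
    using order_trans[OF Finite_Cartesian_Product.norm_nth_le Finite_Cartesian_Product.norm_nth_le[of A i]] .
  show "norm (v v* A) \<le> norm v * (norm A * (real CARD('a) * real CARD('n)))" for v :: "complex^'n"
    using norm_vector_matrix_le[OF A] by (simp add: mult.commute)
qed (simp_all add: vector_matrix_add_left scaleR_cmult_vec vector_matrix_cmult_left)

lemma bounded_linear_cmult_vec: "bounded_linear (\<lambda>v :: complex^'n. c *s v)"
proof (rule bounded_linear_intro)
  show "norm (c *s v) \<le> norm v * cmod c" for v :: "complex^'n"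
    by (simp add: norm_cmult_vec mult.commute)
qed (simp_all add: vec_eq_iff algebra_simps)

lemma vdot_adjoint: "vdot (u v* A) v = vdot u (v v* hconj A)"
proof -
  have "vdot (u v* A) v = (\<Sum>j\<in>UNIV. \<Sum>i\<in>UNIV. u $ i * A $ i $ j * cnj (v $ j))"
    by (simp add: vdot_def vector_matrix_nth sum_distrib_right)
  also have "\<dots> = (\<Sum>i\<in>UNIV. \<Sum>j\<in>UNIV. u $ i * A $ i $ j * cnj (v $ j))"
    by (rule sum.swap)
  also have "\<dots> = vdot u (v v* hconj A)"
    by (simp add: vdot_def vector_matrix_nth hconj_def sum_distrib_left mult_ac)
  finally show ?thesis .
qed

lemma hconj_hconj [simp]: "hconj (hconj A) = A"
  by (simp add: hconj_def vec_eq_iff)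

lemma hconj_add: "hconj (A + B) = hconj A + hconj B"
  by (simp add: hconj_def vec_eq_iff)

lemma hconj_diff: "hconj (A - B) = hconj A - hconj B"
  by (simp add: hconj_def vec_eq_iff)

lemma sigma_finite_lebesgue: "sigma_finite_measure (lebesgue :: real measure)"
proof
  have "\<Union> (range (\<lambda>n. {- real n..real n})) = UNIV"
  proof (intro set_eqI iffI)
    fix x :: real
    obtain n where "\<bar>x\<bar> \<le> real n" using real_arch_simple by blast
    then show "x \<in> \<Union> (range (\<lambda>n. {- real n..real n}))" by (auto simp: abs_le_iff intro!: exI[of _ n])
  qed auto
  then show "\<exists>A. countable A \<and> A \<subseteq> sets lebesgue \<and> \<Union> A = space (lebesgue :: real measure) \<and>
      (\<forall>a\<in>A. emeasure lebesgue a \<noteq> \<infinity>)"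
    by (intro exI[of _ "range (\<lambda>n. {- real n..real n})"]) (auto simp: emeasure_lborel_Icc_eq)
qed

interpretation lebesgue_pair: pair_sigma_finite "lebesgue :: real measure" "lebesgue :: real measure"
  by (simp add: pair_sigma_finite_def sigma_finite_lebesgue)

lemma measurable_fst_snd_lebesgue [measurable]:
  "fst \<in> borel_measurable ((lebesgue :: real measure) \<Otimes>\<^sub>M (lebesgue :: real measure))"
  "snd \<in> borel_measurable ((lebesgue :: real measure) \<Otimes>\<^sub>M (lebesgue :: real measure))"
  using measurable_compose[OF measurable_fst, of "\<lambda>x. x" lebesgue borel lebesgue]
    measurable_compose[OF measurable_snd, of "\<lambda>x. x" lebesgue borel lebesgue]
  by (auto simp: measurable_completion)

lemma integrable_indicator_scaleR:
  fixes u :: "real \<Rightarrow> 'b::{banach,second_countable_topology}"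
  assumes "integrable lebesgue u"
  shows "integrable lebesgue (\<lambda>\<xi>. indicator {a..b} \<xi> *\<^sub>R u \<xi>)"
  by (rule integrable_mult_indicator) (use assms in auto)

text \<open>The two iterated integrals run over the triangles below and above the diagonal of the
  plane. Together they cover it, and they overlap only on the diagonal, a null set.\<close>

lemma Fubini_triangle:
  fixes u v :: "real \<Rightarrow> complex"
  assumes [measurable]: "integrable lebesgue u" "integrable lebesgue v"
  shows "(LINT w|lebesgue. u w * (LINT \<xi>|lebesgue. indicator {..w} \<xi> *\<^sub>R v \<xi>))
    + (LINT w|lebesgue. (LINT \<xi>|lebesgue. indicator {..w} \<xi> *\<^sub>R u \<xi>) * v w)
    = (LINT w|lebesgue. u w) * (LINT w|lebesgue. v w)"
proof -
  have [measurable]: "u \<in> borel_measurable lebesgue" "v \<in> borel_measurable lebesgue"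
    using assms by auto
  have uv: "integrable (lebesgue \<Otimes>\<^sub>M lebesgue) (\<lambda>p. u (fst p) * v (snd p))"
  proof (rule lebesgue_pair.Fubini_integrable)
    show "integrable lebesgue (\<lambda>x. LINT y|lebesgue. norm (u (fst (x, y)) * v (snd (x, y))))"
      using assms by (simp add: norm_mult)
  qed (use assms in auto)
  have tri: "integrable (lebesgue \<Otimes>\<^sub>M lebesgue) (\<lambda>(x, y). indicator {..x} y *\<^sub>R (u x * v y))"
  proof (rule Bochner_Integration.integrable_bound[OF uv])
    have "(\<lambda>p. (if snd p \<le> fst p then 1 else 0 :: real) *\<^sub>R (u (fst p) * v (snd p)))
        \<in> borel_measurable (lebesgue \<Otimes>\<^sub>M lebesgue)"
      by measurable
    then show "(\<lambda>(x, y). indicator {..x} y *\<^sub>R (u x * v y)) \<in> borel_measurable (lebesgue \<Otimes>\<^sub>M lebesgue)"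
      by (simp add: case_prod_unfold indicator_def if_distrib[of "\<lambda>r. r *\<^sub>R _"] cong: if_cong)
  qed (auto simp: indicator_def norm_mult)
  have inner: "(LINT w|lebesgue. indicator {..w} \<xi> *\<^sub>R (u w * v \<xi>)) = (LINT w|lebesgue. indicator {\<xi>..} w *\<^sub>R u w) * v \<xi>" for \<xi>
    by (subst integral_mult_left_zero[symmetric])
      (auto intro!: Bochner_Integration.integral_cong simp: indicator_def)
  have "(LINT w|lebesgue. u w * (LINT \<xi>|lebesgue. indicator {..w} \<xi> *\<^sub>R v \<xi>))
      = (LINT w|lebesgue. LINT \<xi>|lebesgue. indicator {..w} \<xi> *\<^sub>R (u w * v \<xi>))"
    by (simp flip: integral_mult_right_zero)
  also have "\<dots> = (LINT \<xi>|lebesgue. LINT w|lebesgue. indicator {..w} \<xi> *\<^sub>R (u w * v \<xi>))"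
    by (rule lebesgue_pair.Fubini_integral[OF tri, symmetric])
  also have "\<dots> = (LINT \<xi>|lebesgue. (LINT w|lebesgue. indicator {\<xi>..} w *\<^sub>R u w) * v \<xi>)"
    by (simp only: inner)
  finally have swap: "(LINT w|lebesgue. u w * (LINT \<xi>|lebesgue. indicator {..w} \<xi> *\<^sub>R v \<xi>))
      = (LINT \<xi>|lebesgue. (LINT w|lebesgue. indicator {\<xi>..} w *\<^sub>R u w) * v \<xi>)" .
  have split: "(LINT w|lebesgue. indicator {\<xi>..} w *\<^sub>R u w) + (LINT w|lebesgue. indicator {..\<xi>} w *\<^sub>R u w)
      = (LINT w|lebesgue. u w)" for \<xi>
  proof -
    have "(LINT w|lebesgue. indicator {\<xi>..} w *\<^sub>R u w) + (LINT w|lebesgue. indicator {..\<xi>} w *\<^sub>R u w)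
        = (LINT w|lebesgue. indicator {\<xi>..} w *\<^sub>R u w + indicator {..\<xi>} w *\<^sub>R u w)"
      by (intro Bochner_Integration.integral_add[symmetric] integrable_mult_indicator assms) auto
    also have "\<dots> = (LINT w|lebesgue. u w)"
    proof (rule integral_cong_AE)
      have "AE w in lborel. w \<noteq> \<xi>" by (rule AE_lborel_singleton)
      then have "AE w in lebesgue. w \<noteq> \<xi>" by (rule AE_completion)
      then show "AE w in lebesgue. indicator {\<xi>..} w *\<^sub>R u w + indicator {..\<xi>} w *\<^sub>R u w = u w"
        by eventually_elim (auto simp: indicator_def)
    qed (intro borel_measurable_integrable Bochner_Integration.integrable_add integrable_mult_indicator assms, simp_all)
    finally show ?thesis .
  qed
  have int2: "integrable lebesgue (\<lambda>\<xi>. (LINT w|lebesgue. indicator {\<xi>..} w *\<^sub>R u w) * v \<xi>)"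
    using lebesgue_pair.integrable_snd[OF tri] by (simp add: inner)
  \<comment> \<open>The other half is integrable as the difference of the whole and the first half,
    so joint integrability is established for one triangle only.\<close>
  have "integrable lebesgue (\<lambda>\<xi>. (LINT w|lebesgue. u w) * v \<xi>
      - (LINT w|lebesgue. indicator {\<xi>..} w *\<^sub>R u w) * v \<xi>)"
    by (intro Bochner_Integration.integrable_diff int2 integrable_mult_right assms)
  moreover have "(LINT w|lebesgue. u w) * v \<xi> - (LINT w|lebesgue. indicator {\<xi>..} w *\<^sub>R u w) * v \<xi>
      = (LINT w|lebesgue. indicator {..\<xi>} w *\<^sub>R u w) * v \<xi>" for \<xi>
    by (simp flip: split[of \<xi>] add: distrib_right)
  ultimately have int1: "integrable lebesgue (\<lambda>\<xi>. (LINT w|lebesgue. indicator {..\<xi>} w *\<^sub>R u w) * v \<xi>)"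
    by simp
  show ?thesis
    unfolding swap using split
    by (subst Bochner_Integration.integral_add[OF int2 int1, symmetric])
      (simp flip: distrib_right)
qed

section \<open>Multiplication operators\<close>

definition multiplier :: "(real \<Rightarrow> real) \<Rightarrow> 'p::finite L2 \<Rightarrow> 'p L2"
  where "multiplier \<phi> f = abs_L2 (\<lambda>w. \<phi> w *\<^sub>R rep_L2 f w)"

definition bounded_measurable :: "(real \<Rightarrow> real) \<Rightarrow> real \<Rightarrow> bool"
  where "bounded_measurable \<phi> c \<longleftrightarrow> \<phi> \<in> borel_measurable lebesgue \<and> (\<forall>w. \<bar>\<phi> w\<bar> \<le> c)"

lemma bounded_measurable_indicator [simp]:
  "A \<in> sets lebesgue \<Longrightarrow> bounded_measurable (indicator A) 1"
  by (simp add: bounded_measurable_def indicator_def)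

lemma sq_integrable_bound:
  fixes f :: "real \<Rightarrow> complex^'p" and g :: "real \<Rightarrow> real"
  assumes "f \<in> borel_measurable lebesgue" "integrable lebesgue g" "\<And>w. (norm (f w))\<^sup>2 \<le> g w"
  shows "sq_integrable f" "(norm (abs_L2 f))\<^sup>2 \<le> (LINT w|lebesgue. g w)"
proof -
  have [measurable]: "f \<in> borel_measurable lebesgue" by fact
  have int: "integrable lebesgue (\<lambda>w. (norm (f w))\<^sup>2)"
    by (rule Bochner_Integration.integrable_bound[OF assms(2)])
      (use assms(3) in \<open>auto intro: order_trans abs_ge_self\<close>)
  then show "sq_integrable f" by (simp add: sq_integrable_def)
  then show "(norm (abs_L2 f))\<^sup>2 \<le> (LINT w|lebesgue. g w)"
    by (simp add: norm_abs_L2) (intro integral_mono int assms)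
qed

lemma sq_integrable_multiplier:
  assumes "bounded_measurable \<phi> c" "sq_integrable f"
  shows "sq_integrable (\<lambda>w. \<phi> w *\<^sub>R f w)" "norm (abs_L2 (\<lambda>w. \<phi> w *\<^sub>R f w)) \<le> c * norm (abs_L2 f)"
proof -
  have c: "0 \<le> c" using assms(1) by (auto simp: bounded_measurable_def intro: order_trans[OF abs_ge_zero])
  have m: "(\<lambda>w. \<phi> w *\<^sub>R f w) \<in> borel_measurable lebesgue"
    using assms by (auto simp: bounded_measurable_def sq_integrable_def)
  have i: "integrable lebesgue (\<lambda>w. c\<^sup>2 * (norm (f w))\<^sup>2)"
    using assms(2) by (simp add: sq_integrable_def)
  have le: "(norm (\<phi> w *\<^sub>R f w))\<^sup>2 \<le> c\<^sup>2 * (norm (f w))\<^sup>2" for w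
    using assms(1) unfolding norm_scaleR power_mult_distrib
    by (intro mult_right_mono power_mono) (auto simp: bounded_measurable_def)
  show "sq_integrable (\<lambda>w. \<phi> w *\<^sub>R f w)" by (rule sq_integrable_bound(1)[OF m i le])
  have "(norm (abs_L2 (\<lambda>w. \<phi> w *\<^sub>R f w)))\<^sup>2 \<le> (c * norm (abs_L2 f))\<^sup>2"
    using sq_integrable_bound(2)[OF m i le] norm_abs_L2[OF assms(2)] by (simp add: power_mult_distrib)
  then show "norm (abs_L2 (\<lambda>w. \<phi> w *\<^sub>R f w)) \<le> c * norm (abs_L2 f)"
    by (rule power2_le_imp_le) (simp add: c)
qed

lemma rep_multiplier:
  assumes "bounded_measurable \<phi> c"
  shows "AE w in lebesgue. rep_L2 (multiplier \<phi> f) w = \<phi> w *\<^sub>R rep_L2 f w"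
  unfolding multiplier_def by (rule rep_abs_L2[OF sq_integrable_multiplier(1)[OF assms sq_integrable_rep_L2]])

lemma norm_multiplier:
  assumes "bounded_measurable \<phi> c" shows "norm (multiplier \<phi> f) \<le> c * norm f"
  using sq_integrable_multiplier(2)[OF assms, of "rep_L2 f"] by (simp add: multiplier_def)

lemma multiplier_add:
  assumes "bounded_measurable \<phi> c" shows "multiplier \<phi> (f + g) = multiplier \<phi> f + multiplier \<phi> g"
proof (rule rep_L2_eqI)
  show "AE w in lebesgue. rep_L2 (multiplier \<phi> (f + g)) w = rep_L2 (multiplier \<phi> f + multiplier \<phi> g) w"
    using rep_multiplier[OF assms, of "f + g"] rep_multiplier[OF assms, of f] rep_multiplier[OF assms, of g]
      rep_L2_plus[of f g] rep_L2_plus[of "multiplier \<phi> f" "multiplier \<phi> g"]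
    by eventually_elim (simp add: scaleR_add_right)
qed

lemma multiplier_scaleC:
  assumes "bounded_measurable \<phi> c" shows "multiplier \<phi> (a *\<^sub>C f) = a *\<^sub>C multiplier \<phi> f"
proof (rule rep_L2_eqI)
  show "AE w in lebesgue. rep_L2 (multiplier \<phi> (a *\<^sub>C f)) w = rep_L2 (a *\<^sub>C multiplier \<phi> f) w"
    using rep_multiplier[OF assms, of "a *\<^sub>C f"] rep_multiplier[OF assms, of f] 
      rep_L2_scaleC[of a f] rep_L2_scaleC[of a "multiplier \<phi> f"]
    by eventually_elim (simp add: vec_eq_iff)
qed

lemma bounded_linear_multiplier:
  assumes "bounded_measurable \<phi> c" shows "bounded_linear (multiplier \<phi>)"
  by (rule bounded_linear_intro[of _ c])
    (simp_all add: multiplier_add[OF assms] scaleR_scaleC multiplier_scaleC[OF assms]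
      norm_multiplier[OF assms] mult.commute)

lemma multiplier_multiplier:
  assumes "bounded_measurable \<phi> c" "bounded_measurable \<psi> d" "bounded_measurable (\<lambda>w. \<phi> w * \<psi> w) e"
  shows "multiplier \<phi> (multiplier \<psi> f) = multiplier (\<lambda>w. \<phi> w * \<psi> w) f"
proof (rule rep_L2_eqI)
  show "AE w in lebesgue. rep_L2 (multiplier \<phi> (multiplier \<psi> f)) w = rep_L2 (multiplier (\<lambda>w. \<phi> w * \<psi> w) f) w"
    using rep_multiplier[OF assms(1), of "multiplier \<psi> f"] rep_multiplier[OF assms(2), of f]
      rep_multiplier[OF assms(3), of f]
    by eventually_elim simp
qed

lemma cinner_rep: "cinner f g = (LINT w|lebesgue. vdot (rep_L2 f w) (rep_L2 g w))"
  using cinner_abs_L2[of "rep_L2 f" "rep_L2 g"] by simp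

lemma vdot_scaleR_left: "vdot (r *\<^sub>R u) v = r *\<^sub>R vdot u v"
  by (simp add: vdot_def scaleR_sum_right)

lemma vdot_scaleR_right: "vdot u (r *\<^sub>R v) = r *\<^sub>R vdot u v"
  by (simp add: vdot_def scaleR_sum_right)

lemma borel_measurable_vdot:
  assumes "f \<in> borel_measurable M" "g \<in> borel_measurable M"
  shows "(\<lambda>w. vdot (f w) (g w)) \<in> borel_measurable M"
  unfolding vdot_def
  by (intro borel_measurable_sum borel_measurable_times borel_measurable_vec_nth assms
      borel_measurable_continuous_on[of cnj] continuous_intros)

lemma cinner_multiplier:
  assumes "bounded_measurable \<phi> c"
  shows "cinner (multiplier \<phi> f) g = (LINT w|lebesgue. \<phi> w *\<^sub>R vdot (rep_L2 f w) (rep_L2 g w))"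
    and "cinner f (multiplier \<phi> g) = (LINT w|lebesgue. \<phi> w *\<^sub>R vdot (rep_L2 f w) (rep_L2 g w))"
proof -
  have [measurable]: "\<phi> \<in> borel_measurable lebesgue" using assms by (simp add: bounded_measurable_def)
  note [measurable] = borel_measurable_vdot sq_integrable_measurable[OF sq_integrable_rep_L2]
  show "cinner (multiplier \<phi> f) g = (LINT w|lebesgue. \<phi> w *\<^sub>R vdot (rep_L2 f w) (rep_L2 g w))"
    unfolding cinner_rep
    by (rule integral_cong_AE)
      (use rep_multiplier[OF assms, of f] in \<open>auto elim!: eventually_mono simp: vdot_scaleR_left\<close>)
  show "cinner f (multiplier \<phi> g) = (LINT w|lebesgue. \<phi> w *\<^sub>R vdot (rep_L2 f w) (rep_L2 g w))"
    unfolding cinner_rep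
    by (rule integral_cong_AE)
      (use rep_multiplier[OF assms, of g] in \<open>auto elim!: eventually_mono simp: vdot_scaleR_right\<close>)
qed

text \<open>Replaces an almost everywhere condition by a fixed point equation for a bounded
  operator, which is stable under limits and integrals.\<close>

lemma mem_L2on_iff:
  assumes "D \<in> sets lebesgue" shows "f \<in> L2on D \<longleftrightarrow> multiplier (indicator D) f = f"
proof
  assume "f \<in> L2on D"
  then have "AE w in lebesgue. w \<notin> D \<longrightarrow> rep_L2 f w = 0"
    by (simp add: L2on_def vanishes_off.rep_eq)
  with rep_multiplier[OF bounded_measurable_indicator[OF assms], of f]
  have "AE w in lebesgue. rep_L2 (multiplier (indicator D) f) w = rep_L2 f w"
    by eventually_elim (auto simp: indicator_def)
  then show "multiplier (indicator D) f = f" by (rule rep_L2_eqI)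
next
  assume "multiplier (indicator D) f = f"
  with rep_multiplier[OF bounded_measurable_indicator[OF assms], of f]
  show "f \<in> L2on D"
    by (auto simp: L2on_def vanishes_off.rep_eq indicator_def elim!: eventually_mono)
qed

lemma multiplier_indicator_mem:
  assumes "D \<in> sets lebesgue" shows "multiplier (indicator D) f \<in> L2on D"
proof -
  have "(\<lambda>w. indicator D w * indicator D w :: real) = indicator D"
    by (auto simp: indicator_def)
  then show ?thesis
    unfolding mem_L2on_iff[OF assms] using assms
    by (subst multiplier_multiplier[of _ 1 _ 1 1]) auto
qed

text \<open>Cauchy-Schwarz against the indicator of \<open>D\<close>. The factor
  \<open>sqrt (measure lebesgue D)\<close> is the source of the smallness of the integral part of
  \<open>B\<close> on short intervals.\<close>

lemma L2_restrict_integral: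
  fixes f :: "'p::finite L2"
  assumes D: "D \<in> lmeasurable"
  shows "integrable lebesgue (\<lambda>w. indicator D w * norm (rep_L2 f w))"
    and "(LINT w|lebesgue. indicator D w * norm (rep_L2 f w)) \<le> sqrt (measure lebesgue D) * norm f"
proof -
  have [measurable]: "D \<in> sets lebesgue" "rep_L2 f \<in> borel_measurable lebesgue"
    using D by (auto simp: sq_integrable_measurable)
  have sq: "integrable lebesgue (\<lambda>w. (norm (rep_L2 f w))\<^sup>2)"
    using sq_integrable_rep_L2[of f] by (simp add: sq_integrable_def)
  show int: "integrable lebesgue (\<lambda>w. indicator D w * norm (rep_L2 f w))"
  proof (rule Bochner_Integration.integrable_bound)
    show "integrable lebesgue (\<lambda>w. indicator D w + (norm (rep_L2 f w))\<^sup>2)"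
      using D sq lmeasurable_iff_integrable by (intro Bochner_Integration.integrable_add) auto
    have "x \<le> 1 + x\<^sup>2" for x :: real
      using zero_le_power2[of "x - 1/2"] by (simp add: power2_eq_square algebra_simps)
    then show "AE w in lebesgue. norm (indicator D w * norm (rep_L2 f w)) \<le> norm (indicator D w + (norm (rep_L2 f w))\<^sup>2)"
      by (auto simp: indicator_def)
  qed measurable
  let ?I = "LINT w|lebesgue. indicator D w * norm (rep_L2 f w)"
  have I: "0 \<le> ?I" by (rule integral_nonneg_AE) auto
  have "ennreal (?I\<^sup>2) = (\<integral>\<^sup>+ w. ennreal (indicator D w * norm (rep_L2 f w)) \<partial>lebesgue)\<^sup>2"
    by (subst nn_integral_eq_integral[OF int]) (auto simp: ennreal_power I)
  also have "\<dots> = (\<integral>\<^sup>+ w. ennreal (indicator D w) * ennreal (norm (rep_L2 f w)) \<partial>lebesgue)\<^sup>2"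
    by (simp add: ennreal_mult)
  also have "\<dots> \<le> (\<integral>\<^sup>+ w. (ennreal (indicator D w))\<^sup>2 \<partial>lebesgue) * (\<integral>\<^sup>+ w. (ennreal (norm (rep_L2 f w)))\<^sup>2 \<partial>lebesgue)"
    by (intro Cauchy_Schwarz_nn_integral) measurable
  also have "(\<integral>\<^sup>+ w. (ennreal (indicator D w))\<^sup>2 \<partial>lebesgue) = (\<integral>\<^sup>+ w. indicator D w \<partial>lebesgue)"
    by (intro nn_integral_cong) (auto simp: indicator_def)
  also have "\<dots> = ennreal (measure lebesgue D)"
    using D by (simp add: emeasure_eq_measure2)
  also have "(\<integral>\<^sup>+ w. (ennreal (norm (rep_L2 f w)))\<^sup>2 \<partial>lebesgue) = ennreal ((norm f)\<^sup>2)"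
    unfolding norm_rep_L2 by (subst nn_integral_eq_integral[OF sq, symmetric]) (auto simp: ennreal_power)
  finally have "?I\<^sup>2 \<le> measure lebesgue D * (norm f)\<^sup>2"
    by (simp add: ennreal_mult[symmetric])
  also have "\<dots> = (sqrt (measure lebesgue D) * norm f)\<^sup>2"
    by (simp add: power_mult_distrib)
  finally show "?I \<le> sqrt (measure lebesgue D) * norm f"
    by (rule power2_le_imp_le) simp
qed

section \<open>Primitives and integration by parts\<close>

definition primitive :: "(real \<Rightarrow> complex^'m) \<Rightarrow> real \<Rightarrow> complex^'m"
  where "primitive u w = (LINT \<xi>|lebesgue. indicator {..w} \<xi> *\<^sub>R u \<xi>)"

lemma integrable_vec_nth: "integrable M u \<Longrightarrow> integrable M (\<lambda>w. u w $ i)" for u :: "_ \<Rightarrow> complex^'m"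
  by (rule integrable_bounded_linear[OF bounded_linear_vec_nth])

lemma integral_vec_nth: "integrable M u \<Longrightarrow> (LINT w|M. u w) $ i = (LINT w|M. u w $ i)" for u :: "_ \<Rightarrow> complex^'m"
  by (rule integral_bounded_linear[OF bounded_linear_vec_nth, symmetric])

lemma integrable_primitive:
  "integrable lebesgue u \<Longrightarrow> integrable lebesgue (\<lambda>\<xi>. indicator {..w::real} \<xi> *\<^sub>R u \<xi>)"
  for u :: "_ \<Rightarrow> complex^'m"
  by (rule integrable_mult_indicator) auto

lemma primitive_nth:
  assumes "integrable lebesgue u"
  shows "primitive u w $ i = (LINT \<xi>|lebesgue. indicator {..w} \<xi> *\<^sub>R u \<xi> $ i)"
  unfolding primitive_def by (subst integral_vec_nth[OF integrable_primitive[OF assms]]) simp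

lemma norm_primitive: "integrable lebesgue u \<Longrightarrow> norm (primitive u w) \<le> (LINT \<xi>|lebesgue. norm (u \<xi>))"
  unfolding primitive_def
  by (rule order_trans[OF integral_norm_bound], rule integral_mono[OF integrable_norm[OF integrable_primitive]])
    (auto simp: indicator_def)

lemma primitive_measurable [measurable]:
  assumes [measurable]: "u \<in> borel_measurable lebesgue"
  shows "primitive u \<in> borel_measurable lebesgue"
proof -
  have "(\<lambda>p. (if snd p \<le> fst p then 1 else 0 :: real) *\<^sub>R u (snd p)) \<in> borel_measurable (lebesgue \<Otimes>\<^sub>M lebesgue)"
    by measurable
  then have "(\<lambda>(w, \<xi>). indicator {..w} \<xi> *\<^sub>R u \<xi>) \<in> borel_measurable (lebesgue \<Otimes>\<^sub>M lebesgue)"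
    by (simp add: case_prod_unfold indicator_def if_distrib[of "\<lambda>r. r *\<^sub>R _"] cong: if_cong)
  then show ?thesis
    unfolding primitive_def[abs_def]
    by (rule sigma_finite_measure.borel_measurable_lebesgue_integral[OF sigma_finite_lebesgue])
qed

lemma integrable_mult_cnj_bounded:
  fixes u v :: "real \<Rightarrow> complex^'m"
  assumes "integrable lebesgue u" "v \<in> borel_measurable lebesgue" "\<And>w. norm (v w) \<le> c"
  shows "integrable lebesgue (\<lambda>w. u w $ i * cnj (v w $ i))"
proof (rule Bochner_Integration.integrable_bound)
  show "integrable lebesgue (\<lambda>w. c * norm (u w $ i))"
    by (intro integrable_mult_right integrable_norm integrable_vec_nth assms)
  have [measurable]: "(\<lambda>w. v w $ i) \<in> borel_measurable lebesgue" "(\<lambda>w. u w $ i) \<in> borel_measurable lebesgue"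
    using assms by (auto intro: borel_measurable_vec_nth)
  have [measurable]: "(\<lambda>w. cnj (v w $ i)) \<in> borel_measurable lebesgue"
    by (rule borel_measurable_continuous_on[of cnj]) (intro continuous_intros, measurable)
  show "(\<lambda>w. u w $ i * cnj (v w $ i)) \<in> borel_measurable lebesgue" by measurable
  have "cmod (v w $ i) \<le> c" for w
    using Finite_Cartesian_Product.norm_nth_le[of "v w" i] assms(3)[of w] by linarith
  then have "norm (u w $ i * cnj (v w $ i)) \<le> c * norm (u w $ i)" for w
    unfolding norm_mult complex_mod_cnj by (subst mult.commute) (intro mult_right_mono, auto)
  then show "AE w in lebesgue. norm (u w $ i * cnj (v w $ i)) \<le> norm (c * norm (u w $ i))"
    by (auto intro: order_trans abs_ge_self)
qed

lemma integrable_vdot_bounded: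
  fixes u v :: "real \<Rightarrow> complex^'m"
  assumes "integrable lebesgue u" "v \<in> borel_measurable lebesgue" "\<And>w. norm (v w) \<le> c"
  shows "integrable lebesgue (\<lambda>w. vdot (u w) (v w))" "integrable lebesgue (\<lambda>w. vdot (v w) (u w))"
proof -
  show "integrable lebesgue (\<lambda>w. vdot (u w) (v w))"
    unfolding vdot_def by (intro Bochner_Integration.integrable_sum integrable_mult_cnj_bounded[OF assms])
  then have "integrable lebesgue (\<lambda>w. cnj (vdot (u w) (v w)))" by simp
  then show "integrable lebesgue (\<lambda>w. vdot (v w) (u w))" by (simp flip: vdot_commute)
qed

text \<open>\<open>Fubini_triangle\<close> in every coordinate, with the conjugate of
  \<open>v\<close> as second function because \<open>vdot\<close> conjugates its second
  argument.\<close>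

lemma integral_parts:
  fixes u v :: "real \<Rightarrow> complex^'m"
  assumes u: "integrable lebesgue u" and v: "integrable lebesgue v"
  shows "(LINT w|lebesgue. vdot (u w) (primitive v w)) + (LINT w|lebesgue. vdot (primitive u w) (v w))
    = vdot (LINT w|lebesgue. u w) (LINT w|lebesgue. v w)"
proof -
  have int: "integrable lebesgue (\<lambda>w. u w $ i * cnj (v' w $ i))" 
    if "integrable lebesgue u" "v' = primitive v" "integrable lebesgue v" for u v v' :: "real \<Rightarrow> complex^'m" and i
    unfolding that(2) using norm_primitive[OF that(3)] that(1,3)
    by (intro integrable_mult_cnj_bounded) auto
  have int': "integrable lebesgue (\<lambda>w. primitive u w $ i * cnj (v w $ i))" for i
    using integrable_cnj[OF int[OF v refl u, of i]] by (simp add: mult.commute)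
  have cnj: "cnj (LINT \<xi>|lebesgue. indicator {..w} \<xi> *\<^sub>R v \<xi> $ i)
      = (LINT \<xi>|lebesgue. indicator {..w} \<xi> *\<^sub>R cnj (v \<xi> $ i))" for i and w :: real
    by (subst Bochner_Integration.integral_cnj[symmetric]) simp
  have "(LINT w|lebesgue. u w $ i * cnj (primitive v w $ i)) + (LINT w|lebesgue. primitive u w $ i * cnj (v w $ i))
      = (LINT w|lebesgue. u w) $ i * cnj ((LINT w|lebesgue. v w) $ i)" for i
    using Fubini_triangle[of "\<lambda>w. u w $ i" "\<lambda>w. cnj (v w $ i)"] integrable_vec_nth[OF u, of i] integrable_vec_nth[OF v, of i]
    by (simp add: primitive_nth[OF u] primitive_nth[OF v] integral_vec_nth[OF u] integral_vec_nth[OF v] cnj)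
  then show ?thesis
    unfolding vdot_def
    by (simp add: Bochner_Integration.integral_sum int[OF u refl v] int' flip: sum.distrib)
qed

section \<open>The triangular model\<close>

locale triangular_kernel =
  fixes l :: real and L S0 :: "complex^'m^'m" and \<pi> :: "real \<Rightarrow> complex^'m^'p"
  assumes l_pos: "0 < l" and L_hermitian: "hconj L = L"
    and \<pi>_measurable: "\<pi> \<in> borel_measurable (lebesgue_on {-l..l})"
    and \<pi>_le_1: "\<And>w i j. w \<in> {-l..l} \<Longrightarrow> cmod (\<pi> w $ i $ j) \<le> 1"
begin

abbreviation \<Delta> :: "real set" where "\<Delta> \<equiv> {-l..l}"

text \<open>Bounds the action of a matrix with entries of modulus at most 1, by
  \<open>norm_vector_matrix_le\<close>.\<close>

definition \<kappa> :: real where "\<kappa> = real CARD('m) * real CARD('p)"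

lemma \<kappa>_nonneg: "0 \<le> \<kappa>"
  by (simp add: \<kappa>_def)

text \<open>Every integral in \<open>model_op\<close> factors through \<open>complex^'m\<close>:
  pass to \<open>density f\<close>, integrate, apply a constant matrix, and return by
  \<open>emb\<close>.\<close>

definition density :: "'p L2 \<Rightarrow> real \<Rightarrow> complex^'m"
  where "density f w = indicator \<Delta> w *\<^sub>R (rep_L2 f w v* \<pi> w)"

text \<open>The pointwise adjoint of the map from \<open>rep_L2 f w\<close> to
  \<open>density f w\<close>; see \<open>cinner_emb\<close>.\<close>

definition emb_fun :: "(real \<Rightarrow> complex^'m) \<Rightarrow> real \<Rightarrow> complex^'p"
  where "emb_fun g w = indicator \<Delta> w *\<^sub>R (g w v* hconj (\<pi> w))"

definition emb :: "(real \<Rightarrow> complex^'m) \<Rightarrow> 'p L2"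
  where "emb g = abs_L2 (emb_fun g)"

lemma \<pi>_nth_measurable: "(\<lambda>w. indicator \<Delta> w *\<^sub>R \<pi> w $ i $ j) \<in> borel_measurable lebesgue"
proof -
  have "(\<lambda>w. \<pi> w $ i $ j) \<in> borel_measurable (lebesgue_on \<Delta>)"
    by (rule borel_measurable_continuous_on[OF _ \<pi>_measurable]) (intro continuous_intros)
  then show ?thesis
    by (subst (asm) borel_measurable_restrict_space_iff) auto
qed

lemma density_measurable [measurable]: "density f \<in> borel_measurable lebesgue"
proof (rule borel_measurable_vecI)
  fix j
  have "(\<lambda>w. \<Sum>i\<in>UNIV. rep_L2 f w $ i * (indicator \<Delta> w *\<^sub>R \<pi> w $ i $ j)) \<in> borel_measurable lebesgue"
    by (intro borel_measurable_sum borel_measurable_times \<pi>_nth_measurable borel_measurable_vec_nth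
        sq_integrable_measurable[OF sq_integrable_rep_L2])
  then show "(\<lambda>w. density f w $ j) \<in> borel_measurable lebesgue"
    by (simp add: density_def vector_matrix_nth scaleR_sum_right)
qed

lemma norm_density: "norm (density f w) \<le> \<kappa> * (indicator \<Delta> w * norm (rep_L2 f w))"
  using norm_vector_matrix_le[of "\<pi> w" 1 "rep_L2 f w"] \<pi>_le_1[of w]
  by (auto simp: density_def indicator_def \<kappa>_def)

lemma integrable_density: "integrable lebesgue (density f)"
proof (rule Bochner_Integration.integrable_bound[OF _ density_measurable])
  show "integrable lebesgue (\<lambda>w. \<kappa> * (indicator \<Delta> w * norm (rep_L2 f w)))"
    by (intro integrable_mult_right L2_restrict_integral) simp
qed (rule AE_I2, rule order_trans[OF norm_density], simp)

lemma density_L1: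
  assumes "D \<in> lmeasurable" "f \<in> L2on D"
  shows "(LINT w|lebesgue. norm (density f w)) \<le> \<kappa> * sqrt (measure lebesgue D) * norm f"
proof -
  have "AE w in lebesgue. w \<notin> D \<longrightarrow> rep_L2 f w = 0"
    using assms(2) by (simp add: L2on_def vanishes_off.rep_eq)
  then have "AE w in lebesgue. norm (density f w) \<le> \<kappa> * (indicator D w * norm (rep_L2 f w))"
  proof eventually_elim
    case (elim w)
    then show ?case
      using norm_density[of f w] \<kappa>_nonneg
      by (cases "w \<in> D"; cases "w \<in> \<Delta>") (auto simp: density_def)
  qed
  then have "(LINT w|lebesgue. norm (density f w)) \<le> (LINT w|lebesgue. \<kappa> * (indicator D w * norm (rep_L2 f w)))"
    by (intro integral_mono_AE integrable_norm integrable_density integrable_mult_right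
        L2_restrict_integral assms(1))
  also have "\<dots> \<le> \<kappa> * (sqrt (measure lebesgue D) * norm f)"
    using L2_restrict_integral(2)[OF assms(1), of f] \<kappa>_nonneg by (simp add: mult_left_mono)
  finally show ?thesis by (simp add: mult.assoc)
qed

lemma interval_sets [simp]: "\<Delta> \<in> sets lebesgue"
  by simp

text \<open>\<open>density\<close> sees \<open>f\<close> only on \<open>\<Delta>\<close>, so
  \<open>f\<close> may be truncated first. This gives bounds on the whole type rather than on
  \<open>L2on \<Delta>\<close>, as needed for operators in the Banach algebra.\<close>

lemma density_L1_interval: "(LINT w|lebesgue. norm (density f w)) \<le> \<kappa> * sqrt (2 * l) * norm f"
proof -
  let ?P = "multiplier (indicator \<Delta>) f"
  have "(LINT w|lebesgue. norm (density f w)) = (LINT w|lebesgue. norm (density ?P w))"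
  proof (rule integral_cong_AE)
    show "AE w in lebesgue. norm (density f w) = norm (density ?P w)"
      using rep_multiplier[OF bounded_measurable_indicator[OF interval_sets], of f]
      by eventually_elim (auto simp: density_def indicator_def)
  qed measurable
  also have "\<dots> \<le> \<kappa> * sqrt (measure lebesgue \<Delta>) * norm ?P"
    by (rule density_L1) (auto intro: multiplier_indicator_mem)
  also have "\<dots> \<le> \<kappa> * sqrt (2 * l) * norm f"
    using norm_multiplier[OF bounded_measurable_indicator, of \<Delta> f] l_pos \<kappa>_nonneg
    by (intro mult_mono) auto
  finally show ?thesis .
qed

lemma density_add: "AE w in lebesgue. density (f + g) w = density f w + density g w"
  using rep_L2_plus[of f g] by eventually_elim (simp add: density_def vector_matrix_add_left scaleR_add_right)

lemma density_scaleC: "AE w in lebesgue. density (c *\<^sub>C f) w = c *s density f w"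
  using rep_L2_scaleC[of c f]
  by eventually_elim (simp add: density_def vector_matrix_cmult_left scaleR_cmult_vec vector_smult_assoc mult.commute)

lemma primitive_density_add: "primitive (density (f + g)) w = primitive (density f) w + primitive (density g) w"
proof -
  have "primitive (density (f + g)) w
      = (LINT \<xi>|lebesgue. indicator {..w} \<xi> *\<^sub>R density f \<xi> + indicator {..w} \<xi> *\<^sub>R density g \<xi>)"
    unfolding primitive_def
    by (rule integral_cong_AE)
      (use density_add[of f g] in \<open>auto intro!: borel_measurable_integrable integrable_primitive
        integrable_density Bochner_Integration.integrable_add simp: scaleR_add_right elim!: eventually_mono\<close>)
  then show ?thesis
    by (simp add: primitive_def Bochner_Integration.integral_add integrable_primitive integrable_density)
qed

lemma primitive_density_scaleC: "primitive (density (c *\<^sub>C f)) w = c *s primitive (density f) w"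
proof -
  have "primitive (density (c *\<^sub>C f)) w = (LINT \<xi>|lebesgue. c *s (indicator {..w} \<xi> *\<^sub>R density f \<xi>))"
    unfolding primitive_def
    by (rule integral_cong_AE)
      (use density_scaleC[of c f] in \<open>auto intro!: borel_measurable_integrable integrable_primitive
        integrable_density integrable_bounded_linear[OF bounded_linear_cmult_vec]
        simp: vec_eq_iff elim!: eventually_mono\<close>)
  also have "\<dots> = c *s primitive (density f) w"
    unfolding primitive_def
    by (rule integral_bounded_linear[OF bounded_linear_cmult_vec integrable_primitive[OF integrable_density]])
  finally show ?thesis .
qed

lemma norm_primitive_density: "norm (primitive (density f) w) \<le> \<kappa> * sqrt (2 * l) * norm f"
  using norm_primitive[OF integrable_density] density_L1_interval order_trans by blast

lemma model_chan_eq: "model_chan l \<pi> f = (LINT w|lebesgue. density f w)"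
  by (simp add: model_chan_def set_lebesgue_integral_def density_def)

text \<open>As the end value of the primitive, the channel inherits linearity and bounds from
  it.\<close>

lemma primitive_density_end: "primitive (density f) l = model_chan l \<pi> f"
  unfolding primitive_def model_chan_eq
  by (rule Bochner_Integration.integral_cong) (auto simp: density_def indicator_def)

lemma model_chan_add: "model_chan l \<pi> (f + g) = model_chan l \<pi> f + model_chan l \<pi> g"
  by (simp flip: primitive_density_end add: primitive_density_add)

lemma model_chan_scaleC: "model_chan l \<pi> (c *\<^sub>C f) = c *s model_chan l \<pi> f"
  by (simp flip: primitive_density_end add: primitive_density_scaleC)

lemma norm_model_chan: "norm (model_chan l \<pi> f) \<le> \<kappa> * sqrt (2 * l) * norm f"
  by (simp flip: primitive_density_end add: norm_primitive_density)

lemma bounded_linear_model_chan: "bounded_linear (model_chan l \<pi>)"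
  by (rule bounded_linear_intro[of _ "\<kappa> * sqrt (2 * l)"])
    (simp_all add: model_chan_add scaleR_scaleC model_chan_scaleC scaleR_cmult_vec
      norm_model_chan mult.commute[of "norm _"])

lemma emb_fun_measurable:
  assumes "g \<in> borel_measurable lebesgue" shows "emb_fun g \<in> borel_measurable lebesgue"
proof (rule borel_measurable_vecI)
  fix j
  have "(\<lambda>w. \<Sum>i\<in>UNIV. g w $ i * cnj (indicator \<Delta> w *\<^sub>R \<pi> w $ j $ i)) \<in> borel_measurable lebesgue"
    by (intro borel_measurable_sum borel_measurable_times \<pi>_nth_measurable
        borel_measurable_vec_nth[OF assms] borel_measurable_continuous_on[of cnj] continuous_intros)
  then show "(\<lambda>w. emb_fun g w $ j) \<in> borel_measurable lebesgue"
    by (simp add: emb_fun_def vector_matrix_nth hconj_def scaleR_sum_right)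
qed

lemma emb_fun_sq:
  assumes "g \<in> borel_measurable lebesgue" "\<And>w. norm (g w) \<le> c"
  shows "sq_integrable (emb_fun g)" "norm (emb g) \<le> \<kappa> * sqrt (2 * l) * c"
proof -
  have c: "0 \<le> c" using assms(2) norm_ge_zero order_trans by blast
  have "norm (g w v* hconj (\<pi> w)) \<le> \<kappa> * c" if "w \<in> \<Delta>" for w
  proof -
    have "norm (g w v* hconj (\<pi> w)) \<le> \<kappa> * norm (g w)"
      using norm_vector_matrix_le[of "hconj (\<pi> w)" 1 "g w"] \<pi>_le_1[OF that]
      by (simp add: \<kappa>_def hconj_def mult_ac)
    also have "\<dots> \<le> \<kappa> * c" by (intro mult_left_mono assms \<kappa>_nonneg)
    finally show ?thesis .
  qed
  then have le: "(norm (emb_fun g w))\<^sup>2 \<le> (\<kappa> * c)\<^sup>2 * indicator \<Delta> w" for w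
    by (auto simp: emb_fun_def indicator_def intro!: power_mono)
  have i: "integrable lebesgue (\<lambda>w. (\<kappa> * c)\<^sup>2 * indicator \<Delta> w)"
    by (intro integrable_mult_right) (simp flip: lmeasurable_iff_integrable)
  show "sq_integrable (emb_fun g)"
    by (rule sq_integrable_bound(1)[OF emb_fun_measurable[OF assms(1)] i le])
  have "(norm (emb g))\<^sup>2 \<le> (LINT w|lebesgue. (\<kappa> * c)\<^sup>2 * indicator \<Delta> w)"
    unfolding emb_def by (rule sq_integrable_bound(2)[OF emb_fun_measurable[OF assms(1)] i le])
  also have "\<dots> = (\<kappa> * sqrt (2 * l) * c)\<^sup>2"
    using l_pos by (simp add: power_mult_distrib)
  finally show "norm (emb g) \<le> \<kappa> * sqrt (2 * l) * c"
    by (rule power2_le_imp_le) (use l_pos \<kappa>_nonneg c in simp)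
qed

definition emb_dom :: "(real \<Rightarrow> complex^'m) set"
  where "emb_dom = {g \<in> borel_measurable lebesgue. \<exists>c. \<forall>w. norm (g w) \<le> c}"

lemma emb_dom_sq: "g \<in> emb_dom \<Longrightarrow> sq_integrable (emb_fun g)"
  unfolding emb_dom_def using emb_fun_sq(1) by blast

lemma rep_emb: "g \<in> emb_dom \<Longrightarrow> AE w in lebesgue. rep_L2 (emb g) w = emb_fun g w"
  unfolding emb_def by (rule rep_abs_L2[OF emb_dom_sq])

lemma emb_add:
  assumes "g \<in> emb_dom" "h \<in> emb_dom" shows "emb (\<lambda>w. g w + h w) = emb g + emb h"
  unfolding emb_def
  by (subst abs_L2_plus[OF emb_dom_sq emb_dom_sq, OF assms])
    (simp add: emb_fun_def[abs_def] vector_matrix_add_left scaleR_add_right)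

lemma emb_scaleC:
  assumes "g \<in> emb_dom" shows "emb (\<lambda>w. c *s g w) = c *\<^sub>C emb g"
  unfolding emb_def
  by (subst abs_L2_scaleC[OF emb_dom_sq, OF assms])
    (auto simp: emb_fun_def[abs_def] vector_matrix_cmult_left vec_eq_iff intro!: arg_cong[of _ _ abs_L2])

lemma emb_mem: assumes "g \<in> emb_dom" shows "emb g \<in> L2on \<Delta>"
  unfolding L2on_def vanishes_off.rep_eq mem_Collect_eq
  using rep_emb[OF assms] by eventually_elim (simp add: emb_fun_def)

lemma emb_dom_const [simp]: "(\<lambda>_. y) \<in> emb_dom"
  by (auto simp: emb_dom_def)

lemma cinner_emb:
  assumes "g \<in> emb_dom" shows "cinner f (emb g) = (LINT w|lebesgue. vdot (density f w) (g w))"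
proof -
  have [measurable]: "g \<in> borel_measurable lebesgue" using assms by (simp add: emb_dom_def)
  show ?thesis
    unfolding cinner_rep
  proof (rule integral_cong_AE)
    show "AE w in lebesgue. vdot (rep_L2 f w) (rep_L2 (emb g) w) = vdot (density f w) (g w)"
      using rep_emb[OF assms]
      by eventually_elim (simp add: emb_fun_def density_def vdot_scaleR_right vdot_scaleR_left vdot_adjoint)
  qed (simp_all add: borel_measurable_vdot density_measurable sq_integrable_measurable)
qed

definition chan_star :: "complex^'m \<Rightarrow> 'p L2" where "chan_star y = emb (\<lambda>_. y)"

lemma cinner_chan_star: "cinner f (chan_star y) = vdot (model_chan l \<pi> f) y"
proof -
  have "bounded_linear (\<lambda>v. vdot v y)"
    unfolding vdot_def 
    by (intro bounded_linear_sum bounded_linear_mult_const bounded_linear_vec_nth)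
  then show ?thesis
    unfolding chan_star_def model_chan_eq
    by (subst cinner_emb) (auto intro: integral_bounded_linear integrable_density)
qed

text \<open>For the data of the model this is \<open>diag_on R - diag_on (- R)\<close>. It is the
  coefficient of the primitive once the integral over \<open>{w..l}\<close> is written as the total
  minus the primitive: \<open>L\<close> comes from the last term of \<open>B\<close>,
  \<open>- hconj S0\<close> from the first and \<open>- S0\<close> from the second.\<close>

definition Dm :: "complex^'m^'m" where "Dm = L - S0 - hconj S0"

lemma Dm_hermitian: "hconj Dm = Dm"
  by (simp add: Dm_def hconj_diff hconj_add L_hermitian algebra_simps)

text \<open>Besides the Volterra term with \<open>Dm\<close> there is a finite rank term with
  \<open>S0\<close>, left over from the integral over \<open>{w..l}\<close>.\<close>

definition volterra_kernel :: "'p L2 \<Rightarrow> real \<Rightarrow> complex^'m"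
  where "volterra_kernel f w = \<i> *s (primitive (density f) w v* Dm + model_chan l \<pi> f v* S0)"

definition volterra :: "'p L2 \<Rightarrow> 'p L2" where "volterra f = emb (volterra_kernel f)"

text \<open>The bound is by the integral of \<open>density f\<close> instead of
  \<open>norm f\<close>, so that the gain on functions with small support is kept.\<close>

lemma norm_volterra_kernel:
  "norm (volterra_kernel f w) \<le> (onorm (\<lambda>v :: complex^'m. v v* Dm) + onorm (\<lambda>v :: complex^'m. v v* S0)) *
    (LINT w|lebesgue. norm (density f w))"
proof -
  have "norm (volterra_kernel f w) \<le> norm (primitive (density f) w v* Dm) + norm (model_chan l \<pi> f v* S0)"
    unfolding volterra_kernel_def norm_cmult_vec by (simp add: norm_triangle_ineq)
  also have "\<dots> \<le> onorm (\<lambda>v :: complex^'m. v v* Dm) * norm (primitive (density f) w)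
      + onorm (\<lambda>v :: complex^'m. v v* S0) * norm (model_chan l \<pi> f)"
    by (intro add_mono onorm bounded_linear_vector_matrix)
  also have "\<dots> \<le> onorm (\<lambda>v :: complex^'m. v v* Dm) * (LINT w|lebesgue. norm (density f w))
      + onorm (\<lambda>v :: complex^'m. v v* S0) * (LINT w|lebesgue. norm (density f w))"
    unfolding primitive_density_end[symmetric]
    by (intro add_mono mult_left_mono norm_primitive integrable_density onorm_pos_le bounded_linear_vector_matrix)
  finally show ?thesis by (simp add: distrib_right)
qed

lemma volterra_kernel_dom: "volterra_kernel f \<in> emb_dom"
proof -
  have "volterra_kernel f \<in> borel_measurable lebesgue"
    unfolding volterra_kernel_def[abs_def]
    by (rule borel_measurable_cmult_vec, rule borel_measurable_add,
        rule borel_measurable_continuous_on[OF linear_continuous_on[OF bounded_linear_vector_matrix]])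
      (auto intro: primitive_measurable density_measurable)
  then show ?thesis
    unfolding emb_dom_def using norm_volterra_kernel by blast
qed

lemma norm_volterra:
  "norm (volterra f) \<le> \<kappa> * sqrt (2 * l) * ((onorm (\<lambda>v :: complex^'m. v v* Dm) + onorm (\<lambda>v :: complex^'m. v v* S0)) *
    (LINT w|lebesgue. norm (density f w)))"
  unfolding volterra_def
  using emb_fun_sq(2)[of "volterra_kernel f"] volterra_kernel_dom[of f] norm_volterra_kernel
  by (auto simp: emb_dom_def)

lemma volterra_add: "volterra (f + g) = volterra f + volterra g"
proof -
  have "volterra_kernel (f + g) = (\<lambda>w. volterra_kernel f w + volterra_kernel g w)"
    by (auto simp: volterra_kernel_def primitive_density_add model_chan_add vector_matrix_add_left
        vector_add_ldistrib)
  then show ?thesis by (simp add: volterra_def emb_add volterra_kernel_dom)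
qed

lemma volterra_scaleC: "volterra (c *\<^sub>C f) = c *\<^sub>C volterra f"
proof -
  have "volterra_kernel (c *\<^sub>C f) = (\<lambda>w. c *s volterra_kernel f w)"
    by (auto simp: volterra_kernel_def primitive_density_scaleC model_chan_scaleC vector_matrix_cmult_left
        vec_eq_iff algebra_simps)
  then show ?thesis by (simp add: volterra_def emb_scaleC volterra_kernel_dom)
qed

lemma primitive_vector_matrix:
  fixes u :: "real \<Rightarrow> complex^'m"
  assumes "integrable lebesgue u"
  shows "primitive (\<lambda>w. u w v* A) w = primitive u w v* A"
proof -
  have "primitive (\<lambda>w. u w v* A) w = (LINT \<xi>|lebesgue. (indicator {..w} \<xi> *\<^sub>R u \<xi>) v* A)"
    by (simp add: primitive_def scaleR_cmult_vec vector_matrix_cmult_left)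
  also have "\<dots> = primitive u w v* A"
    unfolding primitive_def
    by (rule integral_bounded_linear[OF bounded_linear_vector_matrix integrable_primitive[OF assms]])
  finally show ?thesis .
qed

lemma vdot_cmult_right: "vdot u (c *s v) = cnj c * vdot u v"
  by (simp add: vdot_def sum_distrib_left mult_ac)

lemma vdot_add_right: "vdot u (v + w) = vdot u v + vdot u w"
  by (simp add: vdot_def algebra_simps sum.distrib)

lemma integral_vdot_density: "(LINT w|lebesgue. vdot (density f w) y) = vdot (model_chan l \<pi> f) y"
  using cinner_emb[of "\<lambda>_. y" f] cinner_chan_star[of f y] by (simp add: chan_star_def)

text \<open>Integration by parts leaves the boundary term with \<open>Dm\<close>; the finite rank
  terms with \<open>S0\<close> and its adjoint complete \<open>Dm\<close> to \<open>L\<close>.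
  Multiplication by \<open>w\<close> being symmetric, this is the identity
  \<open>(B - Bs) / i = Phi* L Phi\<close>.\<close>

lemma cinner_volterra:
  "cinner (volterra f) g = cinner f (volterra g) + \<i> * vdot (model_chan l \<pi> f v* L) (model_chan l \<pi> g)"
proof -
  let ?\<Phi> = "model_chan l \<pi>"
  let ?p = "\<lambda>f g. LINT w|lebesgue. vdot (density f w) (primitive (density g) w v* Dm)"
  have pm: "(\<lambda>w. primitive (density f) w v* Dm) \<in> borel_measurable lebesgue" for f
    by (rule borel_measurable_continuous_on[OF linear_continuous_on[OF bounded_linear_vector_matrix]])
      (intro primitive_measurable density_measurable)
  have pb: "norm (primitive (density f) w v* Dm) \<le> onorm (\<lambda>v :: complex^'m. v v* Dm) * (\<kappa> * sqrt (2 * l) * norm f)" for f w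
    by (rule order_trans[OF onorm[OF bounded_linear_vector_matrix]])
      (intro mult_left_mono norm_primitive_density onorm_pos_le bounded_linear_vector_matrix)
  have int: "integrable lebesgue (\<lambda>w. vdot (density f w) (primitive (density g) w v* Dm))" for f g
    by (rule integrable_vdot_bounded[OF integrable_density pm pb])
  have int0: "integrable lebesgue (\<lambda>w. vdot (density f w) y)" for f y
    by (rule integrable_vdot_bounded(1)[OF integrable_density, where c = "norm y"]) auto
  \<comment> \<open>Stated for all \<open>f\<close> and \<open>g\<close>, since the other side is
    its conjugate with the arguments exchanged.\<close>
  have right: "cinner f (volterra g) = - \<i> * (?p f g + vdot (?\<Phi> f) (?\<Phi> g v* S0))" for f g
  proof -
    have "cinner f (volterra g) = (LINT w|lebesgue. - \<i> * (vdot (density f w) (primitive (density g) w v* Dm)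
        + vdot (density f w) (?\<Phi> g v* S0)))"
      by (simp add: volterra_def cinner_emb volterra_kernel_dom volterra_kernel_def vdot_cmult_right
          vdot_add_right distrib_left)
    also have "\<dots> = - \<i> * (LINT w|lebesgue. vdot (density f w) (primitive (density g) w v* Dm)
        + vdot (density f w) (?\<Phi> g v* S0))"
      by (rule integral_mult_right_zero)
    finally show ?thesis
      by (simp add: Bochner_Integration.integral_add int int0 integral_vdot_density)
  qed
  have "cinner (volterra f) g = cnj (cinner g (volterra f))"
    by (rule cinner_commute)
  also have "\<dots> = \<i> * (cnj (?p g f) + cnj (vdot (?\<Phi> g) (?\<Phi> f v* S0)))"
    unfolding right by simp
  also have "cnj (vdot (?\<Phi> g) (?\<Phi> f v* S0)) = vdot (?\<Phi> f v* S0) (?\<Phi> g)"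
    by (rule vdot_commute[symmetric])
  also have "cnj (?p g f) = (LINT w|lebesgue. vdot (primitive (\<lambda>w. density f w v* Dm) w) (density g w))"
    by (subst Bochner_Integration.integral_cnj[symmetric])
      (simp add: primitive_vector_matrix integrable_density flip: vdot_commute)
  finally have left: "cinner (volterra f) g
      = \<i> * ((LINT w|lebesgue. vdot (primitive (\<lambda>w. density f w v* Dm) w) (density g w)) + vdot (?\<Phi> f v* S0) (?\<Phi> g))" .
  have "(LINT w|lebesgue. vdot (density f w v* Dm) (primitive (density g) w))
      + (LINT w|lebesgue. vdot (primitive (\<lambda>w. density f w v* Dm) w) (density g w))
      = vdot (LINT w|lebesgue. density f w v* Dm) (LINT w|lebesgue. density g w)"
    by (intro integral_parts integrable_density integrable_bounded_linear[OF bounded_linear_vector_matrix])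
  moreover have "(LINT w|lebesgue. density f w v* Dm) = ?\<Phi> f v* Dm"
    unfolding model_chan_eq
    by (rule integral_bounded_linear[OF bounded_linear_vector_matrix integrable_density])
  moreover have "vdot (density f w v* Dm) (primitive (density g) w) = vdot (density f w) (primitive (density g) w v* Dm)" for w
    by (simp add: vdot_adjoint Dm_hermitian)
  ultimately have parts: "?p f g + (LINT w|lebesgue. vdot (primitive (\<lambda>w. density f w v* Dm) w) (density g w))
      = vdot (?\<Phi> f v* Dm) (?\<Phi> g)"
    by (simp add: model_chan_eq)
  have "vdot (?\<Phi> f) (?\<Phi> g v* S0) = vdot (?\<Phi> f v* hconj S0) (?\<Phi> g)"
    by (simp add: vdot_adjoint)
  moreover have "vdot (?\<Phi> f v* L) (?\<Phi> g) = vdot (?\<Phi> f v* Dm) (?\<Phi> g) + vdot (?\<Phi> f v* S0) (?\<Phi> g)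
      + vdot (?\<Phi> f v* hconj S0) (?\<Phi> g)"
    by (simp add: Dm_def flip: vdot_add_left vector_matrix_add_right)
  ultimately show ?thesis
    unfolding left right parts[symmetric] by (simp add: algebra_simps)
qed

lemma set_integral_kernel:
  assumes "w \<in> \<Delta>"
  shows "(LINT \<xi>:{-l..w}|lebesgue. rep_L2 f \<xi> v* (\<pi> \<xi> ** A ** C)) = primitive (density f) w v* A v* C"
    and "(LINT \<xi>:{w..l}|lebesgue. rep_L2 f \<xi> v* (\<pi> \<xi> ** A ** C))
      = (model_chan l \<pi> f - primitive (density f) w) v* A v* C"
proof -
  have eq: "r *\<^sub>R (v v* (K ** A ** C)) = (r *\<^sub>R (v v* K)) v* (A ** C)"
    for r and v :: "complex^'p" and K :: "complex^'m^'p"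
    by (simp add: scaleR_cmult_vec vector_matrix_cmult_left vector_matrix_mul_assoc matrix_mul_assoc)
  have 1: "indicator {-l..w} \<xi> *\<^sub>R (rep_L2 f \<xi> v* (\<pi> \<xi> ** A ** C)) = (indicator {..w} \<xi> *\<^sub>R density f \<xi>) v* (A ** C)" for \<xi>
    unfolding eq using assms by (auto simp: density_def indicator_def)
  have le: "(LINT \<xi>|lebesgue. (indicator {..w} \<xi> *\<^sub>R density f \<xi>) v* (A ** C)) = primitive (density f) w v* A v* C"
    unfolding primitive_def vector_matrix_mul_assoc
    by (rule integral_bounded_linear[OF bounded_linear_vector_matrix integrable_primitive[OF integrable_density]])
  then show "(LINT \<xi>:{-l..w}|lebesgue. rep_L2 f \<xi> v* (\<pi> \<xi> ** A ** C)) = primitive (density f) w v* A v* C"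
    unfolding set_lebesgue_integral_def 1 .
  have int: "integrable lebesgue (\<lambda>\<xi>. density f \<xi> - indicator {..w} \<xi> *\<^sub>R density f \<xi>)"
    by (intro Bochner_Integration.integrable_diff integrable_primitive integrable_density)
  \<comment> \<open>At \<open>\<xi> = w\<close> the left indicator is 1 while the right side
    vanishes, so the two integrands agree only off this point.\<close>
  have 2: "indicator {w..l} \<xi> *\<^sub>R (rep_L2 f \<xi> v* (\<pi> \<xi> ** A ** C))
      = (density f \<xi> - indicator {..w} \<xi> *\<^sub>R density f \<xi>) v* (A ** C)" if "\<xi> \<noteq> w" for \<xi>
    unfolding eq using assms that by (auto simp: density_def indicator_def)
  have "(LINT \<xi>:{w..l}|lebesgue. rep_L2 f \<xi> v* (\<pi> \<xi> ** A ** C))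
      = (LINT \<xi>|lebesgue. (density f \<xi> - indicator {..w} \<xi> *\<^sub>R density f \<xi>) v* (A ** C))"
    unfolding set_lebesgue_integral_def
  proof (rule integral_cong_AE)
    have "AE \<xi> in lborel. \<xi> \<noteq> w" by (rule AE_lborel_singleton)
    then have ne: "AE \<xi> in lebesgue. \<xi> \<noteq> w" by (rule AE_completion)
    then show AE: "AE \<xi> in lebesgue. indicator {w..l} \<xi> *\<^sub>R (rep_L2 f \<xi> v* (\<pi> \<xi> ** A ** C))
      = (density f \<xi> - indicator {..w} \<xi> *\<^sub>R density f \<xi>) v* (A ** C)"
      by eventually_elim (rule 2)
    show m: "(\<lambda>\<xi>. (density f \<xi> - indicator {..w} \<xi> *\<^sub>R density f \<xi>) v* (A ** C)) \<in> borel_measurable lebesgue"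
      by (rule borel_measurable_continuous_on[OF linear_continuous_on[OF bounded_linear_vector_matrix]])
        (rule borel_measurable_integrable[OF int])
    \<comment> \<open>\<open>\<pi>\<close> is given as measurable on \<open>\<Delta>\<close> only;
      measurability of the integrand on the line is borrowed from \<open>density f\<close>.\<close>
    have "(\<lambda>\<xi>. indicator {w..l} \<xi> *\<^sub>R density f \<xi>) \<in> borel_measurable lebesgue"
      by (intro borel_measurable_integrable integrable_indicator_scaleR integrable_density)
    then have "(\<lambda>\<xi>. (indicator {w..l} \<xi> *\<^sub>R density f \<xi>) v* (A ** C)) \<in> borel_measurable lebesgue"
      by (rule borel_measurable_continuous_on[OF linear_continuous_on[OF bounded_linear_vector_matrix]])
    also have "(\<lambda>\<xi>. (indicator {w..l} \<xi> *\<^sub>R density f \<xi>) v* (A ** C))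
        = (\<lambda>\<xi>. indicator {w..l} \<xi> *\<^sub>R (rep_L2 f \<xi> v* (\<pi> \<xi> ** A ** C)))"
      unfolding eq using assms by (auto simp: density_def indicator_def)
    finally show "(\<lambda>\<xi>. indicator {w..l} \<xi> *\<^sub>R (rep_L2 f \<xi> v* (\<pi> \<xi> ** A ** C))) \<in> borel_measurable lebesgue" .
  qed
  also have "\<dots> = (LINT \<xi>|lebesgue. density f \<xi> - indicator {..w} \<xi> *\<^sub>R density f \<xi>) v* (A ** C)"
    by (rule integral_bounded_linear[OF bounded_linear_vector_matrix int])
  also have "\<dots> = (model_chan l \<pi> f - primitive (density f) w) v* A v* C"
    by (simp add: Bochner_Integration.integral_diff integrable_density integrable_primitive
        model_chan_eq primitive_def vector_matrix_mul_assoc)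
  finally show "(LINT \<xi>:{w..l}|lebesgue. rep_L2 f \<xi> v* (\<pi> \<xi> ** A ** C))
      = (model_chan l \<pi> f - primitive (density f) w) v* A v* C" .
qed

lemma bounded_mult_var: "bounded_measurable (\<lambda>w. if w \<in> \<Delta> then w else 0) l"
proof -
  have "(\<lambda>w :: real. w) \<in> borel_measurable lebesgue"
    by (rule measurable_completion) simp
  then have "(\<lambda>w. indicator \<Delta> w * w) \<in> borel_measurable lebesgue"
    by (intro borel_measurable_times borel_measurable_indicator) auto
  also have "(\<lambda>w. indicator \<Delta> w * w) = (\<lambda>w. if w \<in> \<Delta> then w else 0)"
    by (auto simp: indicator_def)
  finally show ?thesis
    using l_pos by (auto simp: bounded_measurable_def)
qed

lemma mult_var_eq: "mult_var l f = multiplier (\<lambda>w. if w \<in> \<Delta> then w else 0) f"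
  unfolding mult_var_def multiplier_def by (rule arg_cong[of _ _ abs_L2]) auto

lemma model_op_eq: "model_op l L S0 \<pi> f = mult_var l f + volterra f"
proof -
  have "mult_var l f + volterra f
      = abs_L2 (\<lambda>w. (if w \<in> \<Delta> then w else 0) *\<^sub>R rep_L2 f w + emb_fun (volterra_kernel f) w)"
    unfolding mult_var_eq multiplier_def volterra_def emb_def
    by (rule abs_L2_plus[OF sq_integrable_multiplier(1)[OF bounded_mult_var sq_integrable_rep_L2]
          emb_dom_sq[OF volterra_kernel_dom]])
  also have "\<dots> = model_op l L S0 \<pi> f"
    unfolding model_op_def
  proof (rule arg_cong[of _ _ abs_L2], rule ext)
    fix w
    show "(if w \<in> \<Delta> then w else 0) *\<^sub>R rep_L2 f w + emb_fun (volterra_kernel f) w =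
      (if w \<in> \<Delta> then
      w *\<^sub>R rep_L2 f w
      - \<i> *s (LINT \<xi>:{-l..w}|lebesgue. rep_L2 f \<xi> v* (\<pi> \<xi> ** hconj S0 ** hconj (\<pi> w)))
      + \<i> *s (LINT \<xi>:{w..l}|lebesgue. rep_L2 f \<xi> v* (\<pi> \<xi> ** S0 ** hconj (\<pi> w)))
      + \<i> *s (LINT \<xi>:{-l..w}|lebesgue. rep_L2 f \<xi> v* (\<pi> \<xi> ** L ** hconj (\<pi> w)))
    else 0)"
    proof (cases "w \<in> \<Delta>")
      case True
      then show ?thesis
        by (simp add: set_integral_kernel[OF True] emb_fun_def volterra_kernel_def Dm_def
            vector_matrix_diff_left vector_matrix_diff_right vector_matrix_cmult_left
            vector_matrix_add_left vec_eq_iff algebra_simps)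
    next
      case False
      show ?thesis unfolding if_not_P[OF False] using False by (simp add: emb_fun_def)
    qed
  qed
  finally show ?thesis by simp
qed

lemma model_op_scaleC: "model_op l L S0 \<pi> (c *\<^sub>C f) = c *\<^sub>C model_op l L S0 \<pi> f"
  unfolding model_op_eq volterra_scaleC mult_var_eq multiplier_scaleC[OF bounded_mult_var] scaleC_add_right ..

lemma norm_volterra_le: "\<exists>c. \<forall>f. norm (volterra f) \<le> c * (LINT w|lebesgue. norm (density f w))"
  using norm_volterra by (auto simp: mult.assoc[symmetric])

lemma bounded_linear_volterra: "bounded_linear volterra"
proof -
  let ?c = "\<kappa> * sqrt (2 * l) * (onorm (\<lambda>v :: complex^'m. v v* Dm) + onorm (\<lambda>v :: complex^'m. v v* S0))"
  have "0 \<le> ?c"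
    using \<kappa>_nonneg l_pos by (intro mult_nonneg_nonneg add_nonneg_nonneg onorm_pos_le bounded_linear_vector_matrix) auto
  then have "norm (volterra f) \<le> norm f * (?c * (\<kappa> * sqrt (2 * l)))" for f
    using order_trans[OF norm_volterra[of f], of "?c * (\<kappa> * sqrt (2 * l) * norm f)"]
      mult_left_mono[OF density_L1_interval[of f], of ?c]
    by (simp add: mult_ac)
  then show ?thesis
    by (intro bounded_linear_intro) (simp_all add: volterra_add scaleR_scaleC volterra_scaleC)
qed

lemma bounded_linear_model_op: "bounded_linear (model_op l L S0 \<pi>)"
  unfolding model_op_eq[abs_def] mult_var_eq
  by (intro bounded_linear_add bounded_linear_volterra bounded_linear_multiplier[OF bounded_mult_var])

lemma mult_var_mem: "mult_var l f \<in> L2on \<Delta>"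
proof -
  have "AE w in lebesgue. w \<notin> \<Delta> \<longrightarrow> rep_L2 (mult_var l f) w = 0"
    unfolding mult_var_eq using rep_multiplier[OF bounded_mult_var, of f] by eventually_elim auto
  then show ?thesis by (simp add: L2on_def vanishes_off.rep_eq)
qed

lemma volterra_mem: "volterra f \<in> L2on \<Delta>"
  by (simp add: volterra_def emb_mem volterra_kernel_dom)

end

section \<open>The contour integral of the resolvent\<close>

text \<open>The subspace is presented by a bounded complex linear projection. Membership becomes
  \<open>P f = f\<close>, and closedness is the continuity of \<open>P\<close>.\<close>

locale closed_subspace =
  fixes H :: "'p::finite L2 set" and P :: "'p L2 \<Rightarrow> 'p L2"
  assumes bounded_linear_P: "bounded_linear P" and P_mem: "\<And>f. P f \<in> H"
    and P_id: "\<And>f. f \<in> H \<Longrightarrow> P f = f" and P_scaleC: "\<And>c f. P (c *\<^sub>C f) = c *\<^sub>C P f"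
begin

lemma mem_iff: "f \<in> H \<longleftrightarrow> P f = f"
  using P_mem[of f] P_id[of f] by auto

lemma add_mem: "f \<in> H \<Longrightarrow> g \<in> H \<Longrightarrow> f + g \<in> H"
  by (simp add: mem_iff linear_simps[OF bounded_linear_P])

lemma diff_mem: "f \<in> H \<Longrightarrow> g \<in> H \<Longrightarrow> f - g \<in> H"
  by (simp add: mem_iff linear_simps[OF bounded_linear_P])

lemma scaleC_mem: "f \<in> H \<Longrightarrow> c *\<^sub>C f \<in> H"
  by (simp add: mem_iff P_scaleC)

lemma adj_eqI:
  assumes "k \<in> H" "\<And>f. f \<in> H \<Longrightarrow> cinner (K f) g = cinner f k"
  shows "adj H K g = k"
  unfolding adj_def
proof (rule the_equality)
  show "k' = k" if "k' \<in> H \<and> (\<forall>f\<in>H. cinner (K f) g = cinner f k')" for k'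
    using that assms by (intro cinner_eqI[of H]) (auto intro: diff_mem)
qed (use assms in auto)

lemma chan_adj_eqI:
  assumes "k \<in> H" "\<And>f. f \<in> H \<Longrightarrow> vdot (F f) y = cinner f k"
  shows "chan_adj H F y = k"
  unfolding chan_adj_def
proof (rule the_equality)
  show "k' = k" if "k' \<in> H \<and> (\<forall>f\<in>H. vdot (F f) y = cinner f k')" for k'
    using that assms by (intro cinner_eqI[of H]) (auto intro: diff_mem)
qed (use assms in auto)

lemma exp_mem:
  assumes "\<And>f. f \<in> H \<Longrightarrow> endo_apply E f \<in> H" "f \<in> H"
  shows "endo_apply (exp E) f \<in> H"
proof -
  have "endo_apply (E ^ n) f \<in> H" for n
    by (induction n) (simp_all add: assms)
  then have "P (endo_apply (exp E) f) = endo_apply (exp E) f"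
    by (intro endo_exp_intertwine bounded_linear_P) (simp add: P_id)
  then show ?thesis using P_mem by metis
qed

lemma integral_mem:
  fixes \<phi> :: "real \<Rightarrow> 'p L2"
  assumes "\<phi> integrable_on S" "\<And>x. \<phi> x \<in> H" shows "integral S \<phi> \<in> H"
proof -
  have "P (integral S \<phi>) = integral S (P \<circ> \<phi>)"
    by (rule integral_linear[OF assms(1) bounded_linear_P, symmetric])
  also have "P \<circ> \<phi> = \<phi>" using assms(2) by (auto simp: P_id)
  finally show ?thesis by (simp add: mem_iff)
qed

end

text \<open>Elements of \<open>'p L2 endo\<close> need only be real linear. Complex scalars enter as
  operators, and complex linearity of an operator is its commutation with all of them.\<close>

definition scalar_endo :: "complex \<Rightarrow> 'p::finite L2 endo"
  where "scalar_endo c = Endo (scaleC c)"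

lemma endo_apply_scalar [simp]: "endo_apply (scalar_endo c) f = c *\<^sub>C f"
  by (simp add: scalar_endo_def endo_apply_Endo bounded_linear_scaleC)

lemma scalar_endo_mult: "scalar_endo c * scalar_endo d = scalar_endo (c * d)"
  by (rule endo_eqI) simp

lemma scalar_endo_power: "scalar_endo c ^ n = scalar_endo (c ^ n)"
  by (induction n) (auto intro: endo_eqI simp: scalar_endo_mult)

lemma scalar_endo_mult_power:
  assumes "E * scalar_endo c = scalar_endo c * E"
  shows "(scalar_endo c * E) ^ n = scalar_endo (c ^ n) * E ^ n"
proof (induction n)
  case (Suc n)
  have "E * scalar_endo c ^ n = scalar_endo c ^ n * E"
    by (rule power_commuting_commutes[OF assms[symmetric], symmetric])
  then have comm: "E * scalar_endo (c ^ n) = scalar_endo (c ^ n) * E"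
    by (simp only: scalar_endo_power)
  have "(scalar_endo c * E) ^ Suc n = scalar_endo c * (E * scalar_endo (c ^ n)) * E ^ n"
    by (simp only: power_Suc Suc mult.assoc)
  also have "\<dots> = scalar_endo (c ^ Suc n) * E ^ Suc n"
    unfolding comm power_Suc scalar_endo_mult[symmetric] mult.assoc ..
  finally show ?case .
next
  case 0
  show ?case by (rule endo_eqI) simp
qed

lemma norm_endo_le:
  assumes "\<And>f. norm (endo_apply E f) \<le> c * norm f" "0 \<le> c" shows "norm E \<le> c"
  using assms by transfer (auto intro: norm_blinfun_bound)

lemma norm_scalar_endo: "norm (scalar_endo c) \<le> cmod c"
  by (rule norm_endo_le) (simp_all add: norm_scaleC)

lemma higher_deriv_exp_linear: "(deriv ^^ n) (\<lambda>z. exp (a * z)) = (\<lambda>z::complex. a ^ n * exp (a * z))"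
proof (induction n)
  case (Suc n)
  have "((\<lambda>z. a ^ n * exp (a * z)) has_field_derivative a ^ Suc n * exp (a * z)) (at z)" for z
    by (auto intro!: derivative_eq_intros)
  then show ?case by (auto simp: Suc DERIV_imp_deriv)
qed simp

text \<open>Cauchy's formula for the \<open>n\<close>th derivative of \<open>exp (i \<mu>)\<close>
  at 0; the values \<open>i^n / n!\<close> are the coefficients of the exponential series.\<close>

lemma contour_integral_exp_power:
  assumes "0 < r"
  shows "((\<lambda>\<mu>. exp (\<i> * \<mu>) / \<mu> ^ Suc n) has_contour_integral (2 * pi * \<i> * (\<i> ^ n / fact n))) (circlepath 0 r)"
proof -
  have "((\<lambda>u. exp (\<i> * u) / (u - 0) ^ Suc n) has_contour_integral
      (2 * pi * \<i>) / (fact n) * (deriv ^^ n) (\<lambda>u. exp (\<i> * u)) 0) (circlepath 0 r)"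
    by (rule Cauchy_has_contour_integral_higher_derivative_circlepath)
      (use assms in \<open>auto intro!: continuous_intros holomorphic_intros\<close>)
  then show ?thesis by (simp add: higher_deriv_exp_linear)
qed

text \<open>The scalar core of the functional calculus. On the circle the terms are dominated by a
  geometric series of ratio \<open>k / r\<close>, so convergence is uniform and the integral may be
  taken termwise.\<close>

lemma contour_integral_exp_Laurent:
  fixes c :: "nat \<Rightarrow> complex"
  assumes c: "\<And>n. cmod (c n) \<le> C * k ^ n" and "0 \<le> k" "k < r"
  defines "g \<equiv> \<lambda>\<mu>. \<Sum>n. c n / \<mu> ^ Suc n"
  shows "((\<lambda>\<mu>. exp (\<i> * \<mu>) * g \<mu>) has_contour_integral (2 * pi * \<i> * (\<Sum>n. c n * (\<i> ^ n / fact n)))) (circlepath 0 r)"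
proof -
  have r: "0 < r" using assms by simp
  have C: "0 \<le> C" using order_trans[OF norm_ge_zero c[of 0]] by simp
  define s where "s N \<mu> = (\<Sum>n<N. c n * (exp (\<i> * \<mu>) / \<mu> ^ Suc n))" for N \<mu>
  have sN: "(s N has_contour_integral (\<Sum>n<N. c n * (2 * pi * \<i> * (\<i> ^ n / fact n)))) (circlepath 0 r)" for N
    unfolding s_def
    by (intro has_contour_integral_sum has_contour_integral_lmul contour_integral_exp_power r) simp
  have bound: "cmod (c n * (exp (\<i> * \<mu>) / \<mu> ^ Suc n)) \<le> C * exp r / r * (k / r) ^ n" if "\<mu> \<in> sphere 0 r" for n \<mu>
  proof -
    have \<mu>: "cmod \<mu> = r" using that by simp
    have e: "cmod (exp (\<i> * \<mu>)) \<le> exp r"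
      using norm_exp[of "\<i> * \<mu>"] \<mu> by (simp only: norm_mult norm_ii mult_1)
    have "cmod (c n * (exp (\<i> * \<mu>) / \<mu> ^ Suc n)) \<le> (C * k ^ n) * (exp r / r ^ Suc n)"
      unfolding norm_mult norm_divide norm_power \<mu>
      by (intro mult_mono c divide_right_mono e divide_nonneg_nonneg mult_nonneg_nonneg zero_le_power
          norm_ge_zero C \<open>0 \<le> k\<close> less_imp_le[OF r])
    then show ?thesis by (simp add: power_divide field_simps)
  qed
  have sum: "summable (\<lambda>n. C * exp r / r * (k / r) ^ n)"
    by (intro summable_mult summable_geometric) (use assms in simp)
  have unif: "uniform_limit (sphere 0 r) s (\<lambda>\<mu>. \<Sum>n. c n * (exp (\<i> * \<mu>) / \<mu> ^ Suc n)) sequentially"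
    unfolding s_def using bound by (intro Weierstrass_m_test[OF _ sum]) auto
  have lim_eq: "(\<Sum>n. c n * (exp (\<i> * \<mu>) / \<mu> ^ Suc n)) = exp (\<i> * \<mu>) * g \<mu>" if "\<mu> \<in> sphere 0 r" for \<mu>
  proof -
    have s1: "summable (\<lambda>n. c n * (exp (\<i> * \<mu>) / \<mu> ^ Suc n))"
      by (rule summable_comparison_test'[OF sum, of 0]) (rule bound[OF that])
    \<comment> \<open>Removing the nonzero exponential gives summability of the Laurent series
      itself, needed to pull the factor out of the sum.\<close>
    have "summable (\<lambda>n. exp (- (\<i> * \<mu>)) * (c n * (exp (\<i> * \<mu>) / \<mu> ^ Suc n)))"
      by (rule summable_mult[OF s1])
    then have "summable (\<lambda>n. c n / \<mu> ^ Suc n)"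
      by (simp add: exp_minus field_simps)
    then show ?thesis
      unfolding g_def by (subst suminf_mult[symmetric]) (auto simp: mult_ac)
  qed
  have unif': "uniform_limit (sphere 0 r) s (\<lambda>\<mu>. exp (\<i> * \<mu>) * g \<mu>) sequentially"
    using unif uniform_limit_cong'[of "sphere 0 r" s s "\<lambda>\<mu>. \<Sum>n. c n * (exp (\<i> * \<mu>) / \<mu> ^ Suc n)"
      "\<lambda>\<mu>. exp (\<i> * \<mu>) * g \<mu>"] lim_eq by blast
  have "\<forall>\<^sub>F N in sequentially. s N contour_integrable_on circlepath 0 r"
    by (rule always_eventually, rule allI, rule has_contour_integral_integrable, rule sN)
  note lim = contour_integral_uniform_limit_circlepath[OF this unif' trivial_limit_sequentially r]
  have "summable (\<lambda>n. norm (c n * (\<i> ^ n / fact n)))"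
  proof (rule summable_comparison_test'[where N = 0])
    show "summable (\<lambda>n. C * (inverse (fact n) * k ^ n))" by (intro summable_mult summable_exp)
    show "norm (norm (c n * (\<i> ^ n / fact n))) \<le> C * (inverse (fact n) * k ^ n)" for n
      using mult_right_mono[OF c[of n], of "inverse (fact n)"] by (simp add: norm_mult norm_divide norm_power field_simps)
  qed
  then have "(\<lambda>n. c n * (\<i> ^ n / fact n)) sums (\<Sum>n. c n * (\<i> ^ n / fact n))"
    by (rule summable_sums[OF summable_norm_cancel])
  then have "(\<lambda>n. 2 * pi * \<i> * (c n * (\<i> ^ n / fact n))) sums (2 * pi * \<i> * (\<Sum>n. c n * (\<i> ^ n / fact n)))"
    by (rule sums_mult)
  then have "(\<lambda>N. contour_integral (circlepath 0 r) (s N)) \<longlonglongrightarrow> 2 * pi * \<i> * (\<Sum>n. c n * (\<i> ^ n / fact n))"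
    unfolding sums_def contour_integral_unique[OF sN] by (simp add: mult_ac)
  with lim(2) have eq: "contour_integral (circlepath 0 r) (\<lambda>\<mu>. exp (\<i> * \<mu>) * g \<mu>) = 2 * pi * \<i> * (\<Sum>n. c n * (\<i> ^ n / fact n))"
    by (rule LIMSEQ_unique)
  show ?thesis
    using has_contour_integral_integral[OF lim(1)] unfolding eq .
qed

section \<open>The characteristic function\<close>

text \<open>\<open>Bs\<close> and \<open>Fs\<close> are explicit adjoints of \<open>opB X\<close>
  and \<open>chan X\<close>, which evaluate the definite descriptions \<open>adj\<close> and
  \<open>chan_adj\<close>. The assumption \<open>node\<close> is the colligation condition for
  \<open>B\<close>.\<close>

locale colligation_node = closed_subspace H P
  for H :: "'p::finite L2 set" and P :: "'p L2 \<Rightarrow> 'p L2" +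
  fixes X :: "('p, 'e::finite) colligation" and b :: real
    and Bs :: "'p L2 \<Rightarrow> 'p L2" and Fs :: "complex^'e \<Rightarrow> 'p L2"
  assumes hspace_X: "hspace X = H"
    and opA_X: "opA X = (\<lambda>f. b *\<^sub>R opB X (opB X (opB X f)))"
    and bounded_linear_B: "bounded_linear (opB X)"
    and B_scaleC: "\<And>c f. opB X (c *\<^sub>C f) = c *\<^sub>C opB X f" and B_mem: "\<And>f. opB X f \<in> H"
    and bounded_linear_chan: "bounded_linear (chan X)"
    and chan_scaleC: "\<And>c f. chan X (c *\<^sub>C f) = c *s chan X f"
    and bounded_linear_Fs: "bounded_linear Fs"
    and Fs_scale: "\<And>c y. Fs (c *s y) = c *\<^sub>C Fs y" and Fs_mem: "\<And>y. Fs y \<in> H"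
    and Fs_adjoint: "\<And>f y. f \<in> H \<Longrightarrow> vdot (chan X f) y = cinner f (Fs y)"
    and Bs_mem: "\<And>f. f \<in> H \<Longrightarrow> Bs f \<in> H"
    and Bs_adjoint: "\<And>f g. f \<in> H \<Longrightarrow> g \<in> H \<Longrightarrow> cinner (opB X f) g = cinner f (Bs g)"
    and node: "\<And>f. f \<in> H \<Longrightarrow> Fs (rowop (sigB X) (chan X f)) = (- \<i>) *\<^sub>C (opB X f - Bs f)"
begin

definition EB :: "'p L2 endo" where "EB = Endo (opB X)"

definition pen :: "real \<Rightarrow> real \<Rightarrow> 'p L2 endo" where "pen t x = (t * b) *\<^sub>R EB ^ 3 + x *\<^sub>R EB"

text \<open>The argument order follows \<open>opT X x t\<close>, whereas \<open>pen t x\<close>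
  follows \<open>pencil X t x\<close>.\<close>

definition ET :: "real \<Rightarrow> real \<Rightarrow> 'p L2 endo" where "ET x t = exp (scalar_endo \<i> * pen t x)"

lemma endo_apply_EB [simp]: "endo_apply EB f = opB X f"
  by (simp add: EB_def endo_apply_Endo bounded_linear_B)

lemma pen_apply: "endo_apply (pen t x) f = t *\<^sub>R opA X f + x *\<^sub>R opB X f"
  by (simp add: pen_def endo_simps opA_X eval_nat_numeral)

lemma pen_scalar: "pen t x * scalar_endo c = scalar_endo c * pen t x"
  by (rule endo_eqI) (simp add: pen_def endo_simps eval_nat_numeral B_scaleC scaleC_scaleR scaleC_add_right)

lemma pen_scaleC: "endo_apply (pen t x) (c *\<^sub>C f) = c *\<^sub>C endo_apply (pen t x) f"
  using arg_cong[OF pen_scalar, of "\<lambda>E. endo_apply E f"] by simp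

lemma pen_mem: "endo_apply (pen t x) f \<in> H"
  by (simp add: pen_apply opA_X scaleR_scaleC add_mem scaleC_mem B_mem)

lemma bounded_linear_generator: "bounded_linear (\<lambda>f. \<i> *\<^sub>C (t *\<^sub>R opA X f + x *\<^sub>R opB X f))"
proof -
  have "(\<lambda>f. \<i> *\<^sub>C (t *\<^sub>R opA X f + x *\<^sub>R opB X f)) = endo_apply (scalar_endo \<i> * pen t x)"
    by (rule ext) (simp add: pen_apply)
  then show ?thesis by (simp add: bounded_linear_endo_apply)
qed

lemma opT_eq: "opT X x t f = endo_apply (ET x t) f"
proof -
  have "Endo (\<lambda>f. \<i> *\<^sub>C (t *\<^sub>R opA X f + x *\<^sub>R opB X f)) = scalar_endo \<i> * pen t x"
    by (rule endo_eqI) (simp add: endo_apply_Endo[OF bounded_linear_generator] pen_apply)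
  then show ?thesis
    by (simp add: opT_def op_exp_eq[OF bounded_linear_generator] ET_def)
qed

lemma ET_mem: "f \<in> H \<Longrightarrow> endo_apply (ET x t) f \<in> H"
  unfolding ET_def by (rule exp_mem) (simp_all add: scaleC_mem pen_mem)

lemma chan_adj_eq: "chan_adj H (chan X) y = Fs y"
  by (rule chan_adj_eqI) (auto simp: Fs_mem Fs_adjoint)

lemma pencil_eq: "pencil X t x \<mu> f = endo_apply (pen t x - scalar_endo \<mu>) f"
  by (simp add: pencil_def pen_apply endo_simps)

definition resolvent :: "real \<Rightarrow> real \<Rightarrow> complex \<Rightarrow> 'p L2 endo"
  where "resolvent t x \<mu> = scalar_endo (- inverse \<mu>) * (\<Sum>n. (scalar_endo (inverse \<mu>) * pen t x) ^ n)"

lemma resolvent: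
  assumes "norm (pen t x) < cmod \<mu>"
  shows "summable (\<lambda>n. (scalar_endo (inverse \<mu>) * pen t x) ^ n)"
    and "(pen t x - scalar_endo \<mu>) * resolvent t x \<mu> = 1"
    and "resolvent t x \<mu> * (pen t x - scalar_endo \<mu>) = 1"
proof -
  have \<mu>: "0 < cmod \<mu>" using assms norm_ge_zero le_less_trans by blast
  let ?x = "scalar_endo (inverse \<mu>) * pen t x"
  have "norm ?x \<le> cmod (inverse \<mu>) * norm (pen t x)"
    by (rule order_trans[OF norm_mult_ineq]) (intro mult_right_mono norm_scalar_endo norm_ge_zero)
  also have "\<dots> < 1"
    using assms \<mu> by (simp add: inverse_eq_divide norm_divide pos_divide_less_eq)
  finally have x: "norm ?x < 1" .
  show "summable (\<lambda>n. ?x ^ n)" by (rule Neumann_series(1)[OF x])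
  have J1: "scalar_endo 1 = (1 :: 'p L2 endo)" by (rule endo_eqI) simp
  \<comment> \<open>The scalar may be factored out on the right because \<open>pen t x\<close> is
    complex linear.\<close>
  have eq: "pen t x - scalar_endo \<mu> = (1 - ?x) * scalar_endo (- \<mu>)"
  proof (rule endo_eqI)
    fix f
    have "endo_apply ((1 - ?x) * scalar_endo (- \<mu>)) f = - \<mu> *\<^sub>C f - inverse \<mu> *\<^sub>C (endo_apply (pen t x * scalar_endo (-\<mu>)) f)"
      by (simp add: endo_simps)
    also have "\<dots> = endo_apply (pen t x - scalar_endo \<mu>) f"
      unfolding pen_scalar using \<mu> by (simp add: endo_simps scaleC_minus_left scaleC_minus_right)
    finally show "endo_apply (pen t x - scalar_endo \<mu>) f = endo_apply ((1 - ?x) * scalar_endo (- \<mu>)) f" by simp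
  qed
  have J: "scalar_endo (- \<mu>) * scalar_endo (- inverse \<mu>) = (1 :: 'p L2 endo)"
    "scalar_endo (- inverse \<mu>) * scalar_endo (- \<mu>) = (1 :: 'p L2 endo)"
    using \<mu> by (simp_all add: scalar_endo_mult J1)
  show "(pen t x - scalar_endo \<mu>) * resolvent t x \<mu> = 1"
    unfolding eq resolvent_def
    by (subst mult.assoc) (simp only: J mult_1_left Neumann_series(2)[OF x] mult.assoc[of "scalar_endo (- \<mu>)", symmetric])
  have "resolvent t x \<mu> * (pen t x - scalar_endo \<mu>)
      = scalar_endo (- inverse \<mu>) * ((\<Sum>n. ?x ^ n) * (1 - ?x)) * scalar_endo (- \<mu>)"
    unfolding eq resolvent_def by (simp only: mult.assoc)
  then show "resolvent t x \<mu> * (pen t x - scalar_endo \<mu>) = 1"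
    by (simp add: Neumann_series(3)[OF x] J)
qed

lemma pencil_resolvent:
  assumes "norm (pen t x) < cmod \<mu>"
  shows "pencil X t x \<mu> (endo_apply (resolvent t x \<mu>) f) = f"
    and "endo_apply (resolvent t x \<mu>) (pencil X t x \<mu> f) = f"
  unfolding pencil_eq endo_apply_mult[symmetric] resolvent[OF assms] by simp_all

text \<open>The resolvent equation expresses the solution through \<open>f\<close> and its image
  under the pencil operator, and \<open>pen t x\<close> maps the whole type into
  \<open>H\<close>.\<close>

lemma resolvent_mem:
  assumes "norm (pen t x) < cmod \<mu>" "f \<in> H" shows "endo_apply (resolvent t x \<mu>) f \<in> H"
proof -
  have \<mu>: "\<mu> \<noteq> 0" using assms(1) norm_ge_zero[of "pen t x"] by auto
  let ?g = "endo_apply (resolvent t x \<mu>) f"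
  have "endo_apply (pen t x) ?g - \<mu> *\<^sub>C ?g = f"
    using pencil_resolvent(1)[OF assms(1), of f] by (simp add: pencil_eq endo_simps)
  then have "\<mu> *\<^sub>C ?g = endo_apply (pen t x) ?g - f" by (simp add: algebra_simps)
  then have "?g = inverse \<mu> *\<^sub>C (endo_apply (pen t x) ?g - f)"
    using \<mu> by (metis scaleC_scaleC left_inverse scaleC_one)
  then show ?thesis by (metis scaleC_mem diff_mem pen_mem assms(2))
qed

lemma pencil_mem: "f \<in> H \<Longrightarrow> pencil X t x \<mu> f \<in> H"
  using pen_mem[of t x f] by (simp add: pencil_eq endo_simps diff_mem scaleC_mem)

lemma pencil_bij:
  assumes "norm (pen t x) < cmod \<mu>" shows "bij_betw (pencil X t x \<mu>) H H"
  by (rule bij_betw_byWitness[where f' = "endo_apply (resolvent t x \<mu>)"])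
    (auto simp: pencil_resolvent[OF assms] resolvent_mem[OF assms] pencil_mem)

lemma inv_into_pencil:
  assumes "norm (pen t x) < cmod \<mu>" "f \<in> H"
  shows "inv_into H (pencil X t x \<mu>) f = endo_apply (resolvent t x \<mu>) f"
  using pencil_bij[OF assms(1)] resolvent_mem[OF assms] pencil_resolvent(1)[OF assms(1)]
  by (metis bij_betw_imp_inj_on inv_into_f_f)

section \<open>Laurent and exponential series seen through the channel\<close>

lemma chan_resolvent:
  assumes "norm (pen t x) < cmod \<mu>"
  shows "(\<lambda>n. - (chan X (endo_apply (pen t x ^ n) f) $ j / \<mu> ^ Suc n)) sums
    chan X (endo_apply (resolvent t x \<mu>) f) $ j"
proof -
  have \<mu>: "\<mu> \<noteq> 0" using assms norm_ge_zero[of "pen t x"] by auto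
  have "bounded_linear (\<lambda>E. chan X (endo_apply (scalar_endo (- inverse \<mu>) * E) f) $ j)"
    by (intro bounded_linear_compose[OF bounded_linear_vec_nth] bounded_linear_compose[OF bounded_linear_chan]
        bounded_linear_compose[OF bounded_bilinear.bounded_linear_left[OF bounded_bilinear_endo_apply]]
        bounded_linear_mult_right)
  from bounded_linear.sums[OF this summable_sums[OF resolvent(1)[OF assms]]]
  have "(\<lambda>n. chan X (endo_apply (scalar_endo (- inverse \<mu>) * (scalar_endo (inverse \<mu>) * pen t x) ^ n) f) $ j) sums
    chan X (endo_apply (resolvent t x \<mu>) f) $ j"
    by (simp only: resolvent_def)
  moreover have "chan X (endo_apply (scalar_endo (- inverse \<mu>) * (scalar_endo (inverse \<mu>) * pen t x) ^ n) f) $ j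
      = - (chan X (endo_apply (pen t x ^ n) f) $ j / \<mu> ^ Suc n)" for n
    unfolding scalar_endo_mult_power[OF pen_scalar]
    by (simp add: chan_scaleC power_inverse divide_inverse mult_ac)
  ultimately show ?thesis by simp
qed

text \<open>The coefficients of \<open>chan_resolvent\<close> weighted by \<open>i^n / n!\<close>:
  exactly the sum that \<open>contour_integral_exp_Laurent\<close> produces.\<close>

lemma chan_exp:
  "(\<lambda>n. chan X (endo_apply (pen t x ^ n) f) $ j * (\<i> ^ n / fact n)) sums chan X (endo_apply (ET x t) f) $ j"
proof -
  have "bounded_linear (\<lambda>f. chan X f $ j)"
    by (rule bounded_linear_compose[OF bounded_linear_vec_nth bounded_linear_chan])
  from bounded_linear.sums[OF this endo_exp_sums[of "scalar_endo \<i> * pen t x" f]]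
  show ?thesis
    by (simp add: ET_def endo_apply_power[symmetric] scalar_endo_mult_power[OF pen_scalar]
        scaleR_scaleC chan_scaleC mult_ac)
qed

lemma ET_scalar: "ET x t * scalar_endo c = scalar_endo c * ET x t"
proof -
  have comm: "(scalar_endo \<i> * pen t x) * scalar_endo c = scalar_endo c * (scalar_endo \<i> * pen t x)"
    by (rule endo_eqI) (simp add: pen_scaleC mult.commute[of c])
  show ?thesis
    using exp_commute[OF comm] unfolding ET_def .
qed

lemma char_fun_nth:
  assumes "norm (pen t x) < cmod \<mu>"
  shows "char_fun X t x \<mu> $ i $ j = (mat 1 :: complex^'e^'e) $ i $ j +
    \<i> * (chan X (endo_apply (resolvent t x \<mu>) (Fs (rowop (sig X t x) (axis i 1)))) $ j)"
  by (simp add: char_fun_def op_matrix_def hspace_X chan_adj_eq inv_into_pencil[OF assms Fs_mem])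

text \<open>The identity matrix contributes 0 by Cauchy's theorem. In the other term the factor i of
  \<open>char_fun\<close>, the minus sign of the Laurent series and \<open>2 pi i\<close> multiply
  to \<open>2 pi\<close>.\<close>

lemma char_fun_contour:
  assumes "norm (pen t x) < r"
  shows "((\<lambda>\<mu>. exp (\<i> * \<mu>) * char_fun X t x \<mu> $ i $ j) has_contour_integral
    2 * pi * (chan X (endo_apply (ET x t) (Fs (rowop (sig X t x) (axis i 1)))) $ j)) (circlepath 0 r)"
proof -
  let ?v = "Fs (rowop (sig X t x) (axis i 1))"
  define c where "c n = chan X (endo_apply (pen t x ^ n) ?v) $ j" for n
  have r: "0 < r" using assms norm_ge_zero le_less_trans by blast
  obtain K where K: "\<And>f. norm (chan X f) \<le> norm f * K" and K0: "0 \<le> K"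
    using bounded_linear.nonneg_bounded[OF bounded_linear_chan] by blast
  have c: "cmod (c n) \<le> (norm ?v * K) * norm (pen t x) ^ n" for n
  proof -
    have "cmod (c n) \<le> norm (endo_apply (pen t x ^ n) ?v) * K"
      unfolding c_def by (rule order_trans[OF Finite_Cartesian_Product.norm_nth_le K])
    also have "\<dots> \<le> norm (pen t x) ^ n * norm ?v * K"
      by (intro mult_right_mono order_trans[OF norm_endo_apply] norm_power_ineq K0 norm_ge_zero)
    finally show ?thesis by (simp add: mult_ac)
  qed
  note L = contour_integral_exp_Laurent[OF c norm_ge_zero assms]
  have const: "((\<lambda>\<mu>. exp (\<i> * \<mu>) * (mat 1 :: complex^'e^'e) $ i $ j) has_contour_integral 0) (circlepath 0 r)"
    by (rule Cauchy_theorem_disc_simple[of _ 0 "r + 1"]) (use r in \<open>auto intro!: holomorphic_intros\<close>)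
  have int: "((\<lambda>\<mu>. exp (\<i> * \<mu>) * (mat 1 :: complex^'e^'e) $ i $ j + (- \<i>) * (exp (\<i> * \<mu>) * (\<Sum>n. c n / \<mu> ^ Suc n)))
    has_contour_integral 0 + (- \<i>) * (2 * pi * \<i> * (\<Sum>n. c n * (\<i> ^ n / fact n)))) (circlepath 0 r)"
    by (intro has_contour_integral_add const has_contour_integral_lmul L)
  have sum: "(\<Sum>n. c n * (\<i> ^ n / fact n)) = chan X (endo_apply (ET x t) ?v) $ j"
    unfolding c_def by (rule sums_unique[OF chan_exp, symmetric])
  have eq: "exp (\<i> * \<mu>) * char_fun X t x \<mu> $ i $ j
      = exp (\<i> * \<mu>) * (mat 1 :: complex^'e^'e) $ i $ j + (- \<i>) * (exp (\<i> * \<mu>) * (\<Sum>n. c n / \<mu> ^ Suc n))"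
    if "\<mu> \<in> path_image (circlepath 0 r)" for \<mu>
  proof -
    have \<mu>: "norm (pen t x) < cmod \<mu>" using that assms r by simp
    have "(\<lambda>n. c n / \<mu> ^ Suc n) sums (- (chan X (endo_apply (resolvent t x \<mu>) ?v) $ j))"
      using sums_minus[OF chan_resolvent[OF \<mu>, of ?v j]] by (simp add: c_def)
    then show ?thesis
      by (simp add: char_fun_nth[OF \<mu>] sums_unique[symmetric] algebra_simps)
  qed
  have "((\<lambda>\<mu>. exp (\<i> * \<mu>) * char_fun X t x \<mu> $ i $ j) has_contour_integral
      0 + (- \<i>) * (2 * pi * \<i> * (\<Sum>n. c n * (\<i> ^ n / fact n)))) (circlepath 0 r)"
    by (rule has_contour_integral_eq[OF int eq[symmetric]])
  moreover have "0 + (- \<i>) * (2 * pi * \<i> * z) = 2 * pi * z" for z :: complex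
    by (simp add: algebra_simps)
  ultimately show ?thesis by (simp only: sum)
qed

text \<open>The rows of \<open>char_integral\<close> give the values at the unit vectors only;
  complex linearity, which for the exponential is \<open>ET_scalar\<close>, extends them to all
  \<open>y\<close>.\<close>

lemma chan_ET_Fs_expand:
  "chan X (endo_apply (ET x t) (Fs (rowop S y))) = (\<Sum>i\<in>UNIV. y $ i *s chan X (endo_apply (ET x t) (Fs (rowop S (axis i 1)))))"
proof -
  let ?G = "\<lambda>y. chan X (endo_apply (ET x t) (Fs (rowop S y)))"
  have G: "bounded_linear ?G"
    by (intro bounded_linear_compose[OF bounded_linear_chan] bounded_linear_compose[OF bounded_linear_endo_apply]
        bounded_linear_compose[OF bounded_linear_Fs] bounded_linear_vector_matrix)
  have scale: "?G (c *s y) = c *s ?G y" for c y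
  proof -
    have "?G (c *s y) = chan X (endo_apply (ET x t * scalar_endo c) (Fs (rowop S y)))"
      by (simp add: vector_matrix_cmult_left Fs_scale)
    then show ?thesis unfolding ET_scalar by (simp add: chan_scaleC)
  qed
  have "?G y = ?G (\<Sum>i\<in>UNIV. y $ i *s axis i 1)"
    by (simp add: basis_expansion)
  also have "\<dots> = (\<Sum>i\<in>UNIV. ?G (y $ i *s axis i 1))"
    by (rule linear_sum[OF bounded_linear.linear[OF G]])
  finally show ?thesis by (simp add: scale)
qed

lemma char_integral_apply:
  assumes "norm (pen t x) < r"
  shows "rowop (char_integral X t x r) y = (2 * pi) *\<^sub>R chan X (endo_apply (ET x t) (Fs (rowop (sig X t x) y)))"
proof -
  have nth: "char_integral X t x r $ i $ j
      = 2 * pi * (chan X (endo_apply (ET x t) (Fs (rowop (sig X t x) (axis i 1)))) $ j)" for i j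
    by (simp only: char_integral_def vec_lambda_beta contour_integral_unique[OF char_fun_contour[OF assms]])
  show ?thesis
    unfolding chan_ET_Fs_expand[where S = "sig X t x" and y = y]
    by (simp add: vec_eq_iff vector_matrix_nth nth scaleR_cmult_vec sum_distrib_left mult_ac)
qed

text \<open>On row vectors the inverse matrix acts first, so it cancels the factor
  \<open>sig X t x\<close> built into \<open>char_fun\<close>.\<close>

lemma char_integral_apply_inv:
  assumes "norm (pen t x) < r" "invertible (sig X t x)"
  shows "rowop (char_integral X t x r) (rowop (matrix_inv (sig X t x)) y)
    = (2 * pi) *\<^sub>R chan X (endo_apply (ET x t) (Fs y))"
proof -
  have "matrix_inv (sig X t x) ** sig X t x = mat 1"
    using someI_ex[OF assms(2)[unfolded invertible_def]] by (simp add: matrix_inv_def)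
  then have "rowop (sig X t x) (rowop (matrix_inv (sig X t x)) y) = y"
    by (simp add: vector_matrix_mul_assoc)
  then show ?thesis by (simp add: char_integral_apply[OF assms(1)])
qed

text \<open>The constant \<open>a\<close> of the theorem. The summand 1 makes it positive whatever
  \<open>B\<close> is.\<close>

definition pencil_bound :: real where "pencil_bound = norm (b *\<^sub>R EB ^ 3) + norm EB + 1"

lemma norm_pen_less:
  assumes "pencil_bound * sqrt (\<bar>t\<bar>\<^sup>2 + \<bar>x\<bar>\<^sup>2) < r" shows "norm (pen t x) < r"
proof -
  have tx: "\<bar>t\<bar> \<le> sqrt (\<bar>t\<bar>\<^sup>2 + \<bar>x\<bar>\<^sup>2)" "\<bar>x\<bar> \<le> sqrt (\<bar>t\<bar>\<^sup>2 + \<bar>x\<bar>\<^sup>2)"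
    by (auto intro!: real_le_rsqrt)
  have "norm (pen t x) \<le> norm (t *\<^sub>R (b *\<^sub>R EB ^ 3)) + norm (x *\<^sub>R EB)"
    unfolding pen_def scaleR_scaleR[symmetric] by (rule norm_triangle_ineq)
  also have "\<dots> = \<bar>t\<bar> * norm (b *\<^sub>R EB ^ 3) + \<bar>x\<bar> * norm EB"
    unfolding norm_scaleR ..
  also have "\<dots> \<le> sqrt (\<bar>t\<bar>\<^sup>2 + \<bar>x\<bar>\<^sup>2) * norm (b *\<^sub>R EB ^ 3) + sqrt (\<bar>t\<bar>\<^sup>2 + \<bar>x\<bar>\<^sup>2) * norm EB"
    by (intro add_mono mult_right_mono tx norm_ge_zero)
  also have "\<dots> \<le> pencil_bound * sqrt (\<bar>t\<bar>\<^sup>2 + \<bar>x\<bar>\<^sup>2)"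
    by (simp add: pencil_bound_def algebra_simps)
  finally show ?thesis using assms by simp
qed

lemma pencil_bound_pos: "0 < pencil_bound"
  by (simp add: pencil_bound_def add_nonneg_pos)

end

section \<open>The Gelfand-Levitan-Marchenko equation\<close>

lemma exp_bounded_linear_cong:
  fixes x :: "'a::{real_normed_algebra_1,banach}"
  assumes "bounded_linear f" "bounded_linear g" "\<And>n. f (x ^ n) = g (x ^ n)"
  shows "f (exp x) = g (exp x)"
proof -
  have "(\<lambda>n. f (x ^ n /\<^sub>R fact n)) sums f (exp x)"
    by (rule bounded_linear.sums[OF assms(1) exp_converges])
  moreover have "(\<lambda>n. g (x ^ n /\<^sub>R fact n)) sums g (exp x)"
    by (rule bounded_linear.sums[OF assms(2) exp_converges])
  moreover have "f (x ^ n /\<^sub>R fact n) = g (x ^ n /\<^sub>R fact n)" for n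
    using assms(3)[of n] by (simp add: linear_simps[OF assms(1)] linear_simps[OF assms(2)])
  ultimately show ?thesis
    using sums_unique2 by (simp only:)
qed

lemma exp_affine_has_vector_derivative:
  fixes D A :: "'a::{real_normed_algebra_1,banach}"
  assumes "D * A = A * D"
  shows "((\<lambda>y. exp (D + y *\<^sub>R A)) has_vector_derivative exp (D + x *\<^sub>R A) * A) (at x within S)"
proof -
  have eq: "exp (D + y *\<^sub>R A) = exp D * exp (y *\<^sub>R A)" for y
    by (rule exp_add_commuting) (simp add: assms)
  have "((\<lambda>y. exp D * exp (y *\<^sub>R A)) has_vector_derivative exp D * (exp (x *\<^sub>R A) * A)) (at x within S)"
    by (rule bounded_linear.has_vector_derivative[OF bounded_linear_mult_right exp_scaleR_has_vector_derivative_right])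
  then show ?thesis by (simp add: eq mult.assoc)
qed

text \<open>The gauge integral over an unbounded set compares with all boxes containing a large
  ball; the box from \<open>-T\<close> to \<open>T\<close> meets the half-line in
  \<open>{0..T}\<close>.\<close>

lemma integral_tendsto_halfline:
  fixes f :: "real \<Rightarrow> 'a::banach"
  assumes "f integrable_on {0..}"
  shows "((\<lambda>T. integral {0..T} f) \<longlongrightarrow> integral {0..} f) at_top"
proof (rule tendstoI)
  fix e :: real assume "0 < e"
  have "(f has_integral integral {0..} f) {0..}" using assms by blast
  moreover have "\<nexists>a b. {0..} = cbox a (b :: real)"
  proof
    assume "\<exists>a b. {0..} = cbox a (b :: real)"
    then obtain a b :: real where ab: "{0..} = {a..b}" by auto
    have "max 0 b + 1 \<in> {0..}" by simp
    then have "max 0 b + 1 \<le> b" unfolding ab by simp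
    then show False by linarith
  qed
  ultimately obtain B where "0 < B" and B: "\<forall>a b. ball 0 B \<subseteq> cbox a b \<longrightarrow>
      (\<exists>z. ((\<lambda>x. if x \<in> {0..} then f x else 0) has_integral z) (cbox a b) \<and> norm (z - integral {0..} f) < e)"
    using \<open>0 < e\<close> by (rule has_integral_altD)
  have "dist (integral {0..T} f) (integral {0..} f) < e" if "T \<ge> B" for T
  proof -
    have "ball 0 B \<subseteq> cbox (-T) T" using that by (auto simp: dist_norm)
    with B obtain z where z: "((\<lambda>x. if x \<in> {0..} then f x else 0) has_integral z) (cbox (-T) T)"
      and le: "norm (z - integral {0..} f) < e" by blast
    have "(f has_integral z) ({-T..T} \<inter> {0..})"
      using z has_integral_restrict_Int[of "{0..}" f z "{-T..T}"] by (simp add: Int_commute)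
    moreover have "{-T..T} \<inter> {0..} = {0..T}" using that \<open>0 < B\<close> by auto
    ultimately have "integral {0..T} f = z" by (intro integral_unique) (simp only:)
    then show ?thesis using le by (simp add: dist_norm)
  qed
  then show "\<forall>\<^sub>F T in at_top. dist (integral {0..T} f) (integral {0..} f) < e"
    by (auto simp: eventually_at_top_linorder)
qed

text \<open>Integrability of the derivative gives \<open>\<phi>\<close> a limit \<open>c\<close> at
  infinity. The integrals of \<open>\<phi>\<close> over \<open>{T..T + 1}\<close> then tend to
  \<open>c\<close>, but also to 0 because \<open>\<phi>\<close> is integrable, so
  \<open>c = 0\<close>.\<close>

lemma integral_derivative_halfline:
  fixes \<phi> \<psi> :: "real \<Rightarrow> 'a::banach"
  assumes \<phi>: "\<phi> integrable_on {0..}" and \<psi>: "\<psi> integrable_on {0..}"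
    and deriv: "\<And>x. (\<phi> has_vector_derivative \<psi> x) (at x)"
  shows "integral {0..} \<psi> = - \<phi> 0"
proof -
  define c where "c = integral {0..} \<psi> + \<phi> 0"
  have cont: "continuous_on S \<phi>" for S
    by (rule continuous_on_vector_derivative) (rule has_vector_derivative_at_within[OF deriv])
  have int: "\<phi> integrable_on {a..b}" for a b
    by (rule integrable_continuous_real[OF cont])
  have "integral {0..T} \<psi> + \<phi> 0 = \<phi> T" if "0 \<le> T" for T
    using fundamental_theorem_of_calculus[OF that, of \<phi> \<psi>] has_vector_derivative_at_within[OF deriv]
    by (simp add: integral_unique)
  then have "\<forall>\<^sub>F T in at_top. integral {0..T} \<psi> + \<phi> 0 = \<phi> T"
    by (auto simp: eventually_at_top_linorder)
  moreover have "((\<lambda>T. integral {0..T} \<psi> + \<phi> 0) \<longlongrightarrow> c) at_top"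
    unfolding c_def by (intro tendsto_intros integral_tendsto_halfline \<psi>)
  ultimately have lim: "(\<phi> \<longlongrightarrow> c) at_top"
    by (rule Lim_transform_eventually[rotated])
  have "((\<lambda>T. integral {0..T + 1} \<phi> - integral {0..T} \<phi>) \<longlongrightarrow> integral {0..} \<phi> - integral {0..} \<phi>) at_top"
  proof (intro tendsto_diff integral_tendsto_halfline[OF \<phi>] filterlim_compose[OF integral_tendsto_halfline[OF \<phi>]])
    show "filterlim (\<lambda>T :: real. T + 1) at_top at_top"
      using filterlim_tendsto_add_at_top[OF tendsto_const[of 1] filterlim_ident] by (simp add: add.commute)
  qed
  then have g: "((\<lambda>T. integral {0..T + 1} \<phi> - integral {0..T} \<phi>) \<longlongrightarrow> 0) at_top" by simp
  have "norm c \<le> e" if "0 < e" for e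
  proof -
    have "\<forall>\<^sub>F T in at_top. dist (\<phi> T) c < e / 2"
      using tendstoD[OF lim, of "e / 2"] that by simp
    then obtain T0 where T0: "\<And>T. T \<ge> T0 \<Longrightarrow> dist (\<phi> T) c < e / 2"
      by (auto simp: eventually_at_top_linorder)
    have "\<forall>\<^sub>F T in at_top. norm (integral {0..T + 1} \<phi> - integral {0..T} \<phi>) < e / 2"
      using tendstoD[OF g, of "e / 2"] that by simp
    then obtain T1 where T1: "\<And>T. T \<ge> T1 \<Longrightarrow> norm (integral {0..T + 1} \<phi> - integral {0..T} \<phi>) < e / 2"
      by (auto simp: eventually_at_top_linorder)
    define T where "T = max 0 (max T0 T1)"
    have "integral {0..T + 1} \<phi> = integral {0..T} \<phi> + integral {T..T + 1} \<phi>"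
      by (rule Henstock_Kurzweil_Integration.integral_combine[symmetric]) (auto simp: T_def int)
    then have 1: "norm (integral {T..T + 1} \<phi>) < e / 2"
      using T1[of T] by (simp add: T_def)
    have "integral {T..T + 1} (\<lambda>s. \<phi> s - c) = integral {T..T + 1} \<phi> - c"
      by (subst Henstock_Kurzweil_Integration.integral_diff) (auto simp: int)
    moreover have "norm (integral {T..T + 1} (\<lambda>s. \<phi> s - c)) \<le> e / 2 * (T + 1 - T)"
      by (rule integral_bound)
        (use T0 in \<open>auto intro!: continuous_intros cont less_imp_le simp: T_def dist_norm\<close>)
    ultimately have "norm (integral {T..T + 1} \<phi> - c) \<le> e / 2" by simp
    then show ?thesis
      using 1 norm_triangle_ineq4[of "integral {T..T + 1} \<phi>" "integral {T..T + 1} \<phi> - c"] by simp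
  qed
  then have "norm c \<le> 0" by (rule field_le_epsilon[of _ 0, simplified])
  then show ?thesis by (simp add: c_def eq_neg_iff_add_eq_0)
qed


section \<open>Consequences of the unitary symmetry\<close>

locale symmetric_node = colligation_node H P X b Bs Fs
  for H :: "'p::finite L2 set" and P and X :: "('p, 'e::finite) colligation" and b Bs Fs +
  fixes U :: "'p L2 \<Rightarrow> 'p L2"
  assumes unitary: "unitary_on H U"
    and symmetry: "\<And>f. f \<in> H \<Longrightarrow> adj H (opB X) f = - U (opB X (adj H U f))"
begin

text \<open>\<open>U\<close> is unspecified off \<open>H\<close>. Composed with the projection,
  \<open>V\<close> and \<open>W\<close> are bounded on the whole type and agree on \<open>H\<close>
  with \<open>U\<close> and its adjoint.\<close>

definition W :: "'p L2 \<Rightarrow> 'p L2" where "W f = inv_into H U (P f)"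

definition V :: "'p L2 \<Rightarrow> 'p L2" where "V f = U (P f)"

lemma U_bij: "bij_betw U H H"
  using unitary by (simp add: unitary_on_def)

lemma V_mem: "V f \<in> H"
  using U_bij P_mem by (auto simp: V_def bij_betw_def)

lemma V_eq: "f \<in> H \<Longrightarrow> V f = U f"
  by (simp add: V_def P_id)

lemma W_mem: "W f \<in> H"
  using U_bij P_mem unfolding W_def by (metis bij_betw_def inv_into_into)

lemma V_W: "f \<in> H \<Longrightarrow> V (W f) = f"
  using U_bij W_mem unfolding V_eq[OF W_mem] unfolding W_def by (simp add: P_id bij_betw_inv_into_right)

lemma W_V: "f \<in> H \<Longrightarrow> W (V f) = f"
  using U_bij V_mem[of f] by (simp add: W_def P_id V_eq bij_betw_inv_into_left)

lemma V_add: "V (f + g) = V f + V g"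
  using unitary P_mem by (simp add: V_def linear_simps[OF bounded_linear_P] unitary_on_def)

lemma V_scaleC: "V (c *\<^sub>C f) = c *\<^sub>C V f"
  using unitary P_mem by (simp add: V_def P_scaleC unitary_on_def)

lemma cinner_V: "f \<in> H \<Longrightarrow> g \<in> H \<Longrightarrow> cinner (V f) (V g) = cinner f g"
  using unitary by (simp add: V_eq unitary_on_def)

lemma norm_V: "f \<in> H \<Longrightarrow> norm (V f) = norm f"
  using cinner_V[of f f] by (simp add: norm_eq_sqrt_inner inner_L2_def)

lemma W_P: "W f = W (P f)"
  by (simp add: W_def P_id P_mem)

lemma V_P: "V f = V (P f)"
  by (simp add: V_def P_id P_mem)

lemma inj_V: "f \<in> H \<Longrightarrow> g \<in> H \<Longrightarrow> V f = V g \<Longrightarrow> f = g"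
  by (metis W_V)

lemma W_add: "W (f + g) = W f + W g"
proof -
  have "V (W (P f + P g)) = V (W (P f) + W (P g))"
    by (simp add: V_add V_W P_mem add_mem)
  then have "W (P f + P g) = W (P f) + W (P g)"
    by (rule inj_V[rotated 2]) (auto intro: W_mem add_mem)
  then show ?thesis
    by (simp add: W_P[of "f + g"] W_P[of f] W_P[of g] linear_simps(1)[OF bounded_linear_P])
qed

lemma W_scaleC: "W (c *\<^sub>C f) = c *\<^sub>C W f"
proof -
  have "V (W (c *\<^sub>C P f)) = V (c *\<^sub>C W (P f))"
    by (simp add: V_scaleC V_W P_mem scaleC_mem)
  then have "W (c *\<^sub>C P f) = c *\<^sub>C W (P f)"
    by (rule inj_V[rotated 2]) (auto intro: W_mem scaleC_mem)
  then show ?thesis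
    by (simp add: W_P[of "c *\<^sub>C f"] W_P[of f] P_scaleC)
qed

lemma bounded_linear_V: "bounded_linear V"
proof -
  obtain K where "\<And>f. norm (P f) \<le> norm f * K"
    using bounded_linear.bounded[OF bounded_linear_P] by blast
  then have "norm (V f) \<le> norm f * K" for f
    using V_P[of f] norm_V[OF P_mem, of f] by simp
  then show ?thesis
    by (intro bounded_linear_intro[of _ K]) (simp_all add: V_add scaleR_scaleC V_scaleC)
qed

lemma norm_W: "f \<in> H \<Longrightarrow> norm (W f) = norm f"
  using norm_V[OF W_mem, of f] by (simp add: V_W)

lemma bounded_linear_W: "bounded_linear W"
proof -
  obtain K where K: "\<And>f. norm (P f) \<le> norm f * K"
    using bounded_linear.bounded[OF bounded_linear_P] by blast
  then have "norm (W f) \<le> norm f * K" for f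
    using W_P[of f] norm_W[OF P_mem, of f] by simp
  then show ?thesis
    by (intro bounded_linear_intro[of _ K]) (simp_all add: W_add scaleR_scaleC W_scaleC)
qed

lemma adj_U: "f \<in> H \<Longrightarrow> adj H U f = W f"
  by (rule adj_eqI[OF W_mem]) (metis cinner_V W_mem V_W V_eq)

lemma adj_B: "f \<in> H \<Longrightarrow> adj H (opB X) f = Bs f"
  by (intro adj_eqI Bs_mem Bs_adjoint)

lemma Bs_eq: "f \<in> H \<Longrightarrow> Bs f = - V (opB X (W f))"
  using symmetry[of f] by (simp add: adj_B adj_U V_eq B_mem)

text \<open>The operator \<open>C\<close> of the overview, written through the channel so that it is
  bounded on the type and has values in \<open>H\<close>; \<open>EC_node\<close> gives its other
  form on \<open>H\<close>.\<close>

definition EC :: "'p L2 endo" where "EC = Endo (\<lambda>f. Fs (rowop (sigB X) (chan X f)))"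

lemma EC_apply: "endo_apply EC f = Fs (rowop (sigB X) (chan X f))"
  unfolding EC_def
  by (rule endo_apply_Endo)
    (intro bounded_linear_compose[OF bounded_linear_Fs] bounded_linear_compose[OF bounded_linear_vector_matrix] bounded_linear_chan)

lemma EC_mem: "endo_apply EC f \<in> H"
  by (simp add: EC_apply Fs_mem)

lemma EC_node: "f \<in> H \<Longrightarrow> endo_apply EC f = (- \<i>) *\<^sub>C (opB X f - Bs f)"
  by (simp add: EC_apply node)

text \<open>The symmetry as a relation between pairings with \<open>V\<close>: each passage of
  \<open>B\<close> across the pairing costs one sign, and no adjoint appears any more.\<close>

lemma cinner_B: 
  assumes "f \<in> H" "g \<in> H" shows "cinner (opB X f) (V g) = - cinner f (V (opB X g))"
proof -
  have "cinner (opB X f) (V g) = cinner f (Bs (V g))" by (rule Bs_adjoint[OF assms(1) V_mem])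
  also have "Bs (V g) = (-1) *\<^sub>C V (opB X g)"
    using assms by (simp add: Bs_eq V_mem W_V scaleC_minus1)
  finally show ?thesis by (simp add: cinner_scaleC_right)
qed

definition gen :: "real \<Rightarrow> real \<Rightarrow> 'p L2 endo" where "gen t x = scalar_endo \<i> * pen t x"

lemma ET_gen: "ET x t = exp (gen t x)"
  by (simp add: ET_def gen_def)

lemma gen_mem: "endo_apply (gen t x) f \<in> H"
  by (simp add: gen_def scaleC_mem pen_mem)

lemma gen_power_mem: "f \<in> H \<Longrightarrow> endo_apply (gen t x ^ n) f \<in> H"
  by (cases n) (simp_all add: gen_mem)

text \<open>An odd number of passages of \<open>B\<close> leaves one minus sign, which the
  conjugation of i cancels. This is where the oddness of the cube in \<open>A\<close>
  matters.\<close>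

lemma cinner_gen:
  assumes "f \<in> H" "g \<in> H"
  shows "cinner (endo_apply (gen t x) f) (V g) = cinner f (V (endo_apply (gen t x) g))"
proof -
  have "cinner (opB X (opB X (opB X f))) (V g) = - cinner f (V (opB X (opB X (opB X g))))"
    using assms by (simp add: cinner_B B_mem)
  then have "cinner (endo_apply (pen t x) f) (V g) = - cinner f (V (endo_apply (pen t x) g))"
    using assms
    by (simp add: pen_apply opA_X scaleR_scaleC cinner_add_left cinner_add_right cinner_scaleC_left
        cinner_scaleC_right V_add V_scaleC cinner_B)
  then show ?thesis
    by (simp add: gen_def cinner_scaleC_left cinner_scaleC_right V_scaleC)
qed

lemma cinner_gen_power:
  assumes "f \<in> H" "g \<in> H"
  shows "cinner (endo_apply (gen t x ^ n) f) (V g) = cinner f (V (endo_apply (gen t x ^ n) g))"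
  using assms(2)
proof (induction n arbitrary: g)
  case (Suc n)
  have "cinner (endo_apply (gen t x ^ Suc n) f) (V g) = cinner (endo_apply (gen t x ^ n) f) (V (endo_apply (gen t x) g))"
    using Suc.prems assms(1) by (simp add: cinner_gen gen_power_mem)
  also have "\<dots> = cinner f (V (endo_apply (gen t x ^ n * gen t x) g))"
    using Suc.IH[OF gen_mem] by simp
  finally show ?case by (simp add: power_Suc2 del: endo_apply_mult power_Suc)
qed simp

lemma cinner_ET:
  assumes "f \<in> H" "g \<in> H"
  shows "cinner (endo_apply (ET x t) f) (V g) = cinner f (V (endo_apply (ET x t) g))"
  unfolding ET_gen
  by (rule exp_bounded_linear_cong[where f = "\<lambda>E. cinner (endo_apply E f) (V g)" and g = "\<lambda>E. cinner f (V (endo_apply E g))"])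
    (intro bounded_linear_compose[OF bounded_linear_cinner_left] bounded_linear_compose[OF bounded_linear_cinner_right]
      bounded_linear_compose[OF bounded_linear_V] bounded_bilinear.bounded_linear_left[OF bounded_bilinear_endo_apply]
      cinner_gen_power assms)+

lemma adj_opT: "g \<in> H \<Longrightarrow> adj H (opT X x t) g = V (endo_apply (ET x t) (W g))"
  by (rule adj_eqI[OF V_mem]) (metis cinner_ET W_mem V_W opT_eq)

section \<open>Group law and inverses of the exponentials\<close>

lemma pen_commute: "pen t x * pen s y = pen s y * pen t x"
proof -
  have "EB ^ 3 * EB = EB * EB ^ 3"
    by (simp add: power3_eq_cube mult.assoc)
  then show ?thesis by (simp add: pen_def algebra_simps)
qed

lemma gen_add: "gen (t + s) (x + y) = gen t x + gen s y"
  by (simp add: gen_def pen_def algebra_simps)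

lemma gen_commute: "gen t x * gen s y = gen s y * gen t x"
proof -
  have "endo_apply (pen t x) (endo_apply (pen s y) f) = endo_apply (pen s y) (endo_apply (pen t x) f)" for f
    using arg_cong[OF pen_commute, of "\<lambda>E. endo_apply E f" t x s y] by simp
  then show ?thesis by (intro endo_eqI) (simp add: gen_def pen_scaleC)
qed

lemma ET_add: "ET (x + y) (t + s) = ET x t * ET y s"
  unfolding ET_gen gen_add by (rule exp_add_commuting[OF gen_commute])

lemma ET_zero: "ET 0 0 = 1"
  by (simp add: ET_gen gen_def pen_def)

lemma ET_inverse: "ET x t * ET (- x) (- t) = 1" "ET (- x) (- t) * ET x t = 1"
  using ET_add[of x "- x" t "- t"] ET_add[of "- x" x "- t" t] by (simp_all add: ET_zero)

lemma inv_adj_opT: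
  assumes "g \<in> H"
  shows "inv_into H (adj H (opT X x t)) g = V (endo_apply (ET (- x) (- t)) (W g))"
proof -
  have inv: "V (endo_apply (ET (- x) (- t)) (W (V (endo_apply (ET x t) (W g))))) = g" if "g \<in> H" for g
    using arg_cong[OF ET_inverse(2), of "\<lambda>E. endo_apply E (W g)" x t] that
    by (simp add: W_V ET_mem W_mem V_W)
  have inv': "V (endo_apply (ET x t) (W (V (endo_apply (ET (- x) (- t)) (W g))))) = g"
    using arg_cong[OF ET_inverse(1), of "\<lambda>E. endo_apply E (W g)" x t] assms
    by (simp add: W_V ET_mem W_mem V_W)
  have "inj_on (adj H (opT X x t)) H"
    by (rule inj_on_inverseI[where g = "\<lambda>h. V (endo_apply (ET (- x) (- t)) (W h))"]) (simp add: adj_opT inv)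
  then show ?thesis
    by (rule inv_into_f_eq) (simp_all add: V_mem adj_opT inv')
qed

text \<open>This is \<open>i B\<close>, the generator in the variable \<open>x\<close>, and not the
  operator \<open>opA X\<close>.\<close>

definition EA :: "'p L2 endo" where "EA = scalar_endo \<i> * EB"

lemma gen_0: "gen 0 x = x *\<^sub>R EA"
  by (simp add: gen_def pen_def EA_def)

lemma EA_apply: "endo_apply EA f = \<i> *\<^sub>C opB X f"
  by (simp add: EA_def)

lemma gen_0_apply: "endo_apply (gen 0 \<eta>) f = (\<i> * complex_of_real \<eta>) *\<^sub>C opB X f"
  by (simp add: gen_0 endo_simps EA_apply scaleR_scaleC mult.commute)

lemma op_exp_B: "op_exp (\<lambda>k. (\<i> * complex_of_real \<eta>) *\<^sub>C opB X k) f = endo_apply (ET \<eta> 0) f"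
proof -
  have eq: "(\<lambda>k. (\<i> * complex_of_real \<eta>) *\<^sub>C opB X k) = endo_apply (gen 0 \<eta>)"
    by (rule ext) (simp add: gen_0_apply)
  have "Endo (endo_apply (gen 0 \<eta>)) = gen 0 \<eta>"
    by (rule endo_eqI, rule endo_apply_Endo[OF bounded_linear_endo_apply])
  then show ?thesis
    unfolding eq op_exp_eq[OF bounded_linear_endo_apply] ET_gen by (simp only:)
qed

text \<open>On \<open>H\<close>, \<open>- i \<eta>\<close> times the adjoint of \<open>B\<close>
  becomes \<open>i \<eta> B\<close> after moving it past \<open>V\<close>. The adjoint is controlled
  on \<open>H\<close> only, so the series are compared term by term instead of through
  \<open>op_exp_eq\<close>.\<close>

lemma op_exp_adj_B:
  assumes "c \<in> H"
  shows "op_exp (\<lambda>k. (- \<i> * complex_of_real \<eta>) *\<^sub>C adj H (opB X) k) (V c) = V (endo_apply (ET \<eta> 0) c)"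
proof -
  let ?K = "\<lambda>k. (- \<i> * complex_of_real \<eta>) *\<^sub>C adj H (opB X) k"
  have K: "?K (V d) = V (endo_apply (gen 0 \<eta>) d)" if "d \<in> H" for d
  proof -
    have "?K (V d) = (- (\<i> * complex_of_real \<eta>)) *\<^sub>C (- V (opB X d))"
      using that by (simp add: adj_B V_mem Bs_eq W_V)
    also have "\<dots> = V ((\<i> * complex_of_real \<eta>) *\<^sub>C opB X d)"
      unfolding scaleC_minus_left scaleC_minus_right V_scaleC by simp
    finally show ?thesis by (simp add: gen_0_apply)
  qed
  have pow: "(?K ^^ n) (V c) = V (endo_apply (gen 0 \<eta> ^ n) c)" for n
  proof (induction n)
    case (Suc n)
    have "(?K ^^ Suc n) (V c) = ?K ((?K ^^ n) (V c))" by simp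
    also have "\<dots> = V (endo_apply (gen 0 \<eta>) (endo_apply (gen 0 \<eta> ^ n) c))"
      unfolding Suc by (rule K[OF gen_power_mem[OF assms]])
    finally show ?case by simp
  qed simp
  have "(\<lambda>n. V ((1 / fact n) *\<^sub>R (endo_apply (gen 0 \<eta>) ^^ n) c)) sums V (endo_apply (ET \<eta> 0) c)"
    unfolding ET_gen by (rule bounded_linear.sums[OF bounded_linear_V endo_exp_sums])
  moreover have "V ((1 / fact n) *\<^sub>R (endo_apply (gen 0 \<eta>) ^^ n) c) = (1 / fact n) *\<^sub>R (?K ^^ n) (V c)" for n
    unfolding pow endo_apply_power by (simp add: linear_simps[OF bounded_linear_V])
  ultimately have "(\<lambda>n. (1 / fact n) *\<^sub>R (?K ^^ n) (V c)) sums V (endo_apply (ET \<eta> 0) c)"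
    by (simp only:)
  then show ?thesis
    unfolding op_exp_def by (rule sums_unique[symmetric])
qed

section \<open>The integral \<open>N\<close> and its Lyapunov equation\<close>

definition \<phi> :: "'p L2 \<Rightarrow> real \<Rightarrow> 'p L2"
  where "\<phi> f \<eta> = endo_apply (ET \<eta> 0) (endo_apply EC (endo_apply (ET \<eta> 0) f))"

lemma \<phi>_mem: "\<phi> f \<eta> \<in> H"
  by (simp add: \<phi>_def ET_mem EC_mem)

lemma M_integrand_eq:
  assumes "f \<in> H" shows "M_integrand X U f \<eta> = V (\<phi> f \<eta>)"
proof -
  let ?k = "endo_apply (ET \<eta> 0) f"
  have k: "?k \<in> H" by (rule ET_mem[OF assms])
  have "(1 / \<i>) *\<^sub>C (opB X ?k - adj H (opB X) ?k) = endo_apply EC ?k"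
    using k by (simp add: adj_B EC_node)
  then show ?thesis
    by (simp only: M_integrand_def Let_def hspace_X op_exp_B \<phi>_def V_eq[OF EC_mem, symmetric] op_exp_adj_B[OF EC_mem])
qed

definition N :: "'p L2 \<Rightarrow> 'p L2" where "N f = integral {0..} (\<phi> f)"

context
  assumes convergent: "M_strongly_convergent X U"
begin

lemma \<phi>_integrable:
  assumes "f \<in> H" shows "\<phi> f integrable_on {0..}"
proof -
  have "M_integrand X U f integrable_on {0..}"
    using convergent assms by (simp add: M_strongly_convergent_def hspace_X)
  then have "(W \<circ> M_integrand X U f) integrable_on {0..}"
    by (rule integrable_linear[OF _ bounded_linear_W])
  also have "W \<circ> M_integrand X U f = \<phi> f"
    by (rule ext) (simp add: M_integrand_eq[OF assms] W_V \<phi>_mem)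
  finally show ?thesis .
qed

lemma N_mem: "f \<in> H \<Longrightarrow> N f \<in> H"
  unfolding N_def by (rule integral_mem[OF \<phi>_integrable \<phi>_mem])

lemma opM_eq:
  assumes "f \<in> H" shows "opM X U f = V (N f)"
proof -
  have "V (N f) = integral {0..} (V \<circ> \<phi> f)"
    unfolding N_def by (rule integral_linear[OF \<phi>_integrable[OF assms] bounded_linear_V, symmetric])
  also have "V \<circ> \<phi> f = M_integrand X U f"
    by (rule ext) (simp add: M_integrand_eq[OF assms])
  finally show ?thesis by (simp add: opM_def)
qed

text \<open>By \<open>opM_eq\<close>, \<open>M = U N\<close>. The inverse adjoint of
  \<open>T\<close> is \<open>U T^{-1} U*\<close>, so its inner \<open>U*\<close> meets the
  \<open>U\<close> of \<open>M\<close> and its outer \<open>U\<close> meets the \<open>U*\<close> of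
  \<open>\<Gamma>\<close>; both pairs cancel.\<close>

lemma opGamma_eq:
  assumes "f \<in> H"
  shows "opGamma X U U x t f = endo_apply (ET x t) f + endo_apply (ET (- x) (- t)) (N f)"
  using assms
  by (simp add: opGamma_def hspace_X opT_eq opM_eq inv_adj_opT V_mem adj_U W_V N_mem ET_mem)

lemma \<phi>_diff: "\<phi> (f - g) \<eta> = \<phi> f \<eta> - \<phi> g \<eta>"
  by (simp add: \<phi>_def endo_simps)

lemma N_diff: "f \<in> H \<Longrightarrow> g \<in> H \<Longrightarrow> N (f - g) = N f - N g"
  unfolding N_def \<phi>_diff[abs_def]
  by (rule Henstock_Kurzweil_Integration.integral_diff) (rule \<phi>_integrable, assumption)+

lemma EA_mem: "endo_apply EA f \<in> H"
  by (simp add: EA_apply scaleC_mem B_mem)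

lemma EA_ET: "EA * ET x t = ET x t * EA"
proof -
  have "gen t x * EA = EA * gen t x"
    using gen_commute[of t x 0 1] by (simp add: gen_0)
  then show ?thesis unfolding ET_gen by (rule exp_commute[symmetric])
qed

lemma ET_has_vector_derivative:
  "((\<lambda>y. ET y t) has_vector_derivative ET x t * EA) (at x within S)"
proof -
  have eq: "ET y t = exp (gen t 0 + y *\<^sub>R EA)" for y
    using gen_add[of t 0 0 y] by (simp add: ET_gen gen_0)
  have "gen t 0 * EA = EA * gen t 0"
    using gen_commute[of t 0 0 1] by (simp add: gen_0)
  then show ?thesis unfolding eq by (rule exp_affine_has_vector_derivative)
qed

lemma ET_minus_has_vector_derivative:
  "((\<lambda>y. ET (- y) (- t)) has_vector_derivative - (ET (- x) (- t) * EA)) (at x within S)"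
proof -
  have eq: "ET (- y) (- t) = exp (gen (- t) 0 + y *\<^sub>R (- EA))" for y
    using gen_add[of "- t" 0 0 "- y"] by (simp add: ET_gen gen_0)
  have "gen (- t) 0 * (- EA) = (- EA) * gen (- t) 0"
    using gen_commute[of "- t" 0 0 1] by (simp add: gen_0)
  from exp_affine_has_vector_derivative[OF this, of x S] show ?thesis unfolding eq by simp
qed

text \<open>The form of the derivative is chosen for integrability: the first summand is a bounded
  operator applied to \<open>\<phi> f\<close>, the second is \<open>\<phi>\<close> of another vector
  of \<open>H\<close>.\<close>

lemma \<phi>_has_vector_derivative:
  "(\<phi> f has_vector_derivative endo_apply EA (\<phi> f \<eta>) + \<phi> (endo_apply EA f) \<eta>) (at \<eta>)"
proof -
  have C: "((\<lambda>\<eta>. EC * ET \<eta> 0) has_vector_derivative EC * (ET \<eta> 0 * EA)) (at \<eta>)"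
    by (rule bounded_linear.has_vector_derivative[OF bounded_linear_mult_right ET_has_vector_derivative])
  have "((\<lambda>\<eta>. ET \<eta> 0 * (EC * ET \<eta> 0)) has_vector_derivative
      ET \<eta> 0 * (EC * (ET \<eta> 0 * EA)) + ET \<eta> 0 * EA * (EC * ET \<eta> 0)) (at \<eta>)"
    by (rule has_vector_derivative_mult[OF ET_has_vector_derivative C])
  from bounded_linear.has_vector_derivative[OF bounded_bilinear.bounded_linear_left[OF bounded_bilinear_endo_apply] this, of f]
  have "(\<phi> f has_vector_derivative endo_apply (ET \<eta> 0 * (EC * (ET \<eta> 0 * EA)) + ET \<eta> 0 * EA * (EC * ET \<eta> 0)) f) (at \<eta>)"
    by (simp add: \<phi>_def[abs_def])
  also have "endo_apply (ET \<eta> 0 * (EC * (ET \<eta> 0 * EA)) + ET \<eta> 0 * EA * (EC * ET \<eta> 0)) f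
      = endo_apply EA (\<phi> f \<eta>) + \<phi> (endo_apply EA f) \<eta>"
    using arg_cong[OF EA_ET, of "\<lambda>E. endo_apply E v" \<eta> 0 for v] by (simp add: endo_simps \<phi>_def)
  finally show ?thesis .
qed

lemma Lyapunov:
  assumes "f \<in> H"
  shows "endo_apply EA (N f) + N (endo_apply EA f) = - endo_apply EC f"
proof -
  have 1: "(endo_apply EA \<circ> \<phi> f) integrable_on {0..}"
    by (rule integrable_linear[OF \<phi>_integrable[OF assms] bounded_linear_endo_apply])
  note 2 = \<phi>_integrable[OF EA_mem[of f]]
  have "endo_apply EA (N f) + N (endo_apply EA f)
      = integral {0..} (endo_apply EA \<circ> \<phi> f) + integral {0..} (\<phi> (endo_apply EA f))"
    unfolding N_def integral_linear[OF \<phi>_integrable[OF assms] bounded_linear_endo_apply] ..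
  also have "\<dots> = integral {0..} (\<lambda>\<eta>. endo_apply EA (\<phi> f \<eta>) + \<phi> (endo_apply EA f) \<eta>)"
    using Henstock_Kurzweil_Integration.integral_add[OF 1 2] by (simp add: o_def)
  also have "\<dots> = - \<phi> f 0"
    using Henstock_Kurzweil_Integration.integrable_add[OF 1 2]
    by (intro integral_derivative_halfline[OF \<phi>_integrable[OF assms] _ \<phi>_has_vector_derivative]) (simp add: o_def)
  also have "\<phi> f 0 = endo_apply EC f"
    by (simp add: \<phi>_def ET_zero)
  finally show ?thesis .
qed

lemma opGamma_diff:
  assumes "f \<in> H" "g \<in> H"
  shows "opGamma X U U x t (f - g) = opGamma X U U x t f - opGamma X U U x t g"
  using assms by (simp add: opGamma_eq diff_mem N_diff endo_simps)

text \<open>\<open>N g\<close> does not depend on \<open>x\<close>, so only the two exponentials are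
  differentiated.\<close>

lemma opGamma_opS:
  assumes g: "g \<in> H" and inv: "bij_betw (opGamma X U U x t) H H"
  shows "opS X U U x t g \<in> H"
    and "opGamma X U U x t (opS X U U x t g) = endo_apply (ET x t) (endo_apply EA g) - endo_apply (ET (- x) (- t)) (endo_apply EA (N g))"
proof -
  let ?y = "endo_apply (ET x t) (endo_apply EA g) - endo_apply (ET (- x) (- t)) (endo_apply EA (N g))"
  note ap = bounded_linear.has_vector_derivative[OF bounded_bilinear.bounded_linear_left[OF bounded_bilinear_endo_apply]]
  have "((\<lambda>y. endo_apply (ET y t) g + endo_apply (ET (- y) (- t)) (N g)) has_vector_derivative
      endo_apply (ET x t * EA) g + endo_apply (- (ET (- x) (- t) * EA)) (N g)) (at x)"
    by (intro has_vector_derivative_add ap ET_has_vector_derivative ET_minus_has_vector_derivative)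
  then have "((\<lambda>y. opGamma X U U y t g) has_vector_derivative ?y) (at x)"
    by (simp add: opGamma_eq[OF g] endo_simps)
  then have S: "opS X U U x t g = inv_into H (opGamma X U U x t) ?y"
    by (simp add: opS_def hspace_X vector_derivative_at)
  have y: "?y \<in> H"
    by (intro diff_mem ET_mem EA_mem)
  show "opS X U U x t g \<in> H"
    unfolding S using inv y by (metis bij_betw_def inv_into_into)
  show "opGamma X U U x t (opS X U U x t g) = ?y"
    unfolding S using inv y by (rule bij_betw_inv_into_right)
qed

text \<open>Subtracting \<open>i B g\<close> cancels the terms of \<open>\<Gamma>\<^sub>x g\<close>
  with \<open>T\<close>; those with \<open>T^{-1}\<close> combine to the left side of
  \<open>Lyapunov\<close>. One more factor \<open>T^{-1}\<close> isolates \<open>h\<close> and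
  produces the parameters \<open>-2 x\<close> and \<open>-2 t\<close>.\<close>

lemma h_equation:
  assumes g: "g \<in> H" and inv: "bij_betw (opGamma X U U x t) H H"
    and h: "h = opS X U U x t g - \<i> *\<^sub>C opB X g"
  shows "h \<in> H" "h = endo_apply (ET (- 2 * x) (- 2 * t)) (endo_apply EC g - N h)"
proof -
  let ?\<Gamma> = "opGamma X U U x t" and ?T = "endo_apply (ET x t)" and ?Ti = "endo_apply (ET (- x) (- t))"
  have h': "h = opS X U U x t g - endo_apply EA g" by (simp add: h EA_apply)
  show hH: "h \<in> H" unfolding h' by (intro diff_mem opGamma_opS(1)[OF g inv] EA_mem)
  have "?\<Gamma> h = (?T (endo_apply EA g) - ?Ti (endo_apply EA (N g))) - (?T (endo_apply EA g) + ?Ti (N (endo_apply EA g)))"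
    unfolding h' opGamma_diff[OF opGamma_opS(1)[OF g inv] EA_mem] opGamma_opS(2)[OF g inv] opGamma_eq[OF EA_mem] ..
  also have "\<dots> = - ?Ti (endo_apply EA (N g) + N (endo_apply EA g))"
    by (simp add: endo_simps)
  also have "\<dots> = ?Ti (endo_apply EC g)"
    unfolding Lyapunov[OF g] by (simp add: endo_simps)
  finally have "?T h + ?Ti (N h) = ?Ti (endo_apply EC g)"
    unfolding opGamma_eq[OF hH] .
  then have "?Ti (?T h) + ?Ti (?Ti (N h)) = ?Ti (?Ti (endo_apply EC g))"
    by (metis endo_simps(2))
  moreover have "?Ti (?T h) = h"
    using arg_cong[OF ET_inverse(2), of "\<lambda>E. endo_apply E h" x t] by simp
  moreover have "?Ti (?Ti f) = endo_apply (ET (- 2 * x) (- 2 * t)) f" for f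
    using ET_add[of "- x" "- x" "- t" "- t"] by (simp flip: endo_apply_mult)
  ultimately show "h = endo_apply (ET (- 2 * x) (- 2 * t)) (endo_apply EC g - N h)"
    by (simp add: endo_simps eq_diff_eq)
qed

lemma mode_eq: "mode X f \<xi> = chan X (endo_apply (ET \<xi> 0) f)"
  by (simp add: mode_def op_exp_B)

lemma GLM_equation:
  fixes \<xi> :: real
  assumes g: "g \<in> H" and inv: "bij_betw (opGamma X U U x t) H H"
    and h: "h = opS X U U x t g - \<i> *\<^sub>C opB X g"
  defines "K \<equiv> \<lambda>\<eta> f. chan X (endo_apply (ET (- 2 * x + \<xi> + \<eta>) (- 2 * t)) (Fs (rowop (sigB X) (mode X f \<eta>))))"
  shows "(\<lambda>\<eta>. K \<eta> h) integrable_on {0..}"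
    and "mode X h \<xi> = - integral {0..} (\<lambda>\<eta>. K \<eta> h) + K 0 g"
proof -
  note hH = h_equation(1)[OF g inv h]
  let ?Z = "\<lambda>v. chan X (endo_apply (ET (- 2 * x + \<xi>) (- 2 * t)) v)"
  have Z: "bounded_linear ?Z"
    by (rule bounded_linear_compose[OF bounded_linear_chan bounded_linear_endo_apply])
  \<comment> \<open>The left exponential of \<open>\<phi>\<close> merges with the outer one,
    shifting the \<open>x\<close> parameter by \<open>\<eta>\<close>; the right exponential and
    \<open>C\<close> make up the mode.\<close>
  have K: "K \<eta> f = ?Z (\<phi> f \<eta>)" for \<eta> f
    using ET_add[of "- 2 * x + \<xi>" \<eta> "- 2 * t" 0]
    by (simp add: K_def \<phi>_def mode_eq EC_apply)
  have "(?Z \<circ> \<phi> h) integrable_on {0..}"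
    by (rule integrable_linear[OF \<phi>_integrable[OF hH] Z])
  then show "(\<lambda>\<eta>. K \<eta> h) integrable_on {0..}"
    by (simp add: K o_def)
  have "integral {0..} (\<lambda>\<eta>. K \<eta> h) = ?Z (N h)"
    using integral_linear[OF \<phi>_integrable[OF hH] Z] by (simp add: K[abs_def] o_def N_def)
  moreover have "K 0 g = ?Z (endo_apply EC g)"
    by (simp add: K \<phi>_def ET_zero)
  moreover have "mode X h \<xi> = ?Z (endo_apply EC g - N h)"
    unfolding mode_eq using arg_cong[OF h_equation(2)[OF g inv h], of "\<lambda>h. chan X (endo_apply (ET \<xi> 0) h)"]
      ET_add[of \<xi> "- 2 * x" 0 "- 2 * t"] by (simp add: add.commute)
  ultimately show "mode X h \<xi> = - integral {0..} (\<lambda>\<eta>. K \<eta> h) + K 0 g"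
    by (simp add: endo_simps linear_simps[OF bounded_linear_chan])
qed

end

end

section \<open>Unitary operators commuting with multiplication\<close>

lemma rep_L2_zero: "AE w in lebesgue. rep_L2 0 w = 0"
  using rep_L2_minus[of 0 0] by simp

lemma norm_multiplier_on:
  assumes D: "D \<in> sets lebesgue" and f: "f \<in> L2on D"
    and \<phi>: "bounded_measurable \<phi> c" and le: "\<And>w. w \<in> D \<Longrightarrow> \<bar>\<phi> w\<bar> \<le> d" "0 \<le> d"
  shows "norm (multiplier \<phi> f) \<le> d * norm f" "multiplier \<phi> f \<in> L2on D"
proof -
  have \<phi>D: "bounded_measurable (\<lambda>w. \<phi> w * indicator D w) d"
    using \<phi> D le by (auto simp: bounded_measurable_def indicator_def abs_mult)
  have "multiplier \<phi> f = multiplier \<phi> (multiplier (indicator D) f)"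
    using f by (simp add: mem_L2on_iff[OF D])
  also have "\<dots> = multiplier (\<lambda>w. \<phi> w * indicator D w) f"
    by (rule multiplier_multiplier[OF \<phi> bounded_measurable_indicator[OF D] \<phi>D])
  finally show "norm (multiplier \<phi> f) \<le> d * norm f"
    using norm_multiplier[OF \<phi>D] by simp
  show "multiplier \<phi> f \<in> L2on D"
    unfolding L2on_def vanishes_off.rep_eq mem_Collect_eq
    using rep_multiplier[OF \<phi>, of f] f[unfolded L2on_def vanishes_off.rep_eq mem_Collect_eq]
    by eventually_elim simp
qed

lemma multiplier_indicator_eq_0_imp:
  fixes f :: "'p::finite L2"
  assumes E: "E \<in> sets lebesgue" and 0: "multiplier (indicator E) f = 0" and f: "f \<in> L2on D"
  shows "f \<in> L2on (D - E)"
  unfolding L2on_def vanishes_off.rep_eq mem_Collect_eq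
  using rep_multiplier[OF bounded_measurable_indicator[OF E], of f, unfolded 0] rep_L2_zero[where ?'a = 'p]
    f[unfolded L2on_def vanishes_off.rep_eq mem_Collect_eq]
proof eventually_elim
  case (elim w)
  then show ?case by (cases "w \<in> E") simp_all
qed

text \<open>Powers of \<open>\<psi>\<close> shrink \<open>g\<close> at the rate \<open>\<delta>\<close>, but expand the part of
  \<open>V g\<close> where \<open>\<bar>\<psi>\<bar> \<ge> 2 * \<delta>\<close> at the rate \<open>2 * \<delta>\<close>.\<close>

lemma commuting_isometry_support:
  fixes V :: "'p::finite L2 \<Rightarrow> 'p L2"
  assumes \<psi>: "bounded_measurable \<psi> c" and \<delta>: "0 < \<delta>"
    and D: "D \<in> sets lebesgue" "\<And>w. w \<in> D \<Longrightarrow> \<bar>\<psi> w\<bar> \<le> \<delta>"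
    and E: "E \<in> sets lebesgue" "\<And>w. w \<in> E \<Longrightarrow> 2 * \<delta> \<le> \<bar>\<psi> w\<bar>"
    and V: "\<And>g. g \<in> L2on D \<Longrightarrow> norm (V g) \<le> norm g"
      "\<And>g. g \<in> L2on D \<Longrightarrow> V (multiplier \<psi> g) = multiplier \<psi> (V g)"
    and g: "g \<in> L2on D"
  shows "multiplier (indicator E) (V g) = 0"
proof -
  let ?s = "\<lambda>g. norm (multiplier (indicator E) (V g))"
  \<comment> \<open>The reciprocal of \<open>\<psi>\<close> cut off to \<open>E\<close>, where
    \<open>\<bar>\<psi>\<bar>\<close> is at least \<open>2 * \<delta>\<close>; it undoes one
    multiplication by \<open>\<psi>\<close> there.\<close>
  let ?i = "\<lambda>w. indicator E w / \<psi> w"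
  have bi: "bounded_measurable ?i (1 / (2 * \<delta>))"
  proof -
    have "\<bar>indicator E w / \<psi> w\<bar> \<le> 1 / (2 * \<delta>)" for w
      using E(2)[of w] \<delta> by (cases "w \<in> E") (auto simp: divide_simps abs_divide)
    then show ?thesis
      using \<psi> E(1) by (auto simp: bounded_measurable_def)
  qed
  have step: "2 * \<delta> * ?s g \<le> ?s (multiplier \<psi> g)" if "g \<in> L2on D" for g
  proof -
    have i\<psi>: "(\<lambda>w. ?i w * \<psi> w) = indicator E"
    proof
      fix w show "?i w * \<psi> w = indicator E w"
        using E(2)[of w] \<delta> by (cases "w \<in> E") auto
    qed
    have iE: "(\<lambda>w. ?i w * indicator E w) = ?i" by (auto simp: indicator_def)
    have "multiplier (indicator E) (V g) = multiplier ?i (multiplier \<psi> (V g))"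
      using multiplier_multiplier[OF bi \<psi>, of 1 "V g"] bounded_measurable_indicator[OF E(1)]
      unfolding i\<psi> by (simp only:)
    also have "\<dots> = multiplier ?i (V (multiplier \<psi> g))" by (simp add: V(2)[OF that])
    also have "\<dots> = multiplier ?i (multiplier (indicator E) (V (multiplier \<psi> g)))"
      using multiplier_multiplier[OF bi bounded_measurable_indicator[OF E(1)], of "1 / (2 * \<delta>)" "V (multiplier \<psi> g)"] bi
      unfolding iE by (simp only:)
    finally have "?s g \<le> 1 / (2 * \<delta>) * ?s (multiplier \<psi> g)"
      using norm_multiplier[OF bi] by simp
    then show ?thesis using \<delta> by (simp add: field_simps)
  qed
  have iter: "2 ^ n * ?s g \<le> norm g" if "g \<in> L2on D" for n g
    using that
  proof (induction n arbitrary: g)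
    case 0
    then show ?case
      using norm_multiplier[OF bounded_measurable_indicator[OF E(1)], of "V g"] V(1)[OF 0] by simp
  next
    case (Suc n)
    note \<psi>g = norm_multiplier_on[OF D(1) Suc.prems \<psi> D(2) less_imp_le[OF \<delta>]]
    have "\<delta> * (2 ^ Suc n * ?s g) = 2 ^ n * (2 * \<delta> * ?s g)" by simp
    also have "\<dots> \<le> 2 ^ n * ?s (multiplier \<psi> g)"
      by (intro mult_left_mono step Suc.prems) simp
    also have "\<dots> \<le> norm (multiplier \<psi> g)" by (rule Suc.IH[OF \<psi>g(2)])
    also have "\<dots> \<le> \<delta> * norm g" by (rule \<psi>g(1))
    finally show ?case using \<delta> by (simp only: mult_le_cancel_left_pos)
  qed
  have "?s g \<le> 0"
  proof (rule LIMSEQ_le_const)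
    show "(\<lambda>n. norm g * (1/2) ^ n) \<longlonglongrightarrow> 0"
      by (intro tendsto_mult_right_zero LIMSEQ_realpow_zero) auto
    show "\<exists>N. \<forall>n\<ge>N. ?s g \<le> norm g * (1/2) ^ n"
      using iter[OF g] by (intro exI[of _ 0]) (auto simp: field_simps)
  qed
  then show ?thesis by simp
qed

section \<open>The model as a colligation\<close>

context triangular_kernel
begin

text \<open>The adjoint of \<open>B\<close> in the form \<open>B - i \<Phi>\<^sup>* L \<Phi>\<close>, which makes the colligation condition immediate.\<close>

definition Bs :: "'p L2 \<Rightarrow> 'p L2"
  where "Bs f = model_op l L S0 \<pi> f - \<i> *\<^sub>C chan_star (model_chan l \<pi> f v* L)"

abbreviation B where "B \<equiv> model_op l L S0 \<pi>"

sublocale closed_subspace "L2on \<Delta>" "multiplier (indicator \<Delta>) :: 'p L2 \<Rightarrow> 'p L2"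
  by (rule closed_subspace.intro)
    (auto intro: multiplier_indicator_mem bounded_linear_multiplier[OF bounded_measurable_indicator[OF interval_sets]]
      multiplier_scaleC[OF bounded_measurable_indicator[OF interval_sets]] mem_L2on_iff[THEN iffD1])

lemma chan_star_mem: "chan_star y \<in> L2on \<Delta>"
  by (simp add: chan_star_def emb_mem)

lemma chan_star_add: "chan_star (y + z) = chan_star y + chan_star z"
  unfolding chan_star_def by (rule emb_add) simp_all

lemma chan_star_scaleC: "chan_star (c *s y) = c *\<^sub>C chan_star y"
  unfolding chan_star_def by (rule emb_scaleC) simp

lemma B_mem: "B f \<in> L2on \<Delta>"
  unfolding model_op_eq by (intro add_mem mult_var_mem volterra_mem)

lemma Bs_mem: "Bs f \<in> L2on \<Delta>"
  unfolding Bs_def by (intro diff_mem B_mem scaleC_mem chan_star_mem)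

text \<open>Multiplication by \<open>w\<close> is symmetric, and the defect of the integral part is
  given by \<open>cinner_volterra\<close>.\<close>

lemma cinner_B_Bs: "cinner (B f) g = cinner f (Bs g)"
proof -
  have "cinner (mult_var l f) g = cinner f (mult_var l g)"
    unfolding mult_var_eq cinner_multiplier[OF bounded_mult_var] ..
  moreover have "vdot (model_chan l \<pi> f v* L) (model_chan l \<pi> g) = vdot (model_chan l \<pi> f) (model_chan l \<pi> g v* L)"
    by (simp add: vdot_adjoint L_hermitian)
  moreover have "cinner f (- (\<i> *\<^sub>C k)) = \<i> * cinner f k" for k
    using cinner_scaleC_right[of f "- \<i>" k] by (simp add: scaleC_minus_left)
  ultimately show ?thesis
    by (simp add: Bs_def model_op_eq cinner_add_left cinner_add_right cinner_volterra cinner_chan_star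
        diff_conv_add_uminus del: add_uminus_conv_diff)
qed

lemma adj_B_eq: "adj (L2on \<Delta>) B g = Bs g"
  by (rule adj_eqI[OF Bs_mem cinner_B_Bs])

text \<open>The constant is uniform in \<open>D\<close>, so the integral part can be made as small
  as desired by shrinking the support.\<close>

lemma volterra_small:
  "\<exists>C\<ge>0. \<forall>D f. D \<in> lmeasurable \<longrightarrow> f \<in> L2on D \<longrightarrow> norm (volterra f) \<le> C * sqrt (measure lebesgue D) * norm f"
proof -
  obtain c where c: "\<And>f. norm (volterra f) \<le> c * (LINT w|lebesgue. norm (density f w))"
    using norm_volterra_le by blast
  have "norm (volterra f) \<le> max c 0 * \<kappa> * sqrt (measure lebesgue D) * norm f"
    if "D \<in> lmeasurable" "f \<in> L2on D" for D f
  proof -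
    have "0 \<le> (LINT w|lebesgue. norm (density f w))" by (rule integral_nonneg_AE) simp
    then have "c * (LINT w|lebesgue. norm (density f w)) \<le> max c 0 * (LINT w|lebesgue. norm (density f w))"
      by (intro mult_right_mono) auto
    also have "\<dots> \<le> max c 0 * (\<kappa> * sqrt (measure lebesgue D) * norm f)"
      by (intro mult_left_mono density_L1 that) simp
    finally show ?thesis using c[of f] by (simp add: mult.assoc)
  qed
  then show ?thesis
    using \<kappa>_nonneg by (intro exI[of _ "max c 0 * \<kappa>"]) auto
qed


definition chan3 :: "'p L2 \<Rightarrow> complex^(3 \<times> 'm)"
  where "chan3 f = stack3 (vector [model_chan l \<pi> f, model_chan l \<pi> (Bs f), model_chan l \<pi> (Bs (Bs f))])"

definition part :: "3 \<Rightarrow> complex^(3 \<times> 'm) \<Rightarrow> complex^'m"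
  where "part k y = (\<chi> i. y $ (k, i))"

text \<open>The adjoint of \<open>chan3\<close>: a component of the channel that applies
  \<open>Bs\<close> \<open>k\<close> times contributes \<open>k\<close> factors \<open>B\<close>
  after \<open>chan_star\<close>.\<close>

definition Fs :: "complex^(3 \<times> 'm) \<Rightarrow> 'p L2"
  where "Fs y = chan_star (part 1 y) + B (chan_star (part 2 y)) + B (B (chan_star (part 3 y)))"

lemma chan_star_zero: "chan_star 0 = 0"
  using chan_star_scaleC[of 0 0] scaleR_scaleC[of 0 "chan_star 0"] by simp

lemma Bs_scaleC: "Bs (c *\<^sub>C f) = c *\<^sub>C Bs f"
  by (simp add: scaleC_diff_right Bs_def model_op_scaleC model_chan_scaleC vector_matrix_cmult_left chan_star_scaleC mult.commute)

lemma bounded_linear_chan_star: "bounded_linear chan_star"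
proof -
  have "linear chan_star"
    by (rule linearI) (simp_all add: chan_star_add scaleR_cmult_vec chan_star_scaleC scaleR_scaleC)
  then show ?thesis by (simp add: linear_conv_bounded_linear)
qed

lemma bounded_linear_Bs: "bounded_linear Bs"
  unfolding Bs_def[abs_def]
  by (intro bounded_linear_sub bounded_linear_model_op bounded_linear_compose[OF bounded_linear_scaleC]
      bounded_linear_compose[OF bounded_linear_chan_star] bounded_linear_compose[OF bounded_linear_vector_matrix]
      bounded_linear_model_chan)

definition inject :: "3 \<Rightarrow> complex^'m \<Rightarrow> complex^(3 \<times> 'm)"
  where "inject k u = (\<chi> p. if fst p = k then u $ snd p else 0)"

lemma bounded_linear_inject: "bounded_linear (inject k)"
proof -
  have "linear (inject k)"
    by (rule linearI) (simp_all add: inject_def vec_eq_iff)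
  then show ?thesis by (simp add: linear_conv_bounded_linear)
qed

lemma bounded_linear_part: "bounded_linear (part k)"
proof -
  have "linear (part k)"
    by (rule linearI) (simp_all add: part_def vec_eq_iff)
  then show ?thesis by (simp add: linear_conv_bounded_linear)
qed

text \<open>Writes the stacked channel as a sum of compositions of bounded linear maps.\<close>

lemma chan3_inject:
  "chan3 f = inject 1 (model_chan l \<pi> f) + inject 2 (model_chan l \<pi> (Bs f)) + inject 3 (model_chan l \<pi> (Bs (Bs f)))"
proof -
  have "vector [u, v, w] $ k = (if k = 1 then u else 0) + (if k = 2 then v else 0) + (if k = 3 then w else 0)"
    for u v w :: "complex^'m" and k :: 3
    using exhaust_3[of k] by (auto simp: vector_3)
  then show ?thesis
    by (auto simp: chan3_def stack3_def inject_def vec_eq_iff)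
qed

lemma bounded_linear_chan3: "bounded_linear chan3"
  unfolding chan3_inject[abs_def]
  by (intro bounded_linear_add bounded_linear_compose[OF bounded_linear_inject]
      bounded_linear_compose[OF bounded_linear_model_chan] bounded_linear_compose[OF bounded_linear_Bs]
      bounded_linear_Bs bounded_linear_model_chan)

lemma chan3_scaleC: "chan3 (c *\<^sub>C f) = c *s chan3 f"
  by (simp add: chan3_inject model_chan_scaleC Bs_scaleC) (simp add: inject_def vec_eq_iff)

lemma part_chan3:
  "part 1 (chan3 f) = model_chan l \<pi> f" "part 2 (chan3 f) = model_chan l \<pi> (Bs f)"
  "part 3 (chan3 f) = model_chan l \<pi> (Bs (Bs f))"
  by (simp_all add: part_def chan3_def stack3_def vec_eq_iff vector_3)

lemma vdot_part: "vdot u v = vdot (part 1 u) (part 1 v) + vdot (part 2 u) (part 2 v) + vdot (part 3 u) (part 3 v)"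
proof -
  have "vdot u v = (\<Sum>k\<in>UNIV. \<Sum>i\<in>UNIV. u $ (k, i) * cnj (v $ (k, i)))"
    unfolding vdot_def by (simp add: sum.cartesian_product)
  then show ?thesis by (simp add: sum_3 vdot_def part_def)
qed

lemma cinner_Bs_B: "cinner f (B g) = cinner (Bs f) g"
  by (simp only: cinner_commute[of f "B g"] cinner_B_Bs cinner_commute[of "Bs f" g])

lemma Fs_adjoint: "vdot (chan3 f) y = cinner f (Fs y)"
  by (simp add: vdot_part[of "chan3 f"] part_chan3 Fs_def cinner_add_right cinner_Bs_B cinner_chan_star)

lemma bounded_linear_Fs: "bounded_linear Fs"
  unfolding Fs_def[abs_def]
  by (intro bounded_linear_add bounded_linear_compose[OF bounded_linear_model_op]
      bounded_linear_compose[OF bounded_linear_chan_star] bounded_linear_part)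

lemma Fs_scale: "Fs (c *s y) = c *\<^sub>C Fs y"
proof -
  have "part k (c *s y) = c *s part k y" for k by (simp add: part_def vec_eq_iff)
  then show ?thesis by (simp add: Fs_def chan_star_scaleC model_op_scaleC scaleC_add_right)
qed

lemma Fs_mem: "Fs y \<in> L2on \<Delta>"
  unfolding Fs_def by (intro add_mem chan_star_mem B_mem)

definition sigma_B :: "complex^(3 \<times> 'm)^(3 \<times> 'm)"
  where "sigma_B = block3 (vector [vector [L, 0, 0], vector [0, 0, 0], vector [0, 0, 0]])"

lemma rowop_sigma_B: "part 1 (rowop sigma_B y) = part 1 y v* L" "part 2 (rowop sigma_B y) = 0" "part 3 (rowop sigma_B y) = 0"
proof -
  have row: "rowop sigma_B y $ (k', i') = (\<Sum>k\<in>UNIV. \<Sum>i\<in>UNIV. y $ (k, i) * sigma_B $ (k, i) $ (k', i'))" for k' i'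
    unfolding vector_matrix_nth by (simp add: sum.cartesian_product)
  have "rowop sigma_B y $ (k, i) = (if k = 1 then (part 1 y v* L) $ i else 0)" for k i
    using exhaust_3[of k] unfolding row unfolding sum_3
    by (auto simp: vector_matrix_nth part_def sigma_B_def block3_def vector_3)
  then show "part 1 (rowop sigma_B y) = part 1 y v* L" "part 2 (rowop sigma_B y) = 0" "part 3 (rowop sigma_B y) = 0"
    unfolding part_def by (simp_all add: vec_eq_iff)
qed

text \<open>\<open>sigma_B\<close> is supported in its first block, so only
  \<open>Phi* L Phi\<close> survives, and \<open>Bs\<close> was defined by subtracting precisely
  this.\<close>

lemma node_identity: "Fs (rowop sigma_B (chan3 f)) = (- \<i>) *\<^sub>C (B f - Bs f)"
  by (simp add: Fs_def rowop_sigma_B part_chan3 chan_star_zero linear_simps[OF bounded_linear_model_op] Bs_def)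

lemma model_colligation_fields:
  "hspace (model_colligation l b L S0 \<pi>) = L2on \<Delta>"
  "opA (model_colligation l b L S0 \<pi>) = (\<lambda>f. b *\<^sub>R B (B (B f)))"
  "opB (model_colligation l b L S0 \<pi>) = B"
  "chan (model_colligation l b L S0 \<pi>) = chan3"
  "sigB (model_colligation l b L S0 \<pi>) = sigma_B"
  by (simp_all only: model_colligation_def Let_def colligation.simps chan3_def[abs_def] adj_B_eq sigma_B_def)

lemma colligation_node:
  "colligation_node (L2on \<Delta>) (multiplier (indicator \<Delta>)) (model_colligation l b L S0 \<pi>) b Bs Fs"
  by (intro colligation_node.intro colligation_node_axioms.intro closed_subspace_axioms,
      unfold model_colligation_fields)
    (rule refl bounded_linear_model_op model_op_scaleC B_mem bounded_linear_chan3
      chan3_scaleC bounded_linear_Fs Fs_scale Fs_mem Fs_adjoint Bs_mem cinner_B_Bs node_identity)+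

text \<open>Near the point \<open>l / 2\<close> the quadratic form of multiplication is at least
  \<open>3 * l / 8\<close> times the squared norm, while the symmetry forces twice this form to be
  at most \<open>4 * C * s < l / 2\<close> times it.\<close>

lemma no_commuting_unitary:
  fixes U :: "'p L2 \<Rightarrow> 'p L2"
  assumes symmetric: "symmetric_node (L2on \<Delta>) (multiplier (indicator \<Delta>)) X b Bs F U" "opB X = B"
    and commute: "\<And>f. f \<in> L2on \<Delta> \<Longrightarrow> U (mult_var l f) = mult_var l (U f)"
  shows False
proof -
  interpret symmetric_node "L2on \<Delta>" "multiplier (indicator \<Delta>)" X b Bs F U by (rule symmetric(1))
  let ?H = "L2on \<Delta> :: 'p L2 set"
  obtain C where C: "0 \<le> C"
    "\<And>D f. D \<in> lmeasurable \<Longrightarrow> f \<in> L2on D \<Longrightarrow> norm (volterra f) \<le> C * sqrt (measure lebesgue D) * norm f"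
    using volterra_small by blast
  \<comment> \<open>Chosen so that \<open>8 * C * s < l\<close>; the summand 1 covers the case
    \<open>C = 0\<close>.\<close>
  define s where "s = l / (16 * (C + 1))"
  \<comment> \<open>The bound \<open>l / 8\<close> keeps \<open>D'\<close> inside
    \<open>\<Delta>\<close> and \<open>\<psi>\<close> small on \<open>D\<close>; the bound by the
    square of \<open>s\<close> gives \<open>sqrt (4 * \<delta>) \<le> 2 * s\<close> for the integral
    part.\<close>
  define \<delta> where "\<delta> = min (l / 8) (s\<^sup>2)"
  have s: "0 < s" "8 * C * s < l"
    using l_pos C(1) by (auto simp: s_def field_simps intro: add_pos_nonneg)
  have \<delta>: "0 < \<delta>" "\<delta> \<le> l / 8" "sqrt \<delta> \<le> s"
    using l_pos s(1) by (auto simp: \<delta>_def intro: real_le_lsqrt)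
  define D where "D = {l / 2 - \<delta>..l / 2 + \<delta>}"
  define D' where "D' = {l / 2 - 2 * \<delta>..l / 2 + 2 * \<delta>}"
  \<comment> \<open>Multiplication shifted to vanish at the common centre of \<open>D\<close> and
    \<open>D'\<close>, so these intervals are described by the size of
    \<open>\<psi>\<close>.\<close>
  define \<psi> where "\<psi> w = (if w \<in> \<Delta> then w else 0) - l / 2" for w
  have sub: "D \<subseteq> D'" "D' \<subseteq> \<Delta>"
    using \<delta> l_pos by (auto simp: D_def D'_def)
  have meas: "D \<in> lmeasurable" "D' \<in> lmeasurable" "measure lebesgue D = 2 * \<delta>" "measure lebesgue D' = 4 * \<delta>"
    using \<delta> by (auto simp: D_def D'_def)
  have mono: "L2on A \<subseteq> (L2on A' :: 'p L2 set)" if "A \<subseteq> A'" for A A'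
    using that by (auto simp: L2on_def vanishes_off.rep_eq elim!: eventually_mono)
  have \<psi>: "bounded_measurable \<psi> (2 * l)"
    using bounded_mult_var l_pos by (auto simp: \<psi>_def[abs_def] bounded_measurable_def)
  have \<psi>D: "\<bar>\<psi> w\<bar> \<le> \<delta>" if "w \<in> D" for w
  proof -
    have "w \<in> \<Delta>" using that sub by blast
    then show ?thesis using that by (auto simp: \<psi>_def D_def)
  qed
  have Q\<psi>: "multiplier \<psi> f = mult_var l f - (l / 2) *\<^sub>R f" for f :: "'p L2"
  proof (rule rep_L2_eqI)
    show "AE w in lebesgue. rep_L2 (multiplier \<psi> f) w = rep_L2 (mult_var l f - (l / 2) *\<^sub>R f) w"
      unfolding scaleR_scaleC mult_var_eq
      using rep_multiplier[OF \<psi>, of f] rep_multiplier[OF bounded_mult_var, of f]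
        rep_L2_minus[of "multiplier (\<lambda>w. if w \<in> \<Delta> then w else 0) f" "complex_of_real (l / 2) *\<^sub>C f"]
        rep_L2_scaleC[of "complex_of_real (l / 2)" f]
      by eventually_elim (simp only: \<psi>_def scaleR_left_diff_distrib scaleR_cmult_vec[of "l / 2"])
  qed
  have VQ: "V (mult_var l f) = mult_var l (V f)" if "f \<in> ?H" for f
    using commute[OF that] that mult_var_mem[of f] by (simp add: V_eq)
  have V\<psi>: "V (multiplier \<psi> f) = multiplier \<psi> (V f)" if "f \<in> ?H" for f
    unfolding Q\<psi> using VQ[OF that] by (simp add: linear_simps[OF bounded_linear_V])
  obtain g :: "'p L2" where g: "g \<in> L2on D" "g \<noteq> 0"
    using L2on_nontrivial[of D] meas \<delta>(1) by auto
  have DH: "L2on D \<subseteq> ?H" "L2on D' \<subseteq> ?H" using mono sub by blast+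
  then have gH: "g \<in> ?H" using g by blast
  \<comment> \<open>\<open>D'\<close> has twice the radius of \<open>D\<close>, matching the gap
    between \<open>\<delta>\<close> and \<open>2 * \<delta>\<close> in
    \<open>commuting_isometry_support\<close>.\<close>
  have "multiplier (indicator (\<Delta> - D')) (V g) = 0"
  proof (rule commuting_isometry_support[OF \<psi> \<delta>(1) _ _ _ _ _ _ g(1)])
    show "\<bar>\<psi> w\<bar> \<le> \<delta>" if "w \<in> D" for w
      by (rule \<psi>D[OF that])
    show "2 * \<delta> \<le> \<bar>\<psi> w\<bar>" if "w \<in> \<Delta> - D'" for w
      using that by (auto simp: \<psi>_def D'_def)
    show "norm (V f) \<le> norm f" if "f \<in> L2on D" for f using that DH norm_V by auto
    show "V (multiplier \<psi> f) = multiplier \<psi> (V f)" if "f \<in> L2on D" for f using that DH V\<psi> by auto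
  qed (use meas in auto)
  then have "V g \<in> L2on (\<Delta> - (\<Delta> - D'))"
    using meas by (intro multiplier_indicator_eq_0_imp V_mem) auto
  also have "\<Delta> - (\<Delta> - D') = D'" using sub by auto
  finally have Vg: "V g \<in> L2on D'" .
  have small: "\<bar>Re (cinner (volterra f) f)\<bar> \<le> 2 * C * s * (norm f)\<^sup>2" if "f \<in> L2on D'" for f
  proof -
    have "\<bar>Re (cinner (volterra f) f)\<bar> \<le> norm (volterra f) * norm f"
      using abs_Re_le_cmod Cauchy_Schwarz_cinner order_trans by blast
    also have "\<dots> \<le> (C * sqrt (4 * \<delta>) * norm f) * norm f"
      using C(2)[OF meas(2) that] meas(4) by (intro mult_right_mono) auto
    also have "\<dots> = 2 * C * sqrt \<delta> * (norm f)\<^sup>2"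
      by (simp add: real_sqrt_mult power2_eq_square)
    also have "\<dots> \<le> 2 * C * s * (norm f)\<^sup>2"
      using \<delta>(3) C(1) by (intro mult_right_mono mult_left_mono) auto
    finally show ?thesis .
  qed
  have ng: "norm (V g) = norm g" by (rule norm_V[OF gH])
  let ?q = "Re (cinner (mult_var l g) g)"
  have "cinner (B (V g)) (V g) = - cinner (V g) (V (B g))"
    using cinner_B[OF V_mem gH, of g] symmetric(2) by simp
  also have "\<dots> = - cnj (cinner (B g) g)"
    using cinner_V[OF gH B_mem, of g] cinner_commute[of g "B g"] by (simp add: symmetric(2))
  finally have "Re (cinner (B (V g)) (V g)) + Re (cinner (B g) g) = 0" by simp
  \<comment> \<open>Commutation makes the multiplication terms for \<open>g\<close> and
    \<open>V g\<close> equal, so they add up instead of cancelling and only the integral parts can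
    balance them.\<close>
  moreover have "cinner (mult_var l (V g)) (V g) = cinner (mult_var l g) g"
    unfolding VQ[OF gH, symmetric] by (rule cinner_V[OF mult_var_mem gH])
  ultimately have "2 * ?q = - Re (cinner (volterra g) g) - Re (cinner (volterra (V g)) (V g))"
    by (simp add: model_op_eq cinner_add_left)
  then have upper: "2 * ?q \<le> 4 * C * s * (norm g)\<^sup>2"
    using small[of g] small[OF Vg] g(1) mono[OF sub(1)] unfolding ng by auto
  have "\<bar>Re (cinner (multiplier \<psi> g) g)\<bar> \<le> norm (multiplier \<psi> g) * norm g"
    using abs_Re_le_cmod Cauchy_Schwarz_cinner order_trans by blast
  also have "\<dots> \<le> (l / 8 * norm g) * norm g"
  proof (intro mult_right_mono norm_multiplier_on(1)[OF _ g(1) \<psi>])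
    show "\<bar>\<psi> w\<bar> \<le> l / 8" if "w \<in> D" for w
      using \<psi>D[OF that] \<delta>(2) by simp
  qed (use meas l_pos in auto)
  finally have "\<bar>Re (cinner (multiplier \<psi> g) g)\<bar> \<le> l / 8 * (norm g)\<^sup>2"
    by (simp add: power2_eq_square)
  moreover have "cinner (mult_var l g) g = cinner (multiplier \<psi> g + (l / 2) *\<^sub>R g) g"
    by (simp add: Q\<psi>)
  then have "?q = Re (cinner (multiplier \<psi> g) g) + l / 2 * (norm g)\<^sup>2"
    by (simp add: cinner_add_left scaleR_scaleC cinner_scaleC_left power2_norm_eq_inner inner_L2_def)
  ultimately have "2 * (l / 2 * (norm g)\<^sup>2 - l / 8 * (norm g)\<^sup>2) \<le> 2 * ?q"
    by (simp add: abs_le_iff algebra_simps)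
  with upper have "(3 * l / 4) * (norm g)\<^sup>2 \<le> (4 * C * s) * (norm g)\<^sup>2"
    by (simp add: algebra_simps)
  then have "3 * l / 4 \<le> 4 * C * s"
    by (rule mult_right_le_imp_le) (use g(2) in simp)
  with s(2) l_pos show False by linarith
qed

end

text \<open>The trace of \<open>hconj (\<pi> w) ** \<pi> w\<close> is the sum of the squared moduli
  of all entries of \<open>\<pi> w\<close>; being 1, it bounds each entry.\<close>

lemma triangular_kernel_of_data:
  assumes "triangular_data l R L S0 \<pi>" shows "triangular_kernel l L \<pi>"
proof
  show "cmod (\<pi> w $ k $ j) \<le> 1" if "w \<in> {-l..l}" for w k j
  proof -
    have "(\<Sum>j\<in>UNIV. \<Sum>k\<in>UNIV. (cmod (\<pi> w $ k $ j))\<^sup>2) = (1 :: real)"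
    proof -
      have "trace (hconj (\<pi> w) ** \<pi> w) = (\<Sum>j\<in>UNIV. \<Sum>k\<in>UNIV. of_real ((cmod (\<pi> w $ k $ j))\<^sup>2))"
        by (simp add: trace_def matrix_matrix_mult_def hconj_def complex_norm_square mult.commute del: of_real_power)
      moreover have "trace (hconj (\<pi> w) ** \<pi> w) = 1"
        using assms that by (auto simp: triangular_data_def)
      ultimately have "of_real (\<Sum>j\<in>UNIV. \<Sum>k\<in>UNIV. (cmod (\<pi> w $ k $ j))\<^sup>2) = (1 :: complex)"
        by simp
      then show ?thesis by (simp only: of_real_eq_1_iff)
    qed
    moreover have "(cmod (\<pi> w $ k $ j))\<^sup>2 \<le> (\<Sum>k\<in>UNIV. (cmod (\<pi> w $ k $ j))\<^sup>2)"
      by (rule member_le_sum) auto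
    moreover have "(\<Sum>k\<in>UNIV. (cmod (\<pi> w $ k $ j))\<^sup>2) \<le> (\<Sum>j\<in>UNIV. \<Sum>k\<in>UNIV. (cmod (\<pi> w $ k $ j))\<^sup>2)"
      by (rule member_le_sum) (auto intro: sum_nonneg)
    ultimately have "(cmod (\<pi> w $ k $ j))\<^sup>2 \<le> 1\<^sup>2" by simp
    then show ?thesis by (rule power2_le_imp_le) simp
  qed
qed (use assms in \<open>auto simp: triangular_data_def\<close>)

text \<open>In the equation for the mode the radius is a function of the \<open>x\<close> parameter:
  \<open>-2 * x + \<xi> + \<eta>\<close> is unbounded over the integration, and the lower bound
  imposed on the radius grows with it.\<close>

theorem theorem3p4:
  fixes l b :: real and R :: "'m::finite set" and L S0 :: "complex^'m^'m"
    and \<pi> :: "real \<Rightarrow> complex^'m^'p" and U :: "'p L2 \<Rightarrow> 'p L2"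
    and X :: "('p, 3 \<times> 'm) colligation" and H :: "'p L2 set" and B :: "'p L2 \<Rightarrow> 'p L2"
  assumes model: "triangular_data l R L S0 \<pi>"
    and colligation: "X = model_colligation l b L S0 \<pi>"
    and H_B: "H = hspace X" "B = opB X"
    and unitary: "unitary_on H U"
    and symmetry: "\<forall>f\<in>H. adj H B f = - U (B (adj H U f))"
  shows "\<exists>a>0.
    (\<forall>x t r. a * sqrt (\<bar>t\<bar>\<^sup>2 + \<bar>x\<bar>\<^sup>2) < r \<longrightarrow>
      (\<forall>\<mu>. cmod \<mu> = r \<longrightarrow> invertible_on H (pencil X t x \<mu>)) \<and>
      (\<forall>i j. (\<lambda>\<mu>. exp (\<i> * \<mu>) * char_fun X t x \<mu> $ i $ j) contour_integrable_on circlepath 0 r) \<and>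
      (invertible (sig X t x) \<longrightarrow>
        (\<forall>g'. Psi X (adj H U \<circ> U) x t g' =
          (1 / (2 * pi)) *\<^sub>R rowop (char_integral X t x r)
            (rowop (matrix_inv (sig X t x)) (rowop (sigB X) g')))))
    \<and>
    ((\<forall>f\<in>H. U (mult_var l f) = mult_var l (U f)) \<or> M_strongly_convergent X U \<longrightarrow>
     (\<forall>x t \<xi> g h r.
        invertible_on H (opGamma X U U x t) \<and>
        (\<forall>\<eta>\<ge>0. invertible (sig X (-2 * t) (-2 * x + \<xi> + \<eta>))) \<and>
        (\<forall>y. a * sqrt (\<bar>-2 * t\<bar>\<^sup>2 + \<bar>y\<bar>\<^sup>2) < r y) \<and>
        g \<in> nonhermitian_range X \<and>
        h = opS X U U x t g - \<i> *\<^sub>C B g \<longrightarrow>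
        (let F = (\<lambda>\<eta>. rowop (char_integral X (-2 * t) (-2 * x + \<xi> + \<eta>) (r (-2 * x + \<xi> + \<eta>)))
               (rowop (matrix_inv (sig X (-2 * t) (-2 * x + \<xi> + \<eta>))) (rowop (sigB X) (mode X h \<eta>))))
         in F integrable_on {0..} \<and>
            mode X h \<xi> = - ((1 / (2 * pi)) *\<^sub>R integral {0..} F)
              + (1 / (2 * pi)) *\<^sub>R rowop (char_integral X (-2 * t) (-2 * x + \<xi>) (r (-2 * x + \<xi>)))
                  (rowop (matrix_inv (sig X (-2 * t) (-2 * x + \<xi>))) (rowop (sigB X) (mode X g 0))))))"
proof -
  interpret triangular_kernel l L S0 \<pi> by (rule triangular_kernel_of_data[OF model])
  interpret node: colligation_node "L2on {-l..l}" "multiplier (indicator {-l..l})" X b Bs Fs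
    unfolding colligation by (rule colligation_node)
  have H: "H = L2on {-l..l}" and B: "B = model_op l L S0 \<pi>"
    unfolding H_B colligation model_colligation_fields by simp_all
  have hsp: "hspace X = H" by (simp add: H_B)
  interpret node: symmetric_node "L2on {-l..l}" "multiplier (indicator {-l..l})" X b Bs Fs U
    by unfold_locales (use unitary symmetry in \<open>auto simp flip: H H_B\<close>)
  let ?W = "\<lambda>x t r y. rowop (char_integral X t x r) (rowop (matrix_inv (sig X t x)) y)"
  have W: "(1 / (2 * pi)) *\<^sub>R ?W x t r y = chan X (endo_apply (node.ET x t) (Fs y))"
    if "node.pencil_bound * sqrt (\<bar>t\<bar>\<^sup>2 + \<bar>x\<bar>\<^sup>2) < r" "invertible (sig X t x)" for x t r y
    using node.char_integral_apply_inv[OF node.norm_pen_less[OF that(1)] that(2)] by simp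
  have Psi: "Psi X (adj H U \<circ> U) x t y = chan X (endo_apply (node.ET x t) (Fs (rowop (sigB X) y)))" for x t y
  proof -
    have "adj H U (U f) = f" if "f \<in> H" for f
      using that node.V_eq[of f] node.V_mem[of f] by (simp add: H node.adj_U node.W_V flip: node.V_eq)
    then show ?thesis
      by (simp add: Psi_def hsp H node.chan_adj_eq node.opT_eq node.Fs_mem)
  qed
  show ?thesis
  proof (intro exI[of _ node.pencil_bound] conjI allI impI)
    show "0 < node.pencil_bound" by (rule node.pencil_bound_pos)
  next
    fix x t r \<mu> assume "node.pencil_bound * sqrt (\<bar>t\<bar>\<^sup>2 + \<bar>x\<bar>\<^sup>2) < r" "cmod \<mu> = r"
    then show "invertible_on H (pencil X t x \<mu>)"
      using node.pencil_bij node.norm_pen_less by (simp add: invertible_on_def H)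
  next
    fix x t r i j assume "node.pencil_bound * sqrt (\<bar>t\<bar>\<^sup>2 + \<bar>x\<bar>\<^sup>2) < r"
    then show "(\<lambda>\<mu>. exp (\<i> * \<mu>) * char_fun X t x \<mu> $ i $ j) contour_integrable_on circlepath 0 r"
      by (rule has_contour_integral_integrable[OF node.char_fun_contour[OF node.norm_pen_less]])
  next
    fix x t r g'
    assume "node.pencil_bound * sqrt (\<bar>t\<bar>\<^sup>2 + \<bar>x\<bar>\<^sup>2) < r" "invertible (sig X t x)"
    then show "Psi X (adj H U \<circ> U) x t g' = (1 / (2 * pi)) *\<^sub>R ?W x t r (rowop (sigB X) g')"
      by (simp only: W Psi)
  next
    fix x t \<xi> g h and r :: "real \<Rightarrow> real"
    assume "(\<forall>f\<in>H. U (mult_var l f) = mult_var l (U f)) \<or> M_strongly_convergent X U"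
    moreover have "opB X = model_op l L S0 \<pi>" using H_B B by simp
    then have "\<not> (\<forall>f\<in>H. U (mult_var l f) = mult_var l (U f))"
      using no_commuting_unitary[OF node.symmetric_node_axioms] by (auto simp: H)
    ultimately have conv: "M_strongly_convergent X U" by blast
    assume *: "invertible_on H (opGamma X U U x t) \<and>
        (\<forall>\<eta>\<ge>0. invertible (sig X (-2 * t) (-2 * x + \<xi> + \<eta>))) \<and>
        (\<forall>y. node.pencil_bound * sqrt (\<bar>-2 * t\<bar>\<^sup>2 + \<bar>y\<bar>\<^sup>2) < r y) \<and>
        g \<in> nonhermitian_range X \<and>
        h = opS X U U x t g - \<i> *\<^sub>C B g"
    then have inv: "bij_betw (opGamma X U U x t) (L2on {-l..l}) (L2on {-l..l})"
      and h: "h = opS X U U x t g - \<i> *\<^sub>C opB X g"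
      by (simp_all add: invertible_on_def H H_B(2))
    have g: "g \<in> L2on {-l..l}"
      using * by (auto simp: nonhermitian_range_def hsp H node.adj_B diff_mem node.B_mem node.Bs_mem)
    note GLM = node.GLM_equation[OF conv g inv h, of \<xi>]
    let ?F = "\<lambda>\<eta>. ?W (-2 * x + \<xi> + \<eta>) (-2 * t) (r (-2 * x + \<xi> + \<eta>)) (rowop (sigB X) (mode X h \<eta>))"
    \<comment> \<open>The kernel without the contour integral. \<open>?F\<close> agrees with
      \<open>2 * pi\<close> times it on \<open>{0..}\<close>, so integrability and value are
      transferred from \<open>GLM_equation\<close>.\<close>
    let ?K = "\<lambda>\<eta> f. chan X (endo_apply (node.ET (-2 * x + \<xi> + \<eta>) (-2 * t)) (Fs (rowop (sigB X) (mode X f \<eta>))))"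
    have W': "?W (-2 * x + \<xi> + \<eta>) (-2 * t) (r (-2 * x + \<xi> + \<eta>)) (rowop (sigB X) (mode X f \<eta>)) = (2 * pi) *\<^sub>R ?K \<eta> f"
      if "0 \<le> \<eta>" for \<eta> f
    proof -
      have "(1 / (2 * pi)) *\<^sub>R ?W (-2 * x + \<xi> + \<eta>) (-2 * t) (r (-2 * x + \<xi> + \<eta>)) (rowop (sigB X) (mode X f \<eta>)) = ?K \<eta> f"
        using * that by (intro W) auto
      from arg_cong[OF this, of "\<lambda>v. (2 * pi) *\<^sub>R v"] show ?thesis by simp
    qed
    have "(\<lambda>\<eta>. (2 * pi) *\<^sub>R ?K \<eta> h) integrable_on {0..}"
      by (rule integrable_cmul[OF GLM(1)])
    then have F: "?F integrable_on {0..}"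
      by (rule integrable_eq) (rule W'[symmetric], simp)
    have "integral {0..} ?F = integral {0..} (\<lambda>\<eta>. (2 * pi) *\<^sub>R ?K \<eta> h)"
      by (rule Henstock_Kurzweil_Integration.integral_cong) (rule W', simp)
    also have "\<dots> = (2 * pi) *\<^sub>R integral {0..} (\<lambda>\<eta>. ?K \<eta> h)"
      by (rule integral_cmul)
    finally have I: "integral {0..} (\<lambda>\<eta>. ?K \<eta> h) = (1 / (2 * pi)) *\<^sub>R integral {0..} ?F" by simp
    \<comment> \<open>The inhomogeneous term is the same kernel at \<open>\<eta> = 0\<close>,
      applied to \<open>g\<close>.\<close>
    have "?K 0 g = (1 / (2 * pi)) *\<^sub>R ?W (-2 * x + \<xi>) (-2 * t) (r (-2 * x + \<xi>)) (rowop (sigB X) (mode X g 0))"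
      using W'[of 0 g] by simp
    then have "mode X h \<xi> = - ((1 / (2 * pi)) *\<^sub>R integral {0..} ?F)
        + (1 / (2 * pi)) *\<^sub>R ?W (-2 * x + \<xi>) (-2 * t) (r (-2 * x + \<xi>)) (rowop (sigB X) (mode X g 0))"
      using GLM(2) unfolding I by simp
    then show "let F = ?F in F integrable_on {0..} \<and> mode X h \<xi> = - ((1 / (2 * pi)) *\<^sub>R integral {0..} F)
        + (1 / (2 * pi)) *\<^sub>R ?W (-2 * x + \<xi>) (-2 * t) (r (-2 * x + \<xi>)) (rowop (sigB X) (mode X g 0))"
      using F by (simp only: Let_def)
  qed
qed

end
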